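(* Let $n\ge 2$ and let $M$ be a closed embedded orientable $n$-dimensional $C^{n+1}$ hypersurface in $\mathbb{R}^{n+1}$. If the scalar curvature of $M$ (with the induced metric) is nonnegative everywhere, then, up to the choice of orientation, the mean curvature $H$ of $M$ has a sign, i.e., either $H\ge 0$ everywhere on $M$ or $H\le 0$ everywhere on $M$.
   Context: "Closed" means compact without boundary. The mean curvature of $M$ with respect to a continuous unit normal vector field $\nu$ is $H=-\mathrm{div}_0\,\nu$, where $\mathrm{div}_0$ is the Euclidean divergence; equivalently $H$ is the sum of the principal curvatures (spheres of radius $r$ have $H=n/r$ with respect to the inward unit normal). The scalar curvature is $R=H^2-|A|^2$ (Gauss equation), where $A$ is the second fundamental form. "Up to the choice of orientation" refers to the choice of $\nu$ (on each connected component, if $M$ is disconnected). *)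

theory Defs
  imports "HOL-Analysis.Analysis"
begin

section \<open>Hypersurfaces of class \<open>C\<^sup>k\<close> in a Euclidean space\<close>

text \<open>Meant for open \<open>U\<close>: the iterated directional derivatives of order less than \<open>k\<close> are
  differentiable on \<open>U\<close>, and those of order \<open>k\<close> are continuous.\<close>

fun Ck_on :: "nat \<Rightarrow> 'a::euclidean_space set \<Rightarrow> ('a \<Rightarrow> 'b::real_normed_vector) \<Rightarrow> bool" where
  "Ck_on 0 U f \<longleftrightarrow> continuous_on U f"
| "Ck_on (Suc k) U f \<longleftrightarrow>
     f differentiable_on U \<and> (\<forall>v. Ck_on k U (\<lambda>x. frechet_derivative f (at x) v))"

definition Ck_diffeomorphism ::
    "nat \<Rightarrow> 'a::euclidean_space set \<Rightarrow> 'a set \<Rightarrow> ('a \<Rightarrow> 'a) \<Rightarrow> ('a \<Rightarrow> 'a) \<Rightarrow> bool" where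
  "Ck_diffeomorphism k U V \<phi> \<psi> \<longleftrightarrow>
     open U \<and> open V \<and> homeomorphism U V \<phi> \<psi> \<and> Ck_on k U \<phi> \<and> Ck_on k V \<psi>"

text \<open>Embedded \<open>n\<close>-dimensional submanifolds without boundary, by slice charts. Closedness is
  not part of this notion.\<close>

definition embedded_submanifold :: "nat \<Rightarrow> nat \<Rightarrow> 'a::euclidean_space set \<Rightarrow> bool" where
  "embedded_submanifold k n M \<longleftrightarrow>
     (\<forall>p\<in>M. \<exists>U V \<phi> \<psi> S. p \<in> U \<and> Ck_diffeomorphism k U V \<phi> \<psi> \<and>
        subspace S \<and> dim S = n \<and> \<phi> ` (M \<inter> U) = V \<inter> S)"

definition tangent_space :: "'a::euclidean_space set \<Rightarrow> 'a \<Rightarrow> 'a set" where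
  "tangent_space M p =
     {v. \<exists>\<gamma>::real \<Rightarrow> 'a. \<gamma> 0 = p \<and> (\<forall>\<^sub>F t in nhds 0. \<gamma> t \<in> M) \<and>
         (\<gamma> has_vector_derivative v) (at 0)}"

definition unit_normal_field :: "'a::euclidean_space set \<Rightarrow> ('a \<Rightarrow> 'a) \<Rightarrow> bool" where
  "unit_normal_field M \<nu> \<longleftrightarrow>
     continuous_on M \<nu> \<and>
     (\<forall>p\<in>M. norm (\<nu> p) = 1 \<and> (\<forall>v\<in>tangent_space M p. \<nu> p \<bullet> v = 0))"

section \<open>Extrinsic curvature\<close>

definition orthonormal_basis_of :: "'a::euclidean_space set \<Rightarrow> 'a set \<Rightarrow> bool" where
  "orthonormal_basis_of V E \<longleftrightarrow>
     pairwise orthogonal E \<and> (\<forall>e\<in>E. norm e = 1) \<and> span E = V"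

definition tangent_frame :: "'a::euclidean_space set \<Rightarrow> 'a \<Rightarrow> 'a set" where
  "tangent_frame M p = (SOME E. orthonormal_basis_of (tangent_space M p) E)"

text \<open>A Frechet derivative within \<open>M\<close> is not unique, but any two agree on vectors tangent to
  \<open>M\<close> (\<open>frechet_derivative_tangent\<close> below); it is only applied to such vectors.\<close>

definition second_fundamental_form ::
    "'a::euclidean_space set \<Rightarrow> ('a \<Rightarrow> 'a) \<Rightarrow> 'a \<Rightarrow> 'a \<Rightarrow> 'a \<Rightarrow> real" where
  "second_fundamental_form M \<nu> p u v = - (frechet_derivative \<nu> (at p within M) u \<bullet> v)"

definition surface_divergence :: "'a::euclidean_space set \<Rightarrow> ('a \<Rightarrow> 'a) \<Rightarrow> 'a \<Rightarrow> real" where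
  "surface_divergence M X p =
     (\<Sum>e\<in>tangent_frame M p. frechet_derivative X (at p within M) e \<bullet> e)"

text \<open>For a unit normal field this is minus the Euclidean divergence of any unit extension of
  \<open>\<nu>\<close>, see \<open>mean_curvature_eq_divergence\<close>.\<close>

definition mean_curvature :: "'a::euclidean_space set \<Rightarrow> ('a \<Rightarrow> 'a) \<Rightarrow> 'a \<Rightarrow> real" where
  "mean_curvature M \<nu> p = - surface_divergence M \<nu> p"

definition norm_sq_second_fundamental_form ::
    "'a::euclidean_space set \<Rightarrow> ('a \<Rightarrow> 'a) \<Rightarrow> 'a \<Rightarrow> real" where
  "norm_sq_second_fundamental_form M \<nu> p =
     (\<Sum>e\<in>tangent_frame M p. \<Sum>f\<in>tangent_frame M p. (second_fundamental_form M \<nu> p e f)\<^sup>2)"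

text \<open>The scalar curvature of the induced metric, by the Gauss equation. It does not change
  when \<open>\<nu>\<close> is replaced by \<open>- \<nu>\<close>.\<close>

definition scalar_curvature :: "'a::euclidean_space set \<Rightarrow> ('a \<Rightarrow> 'a) \<Rightarrow> 'a \<Rightarrow> real" where
  "scalar_curvature M \<nu> p =
     (mean_curvature M \<nu> p)\<^sup>2 - norm_sq_second_fundamental_form M \<nu> p"

section \<open>Independence of the choices made above\<close>

lemma has_derivative_tangent:
  assumes "(f has_derivative D) (at p within M)"
    and "\<gamma> 0 = p" "\<forall>\<^sub>F t in nhds 0. \<gamma> t \<in> M" "(\<gamma> has_vector_derivative v) (at (0::real))"
  shows "((f \<circ> \<gamma>) has_vector_derivative D v) (at 0)"
proof -
  obtain T where T: "open T" "0 \<in> T" "\<And>t. t \<in> T \<Longrightarrow> \<gamma> t \<in> M"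
    using assms(3) unfolding eventually_nhds by blast
  have g: "(\<gamma> has_derivative (\<lambda>t. t *\<^sub>R v)) (at 0 within T)"
    using assms(4) has_derivative_at_withinI unfolding has_vector_derivative_def by blast
  have "(f has_derivative D) (at (\<gamma> 0) within \<gamma> ` T)"
    using assms(1,2) T(3) has_derivative_subset by (metis image_subsetI)
  from diff_chain_within[OF g this]
  have "((f \<circ> \<gamma>) has_derivative (\<lambda>t. D (t *\<^sub>R v))) (at 0 within T)"
    by (simp add: o_def)
  moreover have "D (t *\<^sub>R v) = t *\<^sub>R D v" for t
    using has_derivative_linear[OF assms(1)] linear_scale by blast
  ultimately show ?thesis
    unfolding has_vector_derivative_def using T by (simp add: at_within_open[of 0 T])
qed

lemma frechet_derivative_tangent:
  assumes D: "(f has_derivative D) (at p within M)" and v: "v \<in> tangent_space M p"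
  shows "frechet_derivative f (at p within M) v = D v"
proof -
  obtain \<gamma> where g: "\<gamma> 0 = p" "\<forall>\<^sub>F t in nhds 0. \<gamma> t \<in> M"
      "(\<gamma> has_vector_derivative v) (at (0::real))"
    using v by (auto simp: tangent_space_def)
  have "f differentiable (at p within M)"
    using D by (auto simp: differentiable_def)
  hence "(f has_derivative frechet_derivative f (at p within M)) (at p within M)"
    by (simp add: frechet_derivative_works)
  from has_derivative_tangent[OF this g] has_derivative_tangent[OF D g]
  show ?thesis by (rule vector_derivative_unique_at)
qed

lemma orthonormal_basis_of_finite:
  assumes "orthonormal_basis_of V E"
  shows "finite E"
proof -
  have "0 \<notin> E" using assms by (auto simp: orthonormal_basis_of_def)
  thus ?thesis using assms pairwise_orthogonal_imp_finite 
    by (auto simp: orthonormal_basis_of_def)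
qed

lemma orthonormal_basis_of_inner:
  assumes "orthonormal_basis_of V E" "e \<in> E" "f \<in> E"
  shows "e \<bullet> f = (if e = f then 1 else 0)"
  using assms unfolding orthonormal_basis_of_def pairwise_def orthogonal_def
  by (auto simp: norm_eq_1)

lemma orthonormal_basis_of_expand:
  assumes E: "orthonormal_basis_of V E" and x: "x \<in> V"
  shows "x = (\<Sum>e\<in>E. (x \<bullet> e) *\<^sub>R e)"
proof -
  have fin: "finite E" by (rule orthonormal_basis_of_finite[OF E])
  have "x \<in> span E" using E x by (auto simp: orthonormal_basis_of_def)
  then obtain c where c: "x = (\<Sum>e\<in>E. c e *\<^sub>R e)"
    using span_finite[OF fin] by auto
  have "x \<bullet> f = c f" if "f \<in> E" for f
  proof -
    have "x \<bullet> f = (\<Sum>e\<in>E. c e * (e \<bullet> f))"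
      unfolding c by (simp add: inner_sum_left)
    also have "\<dots> = (\<Sum>e\<in>E. if e = f then c e else 0)"
      by (rule sum.cong) (auto simp: orthonormal_basis_of_inner[OF E _ that])
    also have "\<dots> = c f" using fin that by simp
    finally show ?thesis .
  qed
  thus ?thesis using c by (metis (no_types, lifting) sum.cong)
qed

lemma trace_orthonormal_basis_of:
  fixes D :: "'a::euclidean_space \<Rightarrow> 'a"
  assumes E: "orthonormal_basis_of V E" and F: "orthonormal_basis_of V F" and D: "linear D"
  shows "(\<Sum>e\<in>E. D e \<bullet> e) = (\<Sum>f\<in>F. D f \<bullet> f)"
proof -
  have sub: "E \<subseteq> V" "F \<subseteq> V"
    using E F span_superset unfolding orthonormal_basis_of_def by metis+
  have "(\<Sum>e\<in>E. D e \<bullet> e) = (\<Sum>e\<in>E. \<Sum>f\<in>F. (e \<bullet> f) * (D f \<bullet> e))"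
  proof (rule sum.cong[OF refl])
    fix e assume "e \<in> E"
    have "D e = D (\<Sum>f\<in>F. (e \<bullet> f) *\<^sub>R f)"
      using orthonormal_basis_of_expand[OF F, of e] \<open>e \<in> E\<close> sub by auto
    also have "\<dots> = (\<Sum>f\<in>F. (e \<bullet> f) *\<^sub>R D f)"
      by (simp add: linear_sum[OF D] linear_scale[OF D])
    finally show "D e \<bullet> e = (\<Sum>f\<in>F. (e \<bullet> f) * (D f \<bullet> e))"
      by (simp add: inner_sum_left)
  qed
  also have "\<dots> = (\<Sum>f\<in>F. \<Sum>e\<in>E. (f \<bullet> e) * (D f \<bullet> e))"
    by (subst sum.swap) (simp add: inner_commute)
  also have "\<dots> = (\<Sum>f\<in>F. D f \<bullet> f)"
  proof (rule sum.cong[OF refl])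
    fix f assume "f \<in> F"
    have "D f \<bullet> f = D f \<bullet> (\<Sum>e\<in>E. (f \<bullet> e) *\<^sub>R e)"
      using orthonormal_basis_of_expand[OF E, of f] \<open>f \<in> F\<close> sub by auto
    thus "(\<Sum>e\<in>E. (f \<bullet> e) * (D f \<bullet> e)) = D f \<bullet> f"
      by (simp add: inner_sum_right)
  qed
  finally show ?thesis .
qed

lemma tangent_space_eq:
  fixes M :: "'a::euclidean_space set"
  assumes M: "embedded_submanifold (Suc k) n M" and dim: "DIM('a) = n + 1"
    and \<nu>: "unit_normal_field M \<nu>" and p: "p \<in> M"
  shows "tangent_space M p = {v. \<nu> p \<bullet> v = 0}"
proof
  show sub: "tangent_space M p \<subseteq> {v. \<nu> p \<bullet> v = 0}"
    using \<nu> p by (auto simp: unit_normal_field_def)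
  obtain U V \<phi> \<psi> S where pU: "p \<in> U" and d: "Ck_diffeomorphism (Suc k) U V \<phi> \<psi>"
    and S: "subspace S" "dim S = n" and img: "\<phi> ` (M \<inter> U) = V \<inter> S"
    using M p unfolding embedded_submanifold_def by blast
  have opn: "open U" "open V" and hom: "homeomorphism U V \<phi> \<psi>"
    and dphi: "\<phi> differentiable_on U" and dpsi: "\<psi> differentiable_on V"
    using d by (auto simp: Ck_diffeomorphism_def)
  define q where "q = \<phi> p"
  have q: "q \<in> V" "q \<in> S" "\<psi> q = p"
    using img p pU hom by (auto simp: q_def homeomorphism_def)
  obtain A where A: "(\<phi> has_derivative A) (at p)"
    using dphi pU opn by (metis differentiable_def differentiable_on_def at_within_open)
  obtain B where B: "(\<psi> has_derivative B) (at q)"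
    using dpsi q opn by (metis differentiable_def differentiable_on_def at_within_open)
  have "((\<phi> \<circ> \<psi>) has_derivative (A \<circ> B)) (at q)"
    using diff_chain_at[OF B] A q by auto
  moreover have "((\<phi> \<circ> \<psi>) has_derivative id) (at q)"
    by (rule has_derivative_transform_within_open[OF has_derivative_id opn(2) q(1)])
      (use hom in \<open>auto simp: homeomorphism_def\<close>)
  ultimately have "A \<circ> B = id" by (rule has_derivative_unique)
  hence inj: "inj B" by (metis inj_on_id inj_on_imageI2)
  have lin: "linear B" by (rule has_derivative_linear[OF B])
  have tan: "B w \<in> tangent_space M p" if "w \<in> S" for w
  proof -
    let ?c = "\<lambda>t::real. q + t *\<^sub>R w"
    have c: "(?c has_vector_derivative w) (at 0)"
      by (auto intro!: derivative_eq_intros)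
    have "open (?c -` V)"
      by (rule open_vimage[OF opn(2)]) (intro continuous_intros)
    hence "\<forall>\<^sub>F t in nhds 0. ?c t \<in> V"
      using eventually_nhds_in_open[of "?c -` V" 0] q(1) by simp
    moreover have "\<psi> (?c t) \<in> M" if "?c t \<in> V" for t
    proof -
      have "?c t \<in> V \<inter> S" using that q(2) \<open>w \<in> S\<close> S(1)
        by (simp add: subspace_add subspace_scale)
      then obtain m where "m \<in> M" "m \<in> U" "?c t = \<phi> m" using img by blast
      thus ?thesis using hom by (auto simp: homeomorphism_def)
    qed
    ultimately have ev: "\<forall>\<^sub>F t in nhds 0. (\<psi> \<circ> ?c) t \<in> M"
      by (auto elim: eventually_mono)
    have "((\<psi> \<circ> ?c) has_vector_derivative B w) (at 0)"
      by (rule has_derivative_tangent[where p = q and M = UNIV]) (use B c in auto)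
    thus ?thesis unfolding tangent_space_def using ev q(3)
      by (intro CollectI exI[of _ "\<psi> \<circ> ?c"]) auto
  qed
  have "norm (\<nu> p) = 1" using \<nu> p by (auto simp: unit_normal_field_def)
  hence "\<nu> p \<noteq> 0" by auto
  hence "dim {v. \<nu> p \<bullet> v = 0} = n"
    using dim_hyperplane dim by force
  moreover have "dim (B ` S) = n"
    using dim_image_eq[OF lin] inj S(2) by (metis inj_on_subset subset_UNIV)
  moreover have "subspace (B ` S)" using linear_subspace_image[OF lin S(1)] .
  moreover have "B ` S \<subseteq> {v. \<nu> p \<bullet> v = 0}" using tan sub by auto
  ultimately have "B ` S = {v. \<nu> p \<bullet> v = 0}"
    using subspace_dim_equal[of "B ` S" "{v. \<nu> p \<bullet> v = 0}"] subspace_hyperplane[of "\<nu> p"] by simp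
  thus "{v. \<nu> p \<bullet> v = 0} \<subseteq> tangent_space M p"
    using tan by (metis image_subsetI)
qed

lemma tangent_frame:
  fixes M :: "'a::euclidean_space set"
  assumes "subspace (tangent_space M p)"
  shows "orthonormal_basis_of (tangent_space M p) (tangent_frame M p)"
proof -
  obtain E where "pairwise orthogonal E" "\<And>x. x \<in> E \<Longrightarrow> norm x = 1" "span E = tangent_space M p"
    using orthonormal_basis_subspace[OF assms] by metis
  hence "\<exists>E. orthonormal_basis_of (tangent_space M p) E"
    by (auto simp: orthonormal_basis_of_def)
  thus ?thesis unfolding tangent_frame_def by (rule someI_ex)
qed

lemma mean_curvature_eq_divergence:
  fixes M :: "'a::euclidean_space set"
  assumes M: "embedded_submanifold (Suc k) n M" and dim: "DIM('a) = n + 1"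
    and \<nu>: "unit_normal_field M \<nu>" and p: "p \<in> M"
    and U: "open U" "p \<in> U" "\<And>x. x \<in> U \<Longrightarrow> norm (N x) = 1" "\<And>x. x \<in> M \<inter> U \<Longrightarrow> N x = \<nu> x"
    and N: "N differentiable (at p)"
  shows "mean_curvature M \<nu> p = - (\<Sum>b\<in>Basis. frechet_derivative N (at p) b \<bullet> b)"
proof -
  define D where "D = frechet_derivative N (at p)"
  have D: "(N has_derivative D) (at p)"
    using N by (simp add: D_def frechet_derivative_works)
  have lin: "linear D" by (rule has_derivative_linear[OF D])
  have Np: "N p = \<nu> p" and nrm: "norm (\<nu> p) = 1"
    using U p \<nu> by (auto simp: unit_normal_field_def)
  have "((\<lambda>x. N x \<bullet> N x) has_derivative (\<lambda>h. N p \<bullet> D h + D h \<bullet> N p)) (at p)"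
    using D by (intro has_derivative_inner)
  moreover have "((\<lambda>x. N x \<bullet> N x) has_derivative (\<lambda>h. 0)) (at p)"
    by (rule has_derivative_transform_within_open[OF has_derivative_const U(1,2)])
      (use U(3) in \<open>simp add: norm_eq_1\<close>)
  ultimately have "(\<lambda>h. N p \<bullet> D h + D h \<bullet> N p) = (\<lambda>h. 0)"
    by (rule has_derivative_unique)
  hence "N p \<bullet> D h + D h \<bullet> N p = 0" for h by metis
  hence orth: "D (\<nu> p) \<bullet> \<nu> p = 0" using Np 
    by (metis inner_commute mult_2 mult_eq_0_iff zero_neq_numeral)
  have "(N has_derivative D) (at p within M)"
    using D has_derivative_at_withinI by blast
  hence \<nu>D: "(\<nu> has_derivative D) (at p within M)"
  proof (rule has_derivative_transform_eventually)
    show "\<forall>\<^sub>F x in at p within M. N x = \<nu> x"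
      unfolding eventually_at_topological using U by blast
  qed (use Np p in auto)
  have T: "tangent_space M p = {v. \<nu> p \<bullet> v = 0}"
    by (rule tangent_space_eq[OF M dim \<nu> p])
  define E where "E = tangent_frame M p"
  have E: "orthonormal_basis_of {v. \<nu> p \<bullet> v = 0} E"
    using tangent_frame[of M p] by (simp add: E_def T subspace_hyperplane)
  have ET: "E \<subseteq> tangent_space M p"
    using E span_superset unfolding orthonormal_basis_of_def T by metis
  have nin: "\<nu> p \<notin> E" using ET nrm by (auto simp: T norm_eq_1)
  have "x \<in> span (insert (\<nu> p) E)" for x
  proof -
    have "x - (\<nu> p \<bullet> x) *\<^sub>R \<nu> p \<in> {v. \<nu> p \<bullet> v = 0}"
      using nrm by (simp add: inner_diff_right norm_eq_1)
    hence "x - (\<nu> p \<bullet> x) *\<^sub>R \<nu> p \<in> span E" using E by (simp add: orthonormal_basis_of_def)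
    thus ?thesis unfolding span_insert by blast
  qed
  hence "orthonormal_basis_of UNIV (insert (\<nu> p) E)"
    using E ET nrm unfolding orthonormal_basis_of_def pairwise_insert orthogonal_def T
    by (auto simp: inner_commute)
  moreover have "orthonormal_basis_of UNIV (Basis :: 'a set)"
    by (auto simp: orthonormal_basis_of_def pairwise_def orthogonal_def inner_Basis span_Basis)
  ultimately have "(\<Sum>b\<in>Basis. D b \<bullet> b) = (\<Sum>e\<in>insert (\<nu> p) E. D e \<bullet> e)"
    using trace_orthonormal_basis_of lin by blast
  also have "\<dots> = (\<Sum>e\<in>E. D e \<bullet> e)"
    using orthonormal_basis_of_finite[OF E] nin orth by simp
  also have "\<dots> = (\<Sum>e\<in>E. frechet_derivative \<nu> (at p within M) e \<bullet> e)"
    using frechet_derivative_tangent[OF \<nu>D] ET by (intro sum.cong) auto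
  finally show ?thesis
    by (simp add: mean_curvature_def surface_divergence_def E_def D_def)
qed

end

(* Where H = 0, the condition H^2 - |A|^2 >= 0 forces A = 0, so the normal has vanishing derivative
   there. By Morse-Sard the tangent plane is constant on every connected component Z of the set
   {H = 0}, and near Z the hypersurface is a graph over that plane. Where H > 0, the inequality
   H >= |A| makes the trace of A over each hyperplane of the tangent space nonnegative.

   The projection of the flat set to the plane does not separate its neighbourhood. Otherwise some
   complementary face Omega has a flat outer boundary. Extend the height function from Omega across
   each complementary island with flat frontier by the tangent plane along that frontier (constant,
   since the frontier is connected); A = 0 on the frontier, so the extension still has second
   differences. At a point p of the frontier of Omega farthest from the origin, the height over the
   outer tangent plane is nonpositive, by comparison with exponentials of |x + p|^2 and two
   nonnegative directions, and hence zero near p, by a Hopf barrier. So H = 0 at points of Omega,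
   a contradiction.

   Thus H has one sign near every component of the flat set, and by compactness one sign on every
   component of M. *)
theory Submission
  imports Defs
begin

section \<open>Calculus of \<open>C^k\<close> maps\<close>

text \<open>The class \<open>n + 1\<close> is dictated by Morse-Sard: it makes the unit normal of
  class \<open>n\<close>, the number of derivatives that a real function on an
  \<open>n\<close>-dimensional slice needs for negligible critical values. The obstacle is that the
  curvature inequality degenerates on the flat set, and that this set is merely compact: islands of
  no regularity may accumulate at a frontier point of a face. The comparison arguments therefore use
  symmetric second differences along lines, which the patched height has everywhere near the exposed
  point, and two pointwise conditions on them. One provides a nonnegative direction orthogonal to
  any prescribed vector; it beats a test function with negative second differences along the
  tangents of concentric spheres. The other is a trace bound; it beats the Hopf barrier. The centre
  \<open>- p\<close> of the spheres is chosen because the sphere about it through \<open>p\<close>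
  encloses the ball of radius \<open>norm p\<close> and meets its boundary at \<open>p\<close> only.
  A face with flat outer boundary exists for a topological reason: if two faces had none, each would
  sit in a hole of the other, which is impossible.\<close>

lemma Ck_on_SucI:
  fixes f :: "'a::euclidean_space \<Rightarrow> 'b::real_normed_vector"
  assumes U: "open U" and f: "\<And>x. x \<in> U \<Longrightarrow> (f has_derivative f' x) (at x)"
    and "\<And>v. Ck_on k U (\<lambda>x. f' x v)"
    and cong: "\<And>g h :: 'a \<Rightarrow> 'b. Ck_on k U g \<Longrightarrow> (\<And>x. x \<in> U \<Longrightarrow> g x = h x) \<Longrightarrow> Ck_on k U h"
  shows "Ck_on (Suc k) U f"
proof -
  have "f differentiable_on U"
    unfolding differentiable_on_def
    using f differentiable_at_withinI differentiableI by blast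
  moreover have "Ck_on k U (\<lambda>x. frechet_derivative f (at x) v)" for v
    by (rule cong[OF assms(3)[of v]]) (use frechet_derivative_at[OF f] in metis)
  ultimately show ?thesis by simp
qed

text \<open>\<open>Ck_on_SucI\<close> takes congruence at level \<open>k\<close> as a premise so
  that this induction can feed it its own hypothesis; \<open>Ck_on_intro\<close> is the same rule
  with that premise discharged.\<close>

lemma Ck_on_cong:
  fixes f g :: "'a::euclidean_space \<Rightarrow> 'b::real_normed_vector"
  assumes "open U" "Ck_on k U f" "\<And>x. x \<in> U \<Longrightarrow> f x = g x"
  shows "Ck_on k U g"
  using assms(2,3)
proof (induction k arbitrary: f g)
  case 0
  then show ?case by (metis Ck_on.simps(1) continuous_on_cong)
next
  case (Suc k)
  have d: "(f has_derivative frechet_derivative f (at x)) (at x)" if "x \<in> U" for x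
    using Suc.prems(1) that assms(1)
    by (metis Ck_on.simps(2) at_within_open differentiable_on_def frechet_derivative_works)
  have "(g has_derivative frechet_derivative f (at x)) (at x)" if "x \<in> U" for x
    by (rule has_derivative_transform_within_open[OF d[OF that] assms(1) that]) (rule Suc.prems(2))
  then show ?case
    by (rule Ck_on_SucI[OF assms(1)]) (use Suc in auto)
qed


lemma Ck_on_intro:
  fixes f :: "'a::euclidean_space \<Rightarrow> 'b::real_normed_vector"
  assumes U: "open U" and f: "\<And>x. x \<in> U \<Longrightarrow> (f has_derivative f' x) (at x)"
    and "\<And>v. Ck_on k U (\<lambda>x. f' x v)"
  shows "Ck_on (Suc k) U f"
  by (rule Ck_on_SucI[OF assms]) (use Ck_on_cong[OF U] in blast)+

lemma Ck_on_derivative: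
  fixes f :: "'a::euclidean_space \<Rightarrow> 'b::real_normed_vector"
  assumes "open U" "Ck_on (Suc k) U f" "x \<in> U"
  shows "(f has_derivative frechet_derivative f (at x)) (at x)"
  using assms by (metis Ck_on.simps(2) at_within_open differentiable_on_def frechet_derivative_works)

lemma Ck_on_derivative_Ck:
  assumes "open U" "Ck_on (Suc k) U f" "\<And>x. x \<in> U \<Longrightarrow> (f has_derivative f' x) (at x)"
  shows "Ck_on k U (\<lambda>x. f' x v)"
proof -
  have "Ck_on k U (\<lambda>x. frechet_derivative f (at x) v)" using assms(2) by simp
  then show ?thesis
    by (rule Ck_on_cong[OF assms(1)]) (use frechet_derivative_at[OF assms(3)] in metis)
qed

lemma Ck_on_subset:
  assumes "open U" "open V" "V \<subseteq> U" "Ck_on k U f"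
  shows "Ck_on k V f"
  using assms(4)
proof (induction k arbitrary: f)
  case 0
  then show ?case using assms(3) continuous_on_subset by auto
next
  case (Suc k)
  then show ?case using assms(3) differentiable_on_subset by auto
qed

lemma Ck_on_Suc_imp:
  fixes f :: "'a::euclidean_space \<Rightarrow> 'b::real_normed_vector"
  assumes "Ck_on (Suc k) U f"
  shows "Ck_on k U f"
  using assms
proof (induction k arbitrary: f)
  case 0
  then show ?case by (simp add: differentiable_imp_continuous_on)
qed auto

lemma Ck_on_mono:
  assumes "Ck_on k U f" "j \<le> k"
  shows "Ck_on j U f"
  using assms(2,1) by (induction rule: dec_induct) (auto intro: Ck_on_Suc_imp simp del: Ck_on.simps(2))

lemma Ck_on_continuous:
  assumes "Ck_on k U f" shows "continuous_on U f"
  using Ck_on_mono[OF assms, of 0] by simp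

lemma Ck_on_const: "open U \<Longrightarrow> Ck_on k U (\<lambda>x::'a::euclidean_space. c)"
proof (induction k arbitrary: c)
  case (Suc k)
  show ?case by (rule Ck_on_intro[OF Suc.prems has_derivative_const]) (use Suc in auto)
qed simp

lemma Ck_on_linear:
  fixes f :: "'a::euclidean_space \<Rightarrow> 'b::real_normed_vector"
  assumes "open U" "bounded_linear f"
  shows "Ck_on k U f"
proof (cases k)
  case 0
  then show ?thesis using assms by (simp add: linear_continuous_on)
next
  case (Suc j)
  then show ?thesis
    using Ck_on_intro[OF assms(1) bounded_linear_imp_has_derivative[OF assms(2)]]
      Ck_on_const[OF assms(1)] by blast
qed

lemma Ck_on_add:
  fixes f g :: "'a::euclidean_space \<Rightarrow> 'b::real_normed_vector"
  assumes "open U" "Ck_on k U f" "Ck_on k U g"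
  shows "Ck_on k U (\<lambda>x. f x + g x)"
  using assms(2,3)
proof (induction k arbitrary: f g)
  case 0
  then show ?case by (simp add: continuous_on_add)
next
  case (Suc k)
  show ?case
    by (rule Ck_on_intro[OF assms(1) has_derivative_add[OF Ck_on_derivative[OF assms(1) Suc.prems(1)]
         Ck_on_derivative[OF assms(1) Suc.prems(2)]]]) (use Suc in auto)
qed

lemma Ck_on_sum:
  fixes f :: "'i \<Rightarrow> 'a::euclidean_space \<Rightarrow> 'b::real_normed_vector"
  assumes "open U" "\<And>i. i \<in> I \<Longrightarrow> Ck_on k U (f i)"
  shows "Ck_on k U (\<lambda>x. \<Sum>i\<in>I. f i x)"
  using assms(2) by (induction I rule: infinite_finite_induct)
    (auto intro!: Ck_on_add Ck_on_const assms(1))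

lemma Ck_on_bilinear:
  assumes B: "bounded_bilinear P" and "open U" "Ck_on k U f" "Ck_on k U g"
  shows "Ck_on k U (\<lambda>x::'a::euclidean_space. P (f x) (g x))"
  using assms(3,4)
proof (induction k arbitrary: f g)
  case 0
  then show ?case by (simp add: bounded_bilinear.continuous_on[OF B])
next
  case (Suc k)
  show ?case
    by (rule Ck_on_intro[OF assms(2) bounded_bilinear.FDERIV[OF B Ck_on_derivative[OF assms(2) Suc.prems(1)]
         Ck_on_derivative[OF assms(2) Suc.prems(2)]]])
      (use Suc Ck_on_Suc_imp[OF Suc.prems(1)] Ck_on_Suc_imp[OF Suc.prems(2)] in \<open>auto intro!: Ck_on_add assms(2)\<close>)
qed

lemmas Ck_on_mult = Ck_on_bilinear[OF bounded_bilinear_mult]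
lemmas Ck_on_scaleR = Ck_on_bilinear[OF bounded_bilinear_scaleR]
lemmas Ck_on_inner = Ck_on_bilinear[OF bounded_bilinear_inner]

lemma Ck_on_minus:
  assumes "open U" "Ck_on k U f"
  shows "Ck_on k U (\<lambda>x::'a::euclidean_space. - f x)"
  using Ck_on_scaleR[OF assms(1) Ck_on_const[OF assms(1), of k "- 1"] assms(2)] by simp

lemma Ck_on_diff:
  fixes f g :: "'a::euclidean_space \<Rightarrow> 'b::real_normed_vector"
  assumes "open U" "Ck_on k U f" "Ck_on k U g"
  shows "Ck_on k U (\<lambda>x. f x - g x)"
  using Ck_on_add[OF assms(1,2) Ck_on_minus[OF assms(1,3)]] by simp

lemma Ck_on_inverse:
  fixes f :: "'a::euclidean_space \<Rightarrow> real"
  assumes "open U" "Ck_on k U f" "\<And>x. x \<in> U \<Longrightarrow> f x \<noteq> 0"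
  shows "Ck_on k U (\<lambda>x. inverse (f x))"
  using assms(2,3)
proof (induction k)
  case 0
  then show ?case by (auto intro!: continuous_on_inverse)
next
  case (Suc k)
  note i = Suc.IH[OF Ck_on_Suc_imp[OF Suc.prems(1)] Suc.prems(2)]
  show ?case
  proof (rule Ck_on_intro[OF assms(1) Deriv.has_derivative_inverse[OF Suc.prems(2)
        Ck_on_derivative[OF assms(1) Suc.prems(1)]]])
    fix v
    show "Ck_on k U (\<lambda>x. - (inverse (f x) * frechet_derivative f (at x) v * inverse (f x)))"
      using Suc.prems(1) by (intro Ck_on_minus Ck_on_mult i assms(1)) auto
  qed
qed

lemma Ck_on_sqrt:
  fixes f :: "'a::euclidean_space \<Rightarrow> real"
  assumes "open U" "Ck_on k U f" "\<And>x. x \<in> U \<Longrightarrow> f x > 0"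
  shows "Ck_on k U (\<lambda>x. sqrt (f x))"
  using assms(2,3)
proof (induction k)
  case 0
  then show ?case by (simp add: continuous_on_real_sqrt)
next
  case (Suc k)
  note i = Suc.IH[OF Ck_on_Suc_imp[OF Suc.prems(1)] Suc.prems(2)]
  have d: "((\<lambda>x. sqrt (f x)) has_derivative
        (\<lambda>v. frechet_derivative f (at x) v * (inverse 2 * inverse (sqrt (f x))))) (at x)" if "x \<in> U" for x
  proof -
    have e: "(*) (inverse (sqrt (f x)) / 2) = (\<lambda>h. h * (inverse 2 * inverse (sqrt (f x))))"
      by (rule ext) (simp only: divide_inverse mult.commute mult.left_commute mult.assoc)
    have "(sqrt has_derivative (\<lambda>h. h * (inverse 2 * inverse (sqrt (f x))))) (at (f x))"
      using DERIV_real_sqrt[OF Suc.prems(2)[OF that]] unfolding has_field_derivative_def e .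
    from has_derivative_compose[OF Ck_on_derivative[OF assms(1) Suc.prems(1) that] this]
    show ?thesis .
  qed
  show ?case
  proof (rule Ck_on_intro[OF assms(1) d])
    fix v
    have "sqrt (f x) \<noteq> 0" if "x \<in> U" for x using Suc.prems(2)[OF that] by simp
    then show "Ck_on k U (\<lambda>x. frechet_derivative f (at x) v * (inverse 2 * inverse (sqrt (f x))))"
      using Suc.prems(1)
      by (intro Ck_on_mult[OF assms(1) _ Ck_on_mult[OF assms(1) Ck_on_const[OF assms(1)]
            Ck_on_inverse[OF assms(1) i]]]) simp_all
  qed
qed

text \<open>\<open>Ck_on\<close> controls a derivative only in fixed directions, whereas the chain
  rule applies that of \<open>f\<close> to the moving vector \<open>?g' x v\<close>. Expanding this
  vector in \<open>Basis\<close> leaves a finite sum of products, and the induction hypothesis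
  covers each factor \<open>?f' (g x) b\<close>.\<close>

lemma Ck_on_compose:
  fixes f :: "'b::euclidean_space \<Rightarrow> 'c::real_normed_vector" and g :: "'a::euclidean_space \<Rightarrow> 'b"
  assumes U: "open U" and V: "open V" and "Ck_on k V f" "Ck_on k U g" "g ` U \<subseteq> V"
  shows "Ck_on k U (\<lambda>x. f (g x))"
  using assms(3,4)
proof (induction k arbitrary: f)
  case 0
  then show ?case using assms(5) by (auto intro: continuous_on_compose2)
next
  case (Suc k)
  let ?f' = "\<lambda>x. frechet_derivative f (at x)" and ?g' = "\<lambda>x. frechet_derivative g (at x)"
  have d: "((\<lambda>x. f (g x)) has_derivative (\<lambda>v. \<Sum>b\<in>Basis. (?g' x v \<bullet> b) *\<^sub>R ?f' (g x) b)) (at x)"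
    if x: "x \<in> U" for x
  proof -
    have gx: "g x \<in> V" using assms(5) x by auto
    note df = Ck_on_derivative[OF V Suc.prems(1) gx] and dg = Ck_on_derivative[OF U Suc.prems(2) x]
    have lin: "linear (?f' (g x))" by (rule has_derivative_linear[OF df])
    have "?f' (g x) w = (\<Sum>b\<in>Basis. (w \<bullet> b) *\<^sub>R ?f' (g x) b)" for w
    proof -
      have "?f' (g x) w = ?f' (g x) (\<Sum>b\<in>Basis. (w \<bullet> b) *\<^sub>R b)"
        by (simp add: euclidean_representation)
      then show ?thesis by (simp add: linear_sum[OF lin] linear_scale[OF lin])
    qed
    then show ?thesis
      by (intro has_derivative_eq_rhs[OF has_derivative_compose[OF dg df]] ext)
  qed
  show ?case
  proof (rule Ck_on_intro[OF U d])
    fix v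
    show "Ck_on k U (\<lambda>x. \<Sum>b\<in>Basis. (?g' x v \<bullet> b) *\<^sub>R ?f' (g x) b)"
      using Suc.prems Ck_on_Suc_imp[OF Suc.prems(2)] Suc.IH
      by (intro Ck_on_sum Ck_on_scaleR Ck_on_inner Ck_on_const U) auto
  qed
qed

section \<open>The Morse-Sard theorem\<close>

text \<open>A grid of mesh \<eta> cuts \<open>E\<close> into at most a constant times
  \<open>\<eta> ^ - m\<close> cells, with \<open>m = dim T\<close>. The image of each cell lies in
  an interval of length a constant times \<open>\<epsilon> * \<eta> ^ n\<close>. Since
  \<open>m \<le> n\<close>, the total length is of order \<epsilon>.\<close>

lemma negligible_image_small_oscillation:
  fixes g :: "'a::euclidean_space \<Rightarrow> real"
  assumes T: "subspace T" "dim T \<le> n" and E: "bounded E" "E \<subseteq> T"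
    and osc: "\<And>\<epsilon>. \<epsilon> > 0 \<Longrightarrow> \<exists>\<delta>>0. \<forall>y\<in>E. \<forall>x\<in>E. norm (x - y) < \<delta> \<longrightarrow> \<bar>g x - g y\<bar> \<le> \<epsilon> * norm (x - y) ^ n"
  shows "negligible (g ` E)"
proof -
  obtain Bs where Bs: "pairwise orthogonal Bs" "\<And>x. x \<in> Bs \<Longrightarrow> norm x = 1" "span Bs = T"
    "independent Bs" "card Bs = dim T"
    using orthonormal_basis_subspace[OF T(1)] by metis
  have onb: "orthonormal_basis_of T Bs"
    using Bs by (auto simp: orthonormal_basis_of_def)
  have fin: "finite Bs" by (rule orthonormal_basis_of_finite[OF onb])
  define m where "m = card Bs"
  have mn: "m \<le> n" using Bs T by (simp add: m_def)
  obtain R where R: "\<And>x. x \<in> E \<Longrightarrow> norm x \<le> R" "R > 0"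
    using E(1) by (meson bounded_normE)
  \<comment> \<open>Collects all factors other than \<epsilon> and the powers of \<eta> in the final
    estimate: the cell count is at most \<open>((2 * R + 4) / \<eta>) ^ m\<close>, and each image
    interval has length \<open>2 * \<epsilon> * ((m + 1) * \<eta>) ^ n\<close>.\<close>
  define W where "W = 2 * (2 * R + 4) ^ m * (m + 1) ^ n"
  have W: "W > 0" using R by (simp add: W_def)
  show ?thesis
    unfolding negligible_outer_le
  proof (intro allI impI)
    fix e :: real assume e: "e > 0"
    define \<epsilon> where "\<epsilon> = e / W"
    have \<epsilon>: "\<epsilon> > 0" using e W by (simp add: \<epsilon>_def)
    obtain \<delta> where \<delta>: "\<delta> > 0" "\<And>x y. x \<in> E \<Longrightarrow> y \<in> E \<Longrightarrow> norm (x - y) < \<delta> \<Longrightarrow> \<bar>g x - g y\<bar> \<le> \<epsilon> * norm (x - y) ^ n"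
      using osc[OF \<epsilon>] by blast
    \<comment> \<open>Mesh at most 1, so that \<open>\<eta> ^ n \<le> \<eta> ^ m\<close>, and cell
      diameter below \<delta>. The summand 1 in \<open>m + 1\<close> keeps the divisor positive in
      dimension zero.\<close>
    define \<eta> where "\<eta> = min 1 (\<delta> / (2 * (m + 1)))"
    have \<eta>: "0 < \<eta>" "\<eta> \<le> 1" "(m + 1) * \<eta> < \<delta>"
    proof -
      show "0 < \<eta>" "\<eta> \<le> 1" using \<delta> by (auto simp: \<eta>_def)
      have "(m + 1) * \<eta> \<le> (m + 1) * (\<delta> / (2 * (m + 1)))"
        by (intro mult_left_mono) (auto simp: \<eta>_def)
      also have "\<dots> = \<delta> / 2" by (simp add: field_simps)
      also have "\<dots> < \<delta>" using \<delta> by simp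
      finally show "(m + 1) * \<eta> < \<delta>" .
    qed
    define N :: int where "N = \<lceil>R / \<eta>\<rceil>"
    have N: "N \<ge> 0" "of_int N \<le> R / \<eta> + 1" "R / \<eta> \<le> of_int N"
    proof -
      have "0 < R / \<eta>" using R(2) \<eta> by simp
      then show "N \<ge> 0" unfolding N_def by linarith
      show "of_int N \<le> R / \<eta> + 1" "R / \<eta> \<le> of_int N" unfolding N_def by linarith+
    qed
    \<comment> \<open>The index range has \<open>2 * N + 2\<close> values per coordinate;
      \<open>- N - 1\<close> is slack at the lower end.\<close>
    define I where "I = Bs \<rightarrow>\<^sub>E {-N-1..N}"
    define cell where "cell k = {x\<in>E. \<forall>b\<in>Bs. \<lfloor>(x \<bullet> b) / \<eta>\<rfloor> = k b}" for k
    have finI: "finite I" unfolding I_def by (intro finite_PiE fin) auto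
    have cov: "E \<subseteq> (\<Union>k\<in>I. cell k)"
    proof
      fix x assume x: "x \<in> E"
      define k where "k = restrict (\<lambda>b. \<lfloor>(x \<bullet> b) / \<eta>\<rfloor>) Bs"
      have "\<lfloor>(x \<bullet> b) / \<eta>\<rfloor> \<in> {-N-1..N}" if "b \<in> Bs" for b
      proof -
        have "\<bar>x \<bullet> b\<bar> \<le> R"
          using Cauchy_Schwarz_ineq2[of x b] Bs(2)[OF that] R(1)[OF x] by simp
        then have "\<bar>(x \<bullet> b) / \<eta>\<bar> \<le> R / \<eta>" using \<eta> by (simp add: abs_divide divide_right_mono)
        then have "\<bar>(x \<bullet> b) / \<eta>\<bar> \<le> N" using N by linarith
        then have "\<lfloor>(x \<bullet> b) / \<eta>\<rfloor> \<le> N" "- N - 1 \<le> \<lfloor>(x \<bullet> b) / \<eta>\<rfloor>" by linarith+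
        then show ?thesis by simp
      qed
      then have "k \<in> I" by (auto simp: I_def k_def)
      moreover have "x \<in> cell k" using x by (auto simp: cell_def k_def)
      ultimately show "x \<in> (\<Union>k\<in>I. cell k)" by blast
    qed
    have diam: "norm (x - y) \<le> (m + 1) * \<eta>" if "x \<in> cell k" "y \<in> cell k" for x y k
    proof -
      have xy: "x - y \<in> T" using that E(2) T(1) by (auto simp: cell_def intro: subspace_diff)
      have "norm (x - y) = norm (\<Sum>b\<in>Bs. ((x - y) \<bullet> b) *\<^sub>R b)"
        using orthonormal_basis_of_expand[OF onb xy] by simp
      also have "\<dots> \<le> (\<Sum>b\<in>Bs. \<eta>)"
      proof (rule sum_norm_le)
        fix b assume b: "b \<in> Bs"
        have "\<lfloor>(x \<bullet> b) / \<eta>\<rfloor> = \<lfloor>(y \<bullet> b) / \<eta>\<rfloor>" using that b by (auto simp: cell_def)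
        then have "\<bar>(x \<bullet> b) / \<eta> - (y \<bullet> b) / \<eta>\<bar> \<le> 1" by linarith
        then have "\<bar>(x - y) \<bullet> b\<bar> / \<eta> \<le> 1"
          using \<eta> by (simp add: inner_diff_left diff_divide_distrib[symmetric] abs_divide)
        then show "norm (((x - y) \<bullet> b) *\<^sub>R b) \<le> \<eta>"
          using \<eta> Bs(2)[OF b] by (simp add: field_simps)
      qed
      also have "\<dots> \<le> (m + 1) * \<eta>" using \<eta> by (simp add: m_def field_simps)
      finally show ?thesis .
    qed
    define \<rho> where "\<rho> = \<epsilon> * ((m + 1) * \<eta>) ^ n"
    have \<rho>: "\<rho> \<ge> 0" using \<epsilon> \<eta> by (simp add: \<rho>_def)
    define J where "J k = (if cell k = {} then {} else cball (g (SOME y. y \<in> cell k)) \<rho>)" for k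
    have J: "g ` cell k \<subseteq> J k" for k
    proof
      fix v assume "v \<in> g ` cell k"
      then obtain x where x: "x \<in> cell k" "v = g x" by blast
      define y where "y = (SOME y. y \<in> cell k)"
      have y: "y \<in> cell k" unfolding y_def using x(1) by (rule someI)
      have "\<bar>g y - g x\<bar> \<le> \<epsilon> * norm (y - x) ^ n"
        using \<delta>(2)[of y x] x y diam[OF y x(1)] \<eta>(3) by (auto simp: cell_def)
      also have "\<dots> \<le> \<rho>"
        unfolding \<rho>_def using diam[OF y x(1)] \<epsilon> by (intro mult_left_mono power_mono) auto
      finally show "v \<in> J k" using x by (auto simp: J_def y_def dist_real_def)
    qed
    have Jm: "J k \<in> lmeasurable" "measure lebesgue (J k) \<le> 2 * \<rho>" for k
      using \<rho> by (auto simp: J_def cball_eq_atLeastAtMost)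
    show "\<exists>U. g ` E \<subseteq> U \<and> U \<in> lmeasurable \<and> measure lebesgue U \<le> e"
    proof (intro exI conjI)
      show "g ` E \<subseteq> (\<Union>k\<in>I. J k)" using cov J by blast
      show "(\<Union>k\<in>I. J k) \<in> lmeasurable" using finI Jm by (intro fmeasurable.finite_UN) auto
      have "measure lebesgue (\<Union>k\<in>I. J k) \<le> (\<Sum>k\<in>I. measure lebesgue (J k))"
        using finI Jm by (intro measure_UNION_le) auto
      also have "\<dots> \<le> (\<Sum>k\<in>I. 2 * \<rho>)" by (intro sum_mono Jm)
      also have "\<dots> = real (card I) * (2 * \<rho>)" by simp
      also have "card I = nat (2 * N + 2) ^ m"
        using N by (simp add: I_def card_PiE[OF fin] m_def add.commute)
      also have "real (nat (2 * N + 2) ^ m) * (2 * \<rho>) \<le> ((2 * R + 4) / \<eta>) ^ m * (2 * \<rho>)"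
      proof -
        have "real (nat (2 * N + 2)) = 2 * of_int N + 2" using N by simp
        also have "\<dots> \<le> 2 * (R / \<eta>) + 4" using N by simp
        also have "\<dots> \<le> (2 * R + 4) / \<eta>" using \<eta> by (simp add: field_simps)
        finally have "real (nat (2 * N + 2)) ^ m \<le> ((2 * R + 4) / \<eta>) ^ m" by (intro power_mono) auto
        then show ?thesis using \<rho> by (intro mult_right_mono) auto
      qed
      also have "\<dots> = 2 * (2 * R + 4) ^ m * (m + 1) ^ n * \<epsilon> * (\<eta> ^ n / \<eta> ^ m)"
        by (simp add: \<rho>_def power_divide power_mult_distrib)
      also have "\<dots> \<le> 2 * (2 * R + 4) ^ m * (m + 1) ^ n * \<epsilon> * 1"
      proof (rule mult_left_mono)
        have "\<eta> ^ n \<le> \<eta> ^ m" using mn \<eta> by (intro power_decreasing) auto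
        then show "\<eta> ^ n / \<eta> ^ m \<le> 1" using \<eta> by simp
      qed (use R \<epsilon> in auto)
      also have "\<dots> = W * \<epsilon>" by (simp add: W_def)
      also have "\<dots> = e" using W by (simp add: \<epsilon>_def)
      finally show "measure lebesgue (\<Union>k\<in>I. J k) \<le> e" .
    qed
  qed
qed

text \<open>The map replaces the coordinate of \<open>y\<close> along \<open>s\<close> by
  \<open>w y\<close>, so it sends the zeros of \<open>w\<close> into the hyperplane orthogonal to
  \<open>s\<close>. It moves points only along \<open>s\<close>, and so do its inverse and the
  derivative of the inverse up to the identity. Hence a subspace containing \<open>s\<close> is
  respected, which keeps the induction on dimension inside \<open>S\<close>.\<close>

lemma local_flattening:
  fixes w :: "'a::euclidean_space \<Rightarrow> real"
  assumes Y: "open Y" and w: "Ck_on (Suc k) Y w" and x0: "x0 \<in> Y"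
    and s: "norm s = 1" "frechet_derivative w (at x0) s \<noteq> 0"
  obtains Y' V \<iota> \<iota>' where "open Y'" "x0 \<in> Y'" "Y' \<subseteq> Y" "open V"
    "homeomorphism Y' V (\<lambda>y. y + (w y - y \<bullet> s) *\<^sub>R s) \<iota>" "Ck_on (Suc k) V \<iota>"
    "\<forall>v\<in>V. (\<iota> has_derivative \<iota>' v) (at v)" "\<forall>v\<in>V. \<forall>h. \<exists>c. \<iota>' v h = h + c *\<^sub>R s"
proof -
  let ?w' = "\<lambda>x. frechet_derivative w (at x)"
  define \<Theta> where "\<Theta> = (\<lambda>y. y + (w y - y \<bullet> s) *\<^sub>R s)"
  define L where "L x = (\<lambda>h. h + (?w' x h - h \<bullet> s) *\<^sub>R s)" for x
  have ss: "s \<bullet> s = 1" using s(1) by (simp add: norm_eq_1)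
  have dw: "(w has_derivative ?w' x) (at x)" if "x \<in> Y" for x
    using Ck_on_derivative[OF Y w that] .
  have lw: "linear (?w' x)" if "x \<in> Y" for x using has_derivative_linear[OF dw[OF that]] .
  have dT: "(\<Theta> has_derivative L x) (at x)" if "x \<in> Y" for x
    unfolding \<Theta>_def L_def by (rule derivative_eq_intros dw that refl | simp)+
  have bl: "bounded_linear (L x)" if "x \<in> Y" for x
    using dT[OF that] has_derivative_bounded_linear by blast
  have app: "blinfun_apply (Blinfun (L x)) = L x" if "x \<in> Y" for x
    using bl[OF that] by (simp add: bounded_linear_Blinfun_apply)
  have cw: "continuous_on Y (\<lambda>x. ?w' x v)" for v
    using Ck_on_continuous[of k Y "\<lambda>x. ?w' x v"] w by auto
  have cont: "continuous_on Y (\<lambda>x. Blinfun (L x))"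
  proof (rule continuous_on_blinfun_componentwise)
    fix i :: 'a
    have "continuous_on Y (\<lambda>x. L x i)" unfolding L_def by (intro continuous_intros cw)
    then show "continuous_on Y (\<lambda>x. blinfun_apply (Blinfun (L x)) i)"
      by (rule continuous_on_eq) (simp add: app)
  qed
  \<comment> \<open>The inverse of \<open>L x0\<close>. If \<open>u = L x0 h\<close> then
    \<open>u \<bullet> s = ?w' x0 h\<close>; writing \<open>h = u + c *\<^sub>R s\<close> and
    applying \<open>?w' x0\<close> determines \<open>c\<close>.\<close>
  define M where "M = (\<lambda>u. u + ((u \<bullet> s - ?w' x0 u) / ?w' x0 s) *\<^sub>R s)"
  have linM: "linear M"
    unfolding M_def using lw[OF x0]
    by (intro linearI) (auto simp: linear_add linear_scale algebra_simps add_divide_distrib diff_divide_distrib)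
  then have blM: "bounded_linear M" by (simp add: linear_conv_bounded_linear)
  have "M (L x0 h) = h" for h
  proof -
    have 1: "L x0 h \<bullet> s = ?w' x0 h" using ss by (simp add: L_def inner_add_left)
    have 2: "?w' x0 (L x0 h) = ?w' x0 h + (?w' x0 h - h \<bullet> s) * ?w' x0 s"
      unfolding L_def by (simp add: linear_add[OF lw[OF x0]] linear_scale[OF lw[OF x0]])
    have "M (L x0 h) = L x0 h + (- (?w' x0 h - h \<bullet> s)) *\<^sub>R s"
      unfolding M_def 1 2 using s(2) by simp
    then show ?thesis by (simp add: L_def scaleR_diff_left)
  qed
  then have inv: "Blinfun M o\<^sub>L Blinfun (L x0) = id_blinfun"
    by (intro blinfun_eqI) (simp add: app[OF x0] bounded_linear_Blinfun_apply[OF blM])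
  obtain Y' V \<iota> \<iota>' where 1: "open Y'" "Y' \<subseteq> Y" "x0 \<in> Y'" "open V" "homeomorphism Y' V \<Theta> \<iota>"
    and 2: "\<And>y. y \<in> V \<Longrightarrow> (\<iota> has_derivative (\<iota>' y)) (at y)"
    and 3: "\<And>y. y \<in> V \<Longrightarrow> \<iota>' y = inv (blinfun_apply (Blinfun (L (\<iota> y))))"
    and 4: "\<And>y. y \<in> V \<Longrightarrow> bij (blinfun_apply (Blinfun (L (\<iota> y))))"
    using inverse_function_theorem[OF Y _ cont x0 inv, of \<Theta>] dT app by metis
  have \<iota>Y: "\<iota> y \<in> Y" if "y \<in> V" for y using 1 that by (auto simp: homeomorphism_def)
  have nz: "?w' (\<iota> y) s \<noteq> 0" if "y \<in> V" for y
  proof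
    assume "?w' (\<iota> y) s = 0"
    then have "L (\<iota> y) s = L (\<iota> y) 0" using ss lw[OF \<iota>Y[OF that]] by (simp add: L_def linear_0)
    then have "s = 0" using 4[OF that] app[OF \<iota>Y[OF that]] by (metis bij_is_inj injD)
    then show False using s by simp
  qed
  have form: "\<iota>' y h = h + ((h \<bullet> s - ?w' (\<iota> y) h) * inverse (?w' (\<iota> y) s)) *\<^sub>R s" (is "_ = ?r") if "y \<in> V" for y h
  proof -
    have 1: "?w' (\<iota> y) ?r = h \<bullet> s"
      using nz[OF that] lw[OF \<iota>Y[OF that]] by (simp add: linear_add linear_scale mult.assoc)
    have 2: "?r \<bullet> s = h \<bullet> s + (h \<bullet> s - ?w' (\<iota> y) h) * inverse (?w' (\<iota> y) s)"
      using ss by (simp add: inner_add_left)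
    have "L (\<iota> y) ?r = h" unfolding L_def 1 2 by (simp add: scaleR_diff_left)
    then show ?thesis using 3[OF that] 4[OF that] app[OF \<iota>Y[OF that]] by (metis bij_inv_eq_iff)
  qed
  \<comment> \<open>Bootstrapping: by \<open>form\<close>, the derivative of \<iota> is a rational
    expression in derivatives of \<open>w\<close> evaluated along \<iota>, so each order of \<iota>
    gives the next one.\<close>
  have "Ck_on j V \<iota>" if "j \<le> Suc k" for j
    using that
  proof (induction j)
    case 0
    then show ?case using 1 by (simp add: homeomorphism_def)
  next
    case (Suc j)
    have ij: "Ck_on j V \<iota>" using Suc by simp
    have wj: "Ck_on j V (\<lambda>y. ?w' (\<iota> y) h)" for h
    proof (rule Ck_on_compose[OF 1(4) Y _ ij])
      show "Ck_on j Y (\<lambda>x. ?w' x h)" using w Suc.prems by (auto intro: Ck_on_mono)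
    qed (use \<iota>Y in auto)
    show ?case
    proof (rule Ck_on_intro[OF 1(4) 2], assumption)
      fix h
      have "Ck_on j V (\<lambda>y. h + ((h \<bullet> s - ?w' (\<iota> y) h) * inverse (?w' (\<iota> y) s)) *\<^sub>R s)"
        by (intro Ck_on_add Ck_on_scaleR Ck_on_mult Ck_on_diff Ck_on_const Ck_on_inverse wj nz 1(4))
      then show "Ck_on j V (\<lambda>y. \<iota>' y h)"
        by (rule Ck_on_cong[OF 1(4)]) (simp add: form)
    qed
  qed
  then have "Ck_on (Suc k) V \<iota>" by blast
  moreover have "\<forall>v\<in>V. (\<iota> has_derivative \<iota>' v) (at v)" using 2 by blast
  moreover have "\<forall>v\<in>V. \<forall>h. \<exists>c. \<iota>' v h = h + c *\<^sub>R s" using form by blast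
  ultimately show ?thesis by (rule that[OF 1(1,3,2,4) 1(5)[unfolded \<Theta>_def]])
qed

text \<open>A. P. Morse's decomposition: on \<open>E\<close>, every \<open>C^k\<close> function vanishing on \<open>A\<close> is \<open>o(|x - y|^k)\<close>
  along the chart \<open>\<psi>\<close>. The parameter space \<open>T\<close> is a subspace of the ambient space, so that charts
  of all dimensions share one type.\<close>

definition flat_chart ::
    "'a::euclidean_space set \<Rightarrow> 'a set \<Rightarrow> 'a set \<Rightarrow> nat \<Rightarrow> 'a set \<Rightarrow> 'a set \<Rightarrow> 'a set \<Rightarrow> ('a \<Rightarrow> 'a) \<Rightarrow> ('a \<Rightarrow> 'a \<Rightarrow> 'a) \<Rightarrow> bool" where
  "flat_chart X S A k T D E \<psi> \<psi>' \<longleftrightarrow>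
     subspace T \<and> compact D \<and> convex D \<and> D \<subseteq> T \<and> E \<subseteq> D \<and> \<psi> ` E \<subseteq> A \<and> \<psi> ` D \<subseteq> X \<inter> S \<and>
     (\<forall>x\<in>D. (\<psi> has_derivative \<psi>' x) (at x within D)) \<and> (\<forall>x\<in>D. \<forall>h\<in>T. \<psi>' x h \<in> S) \<and>
     (\<exists>C>0. \<forall>x\<in>D. \<forall>h. norm (\<psi>' x h) \<le> C * norm h) \<and>
     (\<forall>w::'a \<Rightarrow> real. Ck_on k X w \<longrightarrow> (\<forall>x\<in>A. w x = 0) \<longrightarrow>
        (\<forall>\<epsilon>>0. \<exists>\<delta>>0. \<forall>y\<in>E. \<forall>x\<in>D. norm (x - y) < \<delta> \<longrightarrow> \<bar>w (\<psi> x)\<bar> \<le> \<epsilon> * norm (x - y) ^ k))"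

section \<open>Covering by charts along which vanishing functions are flat\<close>

lemma flat_chartD:
  assumes "flat_chart X S A k T D E \<psi> \<psi>'"
  shows "subspace T" "compact D" "convex D" "D \<subseteq> T" "E \<subseteq> D" "\<psi> ` E \<subseteq> A" "\<psi> ` D \<subseteq> X \<inter> S"
    "\<And>x. x \<in> D \<Longrightarrow> (\<psi> has_derivative \<psi>' x) (at x within D)" "\<And>x h. x \<in> D \<Longrightarrow> h \<in> T \<Longrightarrow> \<psi>' x h \<in> S"
    "\<exists>C>0. \<forall>x\<in>D. \<forall>h. norm (\<psi>' x h) \<le> C * norm h"
    "\<And>w::'a::euclidean_space \<Rightarrow> real. Ck_on k X w \<Longrightarrow> (\<forall>x\<in>A. w x = 0) \<Longrightarrow>
        (\<forall>\<epsilon>>0. \<exists>\<delta>>0. \<forall>y\<in>E. \<forall>x\<in>D. norm (x - y) < \<delta> \<longrightarrow> \<bar>w (\<psi> x)\<bar> \<le> \<epsilon> * norm (x - y) ^ k)"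
  using assms unfolding flat_chart_def by (elim conjE; simp)+

definition flat_piece :: "'a::euclidean_space set \<Rightarrow> 'a set \<Rightarrow> 'a set \<Rightarrow> nat \<Rightarrow> 'a set \<Rightarrow> bool" where
  "flat_piece X S A k F \<longleftrightarrow> (\<exists>T D E \<psi> \<psi>'. dim T \<le> dim S \<and> flat_chart X S A k T D E \<psi> \<psi>' \<and> F \<subseteq> \<psi> ` E)"

definition flat_covered :: "'a::euclidean_space set \<Rightarrow> 'a set \<Rightarrow> 'a set \<Rightarrow> nat \<Rightarrow> 'a set \<Rightarrow> bool" where
  "flat_covered X S A k B \<longleftrightarrow>
     (\<exists>\<F>. countable \<F> \<and> B \<subseteq> \<Union>\<F> \<and>
        (\<forall>F\<in>\<F>. flat_piece X S A k F))"

lemma flat_coveredE: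
  assumes "flat_covered X S A k B"
  obtains \<F> where "countable \<F>" "B \<subseteq> \<Union>\<F>"
    "\<forall>F\<in>\<F>. flat_piece X S A k F"
proof -
  from assms obtain \<F> where F: "countable \<F> \<and> B \<subseteq> \<Union>\<F> \<and>
        (\<forall>F\<in>\<F>. flat_piece X S A k F)"
    unfolding flat_covered_def by (rule exE)
  show thesis
    by (rule that[OF conjunct1[OF F] conjunct1[OF conjunct2[OF F]] conjunct2[OF conjunct2[OF F]]])
qed

lemma flat_covered_Union:
  assumes "countable \<B>" "\<And>B. B \<in> \<B> \<Longrightarrow> flat_covered X S A k B"
  shows "flat_covered X S A k (\<Union>\<B>)"
proof -
  have "\<forall>B\<in>\<B>. \<exists>\<F>. countable \<F> \<and> B \<subseteq> \<Union>\<F> \<and> (\<forall>F\<in>\<F>. flat_piece X S A k F)"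
    by (intro ballI assms(2)[unfolded flat_covered_def])
  from bchoice[OF this] obtain f where
    f: "\<forall>B\<in>\<B>. countable (f B) \<and> B \<subseteq> \<Union>(f B) \<and> (\<forall>F\<in>f B. flat_piece X S A k F)"
    by (elim exE)
  show ?thesis unfolding flat_covered_def
  proof (intro exI conjI ballI)
    show "countable (\<Union>B\<in>\<B>. f B)" using assms(1) f by (intro countable_UN) auto
    have "B \<subseteq> \<Union>(f B)" if "B \<in> \<B>" for B using f that by simp
    then show "\<Union>\<B> \<subseteq> \<Union>(\<Union>B\<in>\<B>. f B)" by blast
    fix F assume "F \<in> (\<Union>B\<in>\<B>. f B)"
    then obtain B where "B \<in> \<B>" "F \<in> f B" by (elim UN_E)
    then show "flat_piece X S A k F" using f by simp
  qed
qed

lemma flat_covered_mono: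
  assumes "flat_covered X S A k B" "B' \<subseteq> B"
  shows "flat_covered X S A k B'"
  using assms unfolding flat_covered_def by (meson subset_trans)

text \<open>Lindelof extracts a countable subcover. Countability is built into
  \<open>flat_covered\<close> because negligibility of the images must pass to the union.\<close>

lemma flat_covered_local:
  assumes "\<And>x. x \<in> B \<Longrightarrow> \<exists>Y. open Y \<and> x \<in> Y \<and> flat_covered X S A k (B \<inter> Y)"
  shows "flat_covered X S A k B"
proof -
  define \<Y> where "\<Y> = {Y. open Y \<and> flat_covered X S A k (B \<inter> Y)}"
  have op: "\<And>Y. Y \<in> \<Y> \<Longrightarrow> open Y" by (simp add: \<Y>_def)
  obtain \<Y>' where Y: "\<Y>' \<subseteq> \<Y>" "countable \<Y>'" "\<Union>\<Y>' = \<Union>\<Y>"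
    by (rule Lindelof[OF op])
  have "flat_covered X S A k (\<Union>((\<inter>) B ` \<Y>'))"
  proof (rule flat_covered_Union)
    show "countable ((\<inter>) B ` \<Y>')" using Y(2) by simp
    fix C assume "C \<in> (\<inter>) B ` \<Y>'"
    then obtain D where "D \<in> \<Y>'" "C = B \<inter> D" by (elim imageE)
    then show "flat_covered X S A k C" using Y(1) by (auto simp: \<Y>_def)
  qed
  moreover have "B \<subseteq> \<Union>\<Y>"
  proof
    fix x assume "x \<in> B"
    from assms[OF this] obtain Y where "open Y \<and> x \<in> Y \<and> flat_covered X S A k (B \<inter> Y)" by (elim exE)
    then show "x \<in> \<Union>\<Y>" by (intro UnionI[of Y]) (simp_all add: \<Y>_def)
  qed
  then have "B \<subseteq> \<Union>((\<inter>) B ` \<Y>')" using Y(3) by blast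
  ultimately show ?thesis by (rule flat_covered_mono)
qed

text \<open>The derivatives of \<open>f\<close> along a basis of \<open>S\<close> are functions of
  class \<open>k\<close> vanishing on \<open>A\<close>, hence small of order \<open>k\<close> along
  the chart. Integrating over the segment from \<open>y\<close> to \<open>x\<close>, which stays in
  the convex set \<open>D\<close>, gains one power of \<open>norm (x - y)\<close>.\<close>

lemma flat_chart_integrate:
  fixes f :: "'a::euclidean_space \<Rightarrow> real"
  assumes X: "open X" and S: "subspace S" and ch: "flat_chart X S A k T D E \<psi> \<psi>'"
    and f: "Ck_on (Suc k) X f" and crit: "\<And>x s. x \<in> A \<Longrightarrow> s \<in> S \<Longrightarrow> frechet_derivative f (at x) s = 0"
    and \<epsilon>: "\<epsilon> > 0"
  shows "\<exists>\<delta>>0. \<forall>y\<in>E. \<forall>x\<in>D. norm (x - y) < \<delta> \<longrightarrow> \<bar>f (\<psi> x) - f (\<psi> y)\<bar> \<le> \<epsilon> * norm (x - y) ^ Suc k"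
proof -
  obtain Bs where "pairwise orthogonal Bs" "\<And>x. x \<in> Bs \<Longrightarrow> norm x = 1" "span Bs = S"
    using orthonormal_basis_subspace[OF S] by metis
  then have onb: "orthonormal_basis_of S Bs" and Bs: "\<And>b. b \<in> Bs \<Longrightarrow> norm b = 1" "Bs \<subseteq> S"
    using span_superset by (auto simp: orthonormal_basis_of_def)
  have fin: "finite Bs" by (rule orthonormal_basis_of_finite[OF onb])
  obtain C where C: "C > 0" "\<And>x h. x \<in> D \<Longrightarrow> norm (\<psi>' x h) \<le> C * norm h"
    using flat_chartD(10)[OF ch] by blast
  have D: "convex D" "D \<subseteq> T" "subspace T" "E \<subseteq> D" "\<psi> ` D \<subseteq> X"
    and \<psi>': "\<And>x. x \<in> D \<Longrightarrow> (\<psi> has_derivative \<psi>' x) (at x within D)" "\<And>x h. x \<in> D \<Longrightarrow> h \<in> T \<Longrightarrow> \<psi>' x h \<in> S"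
    using flat_chartD[OF ch] by blast+
  let ?f' = "\<lambda>x. frechet_derivative f (at x)"
  \<comment> \<open>\<open>C\<close> bounds the derivative of the chart and \<open>card Bs\<close>
    is the number of partial derivatives summed below; adding 1 covers an empty basis.\<close>
  define \<epsilon>' where "\<epsilon>' = \<epsilon> / (C * (card Bs + 1))"
  have \<epsilon>': "\<epsilon>' > 0" using \<epsilon> C by (simp add: \<epsilon>'_def)
  have "\<forall>b\<in>Bs. \<exists>\<delta>>0. \<forall>y\<in>E. \<forall>x\<in>D. norm (x - y) < \<delta> \<longrightarrow> \<bar>?f' (\<psi> x) b\<bar> \<le> \<epsilon>' * norm (x - y) ^ k"
  proof
    fix b assume b: "b \<in> Bs"
    have "Ck_on k X (\<lambda>x. ?f' x b)" using f by simp
    moreover have "\<forall>x\<in>A. ?f' x b = 0" using crit b Bs by blast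
    ultimately show "\<exists>\<delta>>0. \<forall>y\<in>E. \<forall>x\<in>D. norm (x - y) < \<delta> \<longrightarrow> \<bar>?f' (\<psi> x) b\<bar> \<le> \<epsilon>' * norm (x - y) ^ k"
      using flat_chartD(11)[OF ch] \<epsilon>' by blast
  qed
  from bchoice[OF this] obtain d where d: "\<And>b. b \<in> Bs \<Longrightarrow> d b > 0"
    "\<And>b x y. b \<in> Bs \<Longrightarrow> y \<in> E \<Longrightarrow> x \<in> D \<Longrightarrow> norm (x - y) < d b \<Longrightarrow> \<bar>?f' (\<psi> x) b\<bar> \<le> \<epsilon>' * norm (x - y) ^ k"
    by metis
  define \<delta> where "\<delta> = Min (insert 1 (d ` Bs))"
  have \<delta>: "\<delta> > 0" "\<And>b. b \<in> Bs \<Longrightarrow> \<delta> \<le> d b" using fin d by (auto simp: \<delta>_def)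
  show ?thesis
  proof (intro exI[of _ \<delta>] conjI ballI impI)
    fix y x assume y: "y \<in> E" and x: "x \<in> D" and xy: "norm (x - y) < \<delta>"
    define z where "z t = y + t *\<^sub>R (x - y)" for t :: real
    have zD: "z t \<in> D" if "t \<in> {0..1}" for t
    proof -
      have "z t = (1 - t) *\<^sub>R y + t *\<^sub>R x" by (simp add: z_def algebra_simps)
      then show ?thesis using that D(1,4) x y by (auto intro: convexD)
    qed
    have xyT: "x - y \<in> T" using x y D by (meson subsetD subspace_diff)
    define c where "c t = ?f' (\<psi> (z t)) (\<psi>' (z t) (x - y))" for t
    have der: "((\<lambda>t. f (\<psi> (z t))) has_derivative (\<lambda>h. h * c t)) (at t within {0..1})" if t: "t \<in> {0..1}" for t
    proof -
      have 1: "(z has_derivative (\<lambda>h. h *\<^sub>R (x - y))) (at t within {0..1})"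
        unfolding z_def by (auto intro!: derivative_eq_intros)
      have 2: "(\<psi> has_derivative \<psi>' (z t)) (at (z t) within z ` {0..1})"
        by (rule has_derivative_subset[OF \<psi>'(1)[OF zD[OF t]]]) (use zD in auto)
      note 3 = diff_chain_within[OF 1 2]
      have df: "(f has_derivative ?f' (\<psi> (z t))) (at (\<psi> (z t)))"
        using Ck_on_derivative[OF X f, of "\<psi> (z t)"] D(5) zD[OF t] by blast
      have "((\<lambda>t. f (\<psi> (z t))) has_derivative (\<lambda>h. ?f' (\<psi> (z t)) (\<psi>' (z t) (h *\<^sub>R (x - y))))) (at t within {0..1})"
        using has_derivative_compose[OF 3] df by (simp add: o_def)
      moreover have "?f' (\<psi> (z t)) (\<psi>' (z t) (h *\<^sub>R (x - y))) = h * c t" for h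
        using linear_scale[OF has_derivative_linear[OF \<psi>'(1)[OF zD[OF t]]]] linear_scale[OF has_derivative_linear[OF df]]
        by (simp add: c_def)
      ultimately show ?thesis by simp
    qed
    have c: "\<bar>c t\<bar> \<le> \<epsilon> * norm (x - y) ^ Suc k" if t: "t \<in> {0..1}" for t
    proof -
      have zt: "norm (z t - y) \<le> norm (x - y)" using t by (simp add: z_def mult_left_le_one_le)
      let ?v = "\<psi>' (z t) (x - y)"
      have v: "?v \<in> S" "norm ?v \<le> C * norm (x - y)" using \<psi>'(2) C(2) zD[OF t] xyT by auto
      have df: "(f has_derivative ?f' (\<psi> (z t))) (at (\<psi> (z t)))"
        using Ck_on_derivative[OF X f, of "\<psi> (z t)"] D(5) zD[OF t] by blast
      note lin = has_derivative_linear[OF df]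
      have "c t = ?f' (\<psi> (z t)) (\<Sum>b\<in>Bs. (?v \<bullet> b) *\<^sub>R b)"
        using orthonormal_basis_of_expand[OF onb v(1)] by (simp add: c_def)
      also have "\<dots> = (\<Sum>b\<in>Bs. (?v \<bullet> b) * ?f' (\<psi> (z t)) b)"
        by (simp add: linear_sum[OF lin] linear_scale[OF lin])
      finally have "\<bar>c t\<bar> \<le> (\<Sum>b\<in>Bs. \<bar>(?v \<bullet> b) * ?f' (\<psi> (z t)) b\<bar>)" by (simp add: sum_abs)
      also have "\<dots> \<le> (\<Sum>b\<in>Bs. (C * norm (x - y)) * (\<epsilon>' * norm (x - y) ^ k))"
      proof (rule sum_mono)
        fix b assume b: "b \<in> Bs"
        have "\<bar>?v \<bullet> b\<bar> \<le> C * norm (x - y)"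
          using Cauchy_Schwarz_ineq2[of ?v b] Bs(1)[OF b] v(2) by simp
        moreover have "\<bar>?f' (\<psi> (z t)) b\<bar> \<le> \<epsilon>' * norm (z t - y) ^ k"
          using d(2)[OF b y zD[OF t]] zt xy \<delta>(2)[OF b] by linarith
        moreover have "\<epsilon>' * norm (z t - y) ^ k \<le> \<epsilon>' * norm (x - y) ^ k"
          using zt \<epsilon>' by (intro mult_left_mono power_mono) auto
        ultimately show "\<bar>(?v \<bullet> b) * ?f' (\<psi> (z t)) b\<bar> \<le> (C * norm (x - y)) * (\<epsilon>' * norm (x - y) ^ k)"
          using \<epsilon>' C unfolding abs_mult by (intro mult_mono) (linarith | simp)+
      qed
      also have "\<dots> = (card Bs * C * \<epsilon>') * norm (x - y) ^ Suc k" by simp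
      also have "\<dots> \<le> \<epsilon> * norm (x - y) ^ Suc k"
      proof (rule mult_right_mono)
        have "card Bs * C * \<epsilon>' = \<epsilon> * (card Bs / (card Bs + 1))" using C(1) by (simp add: \<epsilon>'_def)
        also have "\<dots> \<le> \<epsilon> * 1" using \<epsilon> by (intro mult_left_mono) auto
        finally show "card Bs * C * \<epsilon>' \<le> \<epsilon>" by simp
      qed auto
      finally show ?thesis .
    qed
    have "norm (f (\<psi> (z 1)) - f (\<psi> (z 0))) \<le> (\<epsilon> * norm (x - y) ^ Suc k) * norm (1 - 0 :: real)"
    proof (rule differentiable_bound[OF _ der])
      fix t :: real assume "t \<in> {0..1}"
      then show "onorm (\<lambda>h. h * c t) \<le> \<epsilon> * norm (x - y) ^ Suc k"
        using mult_left_mono[OF c] by (intro onorm_le) (simp add: abs_mult mult.commute)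
    qed auto
    then show "\<bar>f (\<psi> x) - f (\<psi> y)\<bar> \<le> \<epsilon> * norm (x - y) ^ Suc k" by (simp add: z_def)
  qed (rule \<delta>(1))
qed

text \<open>At order zero flatness is uniform continuity: the identity serves as chart on a compact
  ball of \<open>S\<close>, since \<open>w\<close> vanishes on \<open>A\<close> and cannot be large
  near it.\<close>

lemma flat_covered_0:
  assumes X: "open X" and S: "subspace S" and A: "A \<subseteq> X \<inter> S"
  shows "flat_covered X S A 0 A"
proof (rule flat_covered_local)
  fix x assume x: "x \<in> A"
  obtain r where r: "r > 0" "cball x r \<subseteq> X" using X A x open_contains_cball by (metis IntD1 subsetD)
  define D where "D = cball x r \<inter> S"
  have "closed S" using S by (rule closed_subspace)
  then have D: "compact D" "convex D" unfolding D_def using S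
    by (auto intro: compact_Int_closed convex_Int subspace_imp_convex)
  have "flat_chart X S A 0 S D (A \<inter> D) id (\<lambda>x. id)"
    unfolding flat_chart_def
  proof (intro conjI ballI allI impI)
    show "\<exists>C>0. \<forall>x\<in>D. \<forall>h. norm (id h :: 'a) \<le> C * norm h" by (intro exI[of _ 1]) auto
    fix w :: "'a \<Rightarrow> real" and \<epsilon> :: real
    assume w: "Ck_on 0 X w" "\<forall>x\<in>A. w x = 0" and \<epsilon>: "\<epsilon> > 0"
    have "continuous_on D w" using w(1) r by (auto simp: D_def intro: continuous_on_subset)
    then have "uniformly_continuous_on D w" using D compact_uniformly_continuous by blast
    then obtain \<delta> where \<delta>: "\<delta> > 0" "\<And>y x. y \<in> D \<Longrightarrow> x \<in> D \<Longrightarrow> dist x y < \<delta> \<Longrightarrow> dist (w x) (w y) < \<epsilon>"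
      using \<epsilon> unfolding uniformly_continuous_on_def by metis
    show "\<exists>\<delta>>0. \<forall>y\<in>A \<inter> D. \<forall>x\<in>D. norm (x - y) < \<delta> \<longrightarrow> \<bar>w (id x)\<bar> \<le> \<epsilon> * norm (x - y) ^ 0"
      using \<delta> w(2) by (intro exI[of _ \<delta>]) (fastforce simp: dist_norm)
  qed (use S D r in \<open>auto simp: D_def\<close>)
  then have "flat_covered X S A 0 (A \<inter> D)"
    unfolding flat_covered_def flat_piece_def by (intro exI[of _ "{A \<inter> D}"]) fastforce
  then have "flat_covered X S A 0 (A \<inter> ball x r)"
    by (rule flat_covered_mono) (use A in \<open>auto simp: D_def\<close>)
  then show "\<exists>Y. open Y \<and> x \<in> Y \<and> flat_covered X S A 0 (A \<inter> Y)"
    using r by (intro exI[of _ "ball x r"]) auto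
qed

text \<open>A chart of order \<open>k\<close> for the critical part \<open>A'\<close> has order
  \<open>k + 1\<close> for \<open>A\<close>: a function \<open>w\<close> vanishing on
  \<open>A\<close> is critical along \<open>S\<close> on \<open>A'\<close>, so integration gains an
  order, and the constant \<open>w (\<psi> y)\<close> is zero.\<close>

lemma flat_chart_Suc:
  assumes X: "open X" and S: "subspace S" and ch: "flat_chart X S A' k T D E \<psi> \<psi>'" and A: "A' \<subseteq> A"
    and crit: "\<And>w x s. Ck_on (Suc k) X w \<Longrightarrow> (\<forall>x\<in>A. w x = (0::real)) \<Longrightarrow> x \<in> A' \<Longrightarrow> s \<in> S \<Longrightarrow>
      frechet_derivative w (at x) s = 0"
  shows "flat_chart X S A (Suc k) T D E \<psi> \<psi>'"
  unfolding flat_chart_def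
proof (intro conjI ballI allI impI)
  show "\<psi> ` E \<subseteq> A" using flat_chartD(6)[OF ch] A by blast
  fix w :: "'a \<Rightarrow> real" and \<epsilon> :: real
  assume w: "Ck_on (Suc k) X w" "\<forall>x\<in>A. w x = 0" and \<epsilon>: "\<epsilon> > 0"
  have E: "w (\<psi> y) = 0" if "y \<in> E" for y using flat_chartD(6)[OF ch] A w(2) that by blast
  have "\<exists>\<delta>>0. \<forall>y\<in>E. \<forall>x\<in>D. norm (x - y) < \<delta> \<longrightarrow> \<bar>w (\<psi> x) - w (\<psi> y)\<bar> \<le> \<epsilon> * norm (x - y) ^ Suc k"
    by (rule flat_chart_integrate[OF X S ch w(1) _ \<epsilon>]) (rule crit[OF w])
  then show "\<exists>\<delta>>0. \<forall>y\<in>E. \<forall>x\<in>D. norm (x - y) < \<delta> \<longrightarrow> \<bar>w (\<psi> x)\<bar> \<le> \<epsilon> * norm (x - y) ^ Suc k"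
    using E by auto
qed (rule flat_chartD[OF ch] | assumption)+

lemma flat_chart_compose:
  assumes V: "open V" and \<iota>: "Ck_on (Suc k) V \<iota>" and d\<iota>: "\<And>v. v \<in> V \<Longrightarrow> (\<iota> has_derivative \<iota>' v) (at v)"
    and \<iota>S: "\<And>v h. v \<in> V \<Longrightarrow> h \<in> S' \<Longrightarrow> \<iota>' v h \<in> S" and im: "\<iota> ` (V \<inter> S') \<subseteq> X \<inter> S" "\<iota> ` V \<subseteq> X"
    and X: "open X" and ch: "flat_chart V S' A' (Suc k) T D E \<psi> \<psi>'" and A: "\<iota> ` A' \<subseteq> A"
  shows "flat_chart X S A (Suc k) T D E (\<lambda>x. \<iota> (\<psi> x)) (\<lambda>x h. \<iota>' (\<psi> x) (\<psi>' x h))"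
  unfolding flat_chart_def
proof (intro conjI ballI allI impI)
  have D: "compact D" "\<psi> ` D \<subseteq> V \<inter> S'"
    and \<psi>: "\<And>x. x \<in> D \<Longrightarrow> (\<psi> has_derivative \<psi>' x) (at x within D)"
    using flat_chartD[OF ch] by blast+
  show "(\<lambda>x. \<iota> (\<psi> x)) ` E \<subseteq> A" using flat_chartD(6)[OF ch] A by blast
  show "\<iota>' (\<psi> x) (\<psi>' x h) \<in> S" if "x \<in> D" "h \<in> T" for x h
    using flat_chartD(9)[OF ch that] \<iota>S D that by blast
  show "((\<lambda>x. \<iota> (\<psi> x)) has_derivative (\<lambda>h. \<iota>' (\<psi> x) (\<psi>' x h))) (at x within D)" if "x \<in> D" for x
    using has_derivative_compose[OF \<psi>[OF that] d\<iota>] D that by blast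
  show "(\<lambda>x. \<iota> (\<psi> x)) ` D \<subseteq> X \<inter> S" using D im by blast
  show "\<exists>C>0. \<forall>x\<in>D. \<forall>h. norm (\<iota>' (\<psi> x) (\<psi>' x h)) \<le> C * norm h"
  proof -
    obtain C where C: "C > 0" "\<And>x h. x \<in> D \<Longrightarrow> norm (\<psi>' x h) \<le> C * norm h"
      using flat_chartD(10)[OF ch] by blast
    have "continuous_on D \<psi>" using \<psi> has_derivative_continuous_on by blast
    then have cpt: "compact (\<psi> ` D)" using D compact_continuous_image by blast
    have "\<forall>b\<in>Basis. \<exists>K. \<forall>v\<in>\<psi> ` D. norm (\<iota>' v b) \<le> K"
    proof
      fix b :: 'a
      have "Ck_on k V (\<lambda>v. \<iota>' v b)" by (rule Ck_on_derivative_Ck[OF V \<iota> d\<iota>])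
      then have "continuous_on (\<psi> ` D) (\<lambda>v. \<iota>' v b)"
        using D by (meson Ck_on_continuous continuous_on_subset le_inf_iff)
      then have "bounded ((\<lambda>v. \<iota>' v b) ` \<psi> ` D)"
        using cpt compact_continuous_image compact_imp_bounded by blast
      then show "\<exists>K. \<forall>v\<in>\<psi> ` D. norm (\<iota>' v b) \<le> K" by (auto simp: bounded_iff)
    qed
    from bchoice[OF this] obtain K where K: "\<And>b v. b \<in> Basis \<Longrightarrow> v \<in> \<psi> ` D \<Longrightarrow> norm (\<iota>' v b) \<le> K b" by metis
    define L where "L = (\<Sum>b\<in>Basis. \<bar>K b\<bar>) + 1"
    have L: "L > 0" by (simp add: L_def add_nonneg_pos sum_nonneg)
    have b1: "norm (\<iota>' v h) \<le> L * norm h" if v: "v \<in> \<psi> ` D" for v h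
    proof -
      have lin: "linear (\<iota>' v)" using has_derivative_linear[OF d\<iota>] v D by blast
      have "\<iota>' v h = \<iota>' v (\<Sum>b\<in>Basis. (h \<bullet> b) *\<^sub>R b)" by (simp add: euclidean_representation)
      also have "\<dots> = (\<Sum>b\<in>Basis. (h \<bullet> b) *\<^sub>R \<iota>' v b)" by (simp add: linear_sum[OF lin] linear_scale[OF lin])
      also have "norm \<dots> \<le> (\<Sum>b\<in>Basis. norm h * \<bar>K b\<bar>)"
      proof (rule sum_norm_le)
        fix b :: 'a assume b: "b \<in> Basis"
        have "norm (\<iota>' v b) \<le> \<bar>K b\<bar>" using K[OF b v] by simp
        then show "norm ((h \<bullet> b) *\<^sub>R \<iota>' v b) \<le> norm h * \<bar>K b\<bar>"
          using Basis_le_norm[OF b, of h] by (simp add: mult_mono)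
      qed
      also have "\<dots> = (\<Sum>b\<in>Basis. \<bar>K b\<bar>) * norm h" by (simp add: sum_distrib_left mult.commute)
      also have "\<dots> \<le> L * norm h" by (intro mult_right_mono) (auto simp: L_def)
      finally show ?thesis .
    qed
    have "norm (\<iota>' (\<psi> x) (\<psi>' x h)) \<le> L * C * norm h" if "x \<in> D" for x h
    proof -
      have "norm (\<iota>' (\<psi> x) (\<psi>' x h)) \<le> L * norm (\<psi>' x h)" using b1 that by blast
      also have "\<dots> \<le> L * (C * norm h)" using C(2)[OF that] L by (intro mult_left_mono) auto
      finally show ?thesis by simp
    qed
    then show ?thesis using L C(1) by (intro exI[of _ "L * C"]) auto
  qed
  fix w :: "'a \<Rightarrow> real" and \<epsilon> :: real
  assume w: "Ck_on (Suc k) X w" "\<forall>x\<in>A. w x = 0" and \<epsilon>: "\<epsilon> > 0"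
  have 1: "Ck_on (Suc k) V (\<lambda>x. w (\<iota> x))" by (rule Ck_on_compose[OF V X w(1) \<iota> im(2)])
  have 2: "\<forall>x\<in>A'. w (\<iota> x) = 0" using w(2) A by blast
  show "\<exists>\<delta>>0. \<forall>y\<in>E. \<forall>x\<in>D. norm (x - y) < \<delta> \<longrightarrow> \<bar>w (\<iota> (\<psi> x))\<bar> \<le> \<epsilon> * norm (x - y) ^ Suc k"
    using flat_chartD(11)[OF ch 1 2] \<epsilon> by blast
qed (rule flat_chartD[OF ch])+

text \<open>Outer induction on \<open>dim S\<close>, inner induction on \<open>k\<close>. Where
  every admissible function vanishing on \<open>A\<close> is critical along \<open>S\<close>, the
  order rises from \<open>k\<close> to \<open>k + 1\<close>. Elsewhere some such function
  \<open>w\<close> is regular along \<open>S\<close>, so \<open>A\<close> lies locally in its zero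
  set, which flattens to a subspace of smaller dimension without lowering the order.\<close>

theorem flat_covered_all:
  assumes "open X" "subspace S" "A \<subseteq> X \<inter> S"
  shows "flat_covered X S A k A"
  using assms
proof (induction "dim S" arbitrary: X S A k rule: less_induct)
  case less
  note dimIH = less.hyps and X = less.prems(1) and S = less.prems(2)
  show ?case
    using less.prems(3)
  proof (induction k arbitrary: A)
    case 0
    show ?case by (rule flat_covered_0[OF X S 0])
  next
    case (Suc k)
    \<comment> \<open>The part of \<open>A\<close> where no function of class \<open>k + 1\<close>
      vanishing on \<open>A\<close> has a nonzero derivative along \<open>S\<close>. The inner
      induction hypothesis is applied to \<open>A'\<close> instead of \<open>A\<close>.\<close>
    define A' where "A' = {x\<in>A. \<forall>Y w s. open Y \<and> x \<in> Y \<and> Y \<subseteq> X \<and> Ck_on (Suc k) Y w \<and> (\<forall>x\<in>A \<inter> Y. w x = (0::real)) \<and> s \<in> S \<longrightarrow>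
        frechet_derivative w (at x) s = 0}"
    have A': "A' \<subseteq> X \<inter> S" "A' \<subseteq> A" using Suc.prems by (auto simp: A'_def)
    have 1: "flat_covered X S A (Suc k) A'"
    proof -
      have "flat_chart X S A (Suc k) T D E \<psi> \<psi>'" if "flat_chart X S A' k T D E \<psi> \<psi>'" for T D E \<psi> \<psi>'
      proof (rule flat_chart_Suc[OF X S that A'(2)])
        fix w :: "'a \<Rightarrow> real" and x s
        assume "Ck_on (Suc k) X w" "\<forall>x\<in>A. w x = 0" "x \<in> A'" "s \<in> S"
        moreover have "\<forall>x\<in>A \<inter> X. w x = 0" "x \<in> X" using calculation A' by blast+
        ultimately show "frechet_derivative w (at x) s = 0"
          using X unfolding A'_def by blast
      qed
      then show ?thesis
      proof -
        assume *: "\<And>T D E \<psi> \<psi>'. flat_chart X S A' k T D E \<psi> \<psi>' \<Longrightarrow> flat_chart X S A (Suc k) T D E \<psi> \<psi>'"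
        obtain \<F> where \<F>: "countable \<F>" "A' \<subseteq> \<Union>\<F>" "\<forall>F\<in>\<F>. flat_piece X S A' k F"
          using Suc.IH[OF A'(1)] by (rule flat_coveredE) (rule that)
        show ?thesis
          unfolding flat_covered_def
        proof (intro exI[of _ \<F>] conjI ballI)
          fix F assume "F \<in> \<F>"
          from bspec[OF \<F>(3) this, unfolded flat_piece_def] obtain T D E \<psi> \<psi>' where
            "dim T \<le> dim S" "flat_chart X S A' k T D E \<psi> \<psi>'" "F \<subseteq> \<psi> ` E" by (elim exE conjE)
          with * show "flat_piece X S A (Suc k) F"
            unfolding flat_piece_def by (intro exI conjI)
        qed (rule \<F>)+
      qed
    qed
    have 2: "flat_covered X S A (Suc k) (A - A')"
    proof (rule flat_covered_local)
      fix x assume x: "x \<in> A - A'"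
      then obtain Y w s0 where Y: "open Y" "x \<in> Y" "Y \<subseteq> X" and w: "Ck_on (Suc k) Y w" "\<forall>x\<in>A \<inter> Y. w x = (0::real)"
        and s0: "s0 \<in> S" "frechet_derivative w (at x) s0 \<noteq> 0"
        unfolding A'_def by blast
      have lw: "linear (frechet_derivative w (at x))"
        using has_derivative_linear[OF Ck_on_derivative[OF Y(1) w(1) Y(2)]] .
      have "s0 \<noteq> 0" using s0(2) linear_0[OF lw] by metis
      define s where "s = s0 /\<^sub>R norm s0"
      have s: "norm s = 1" "frechet_derivative w (at x) s \<noteq> 0" "s \<in> S"
        using \<open>s0 \<noteq> 0\<close> s0 by (simp_all add: s_def linear_scale[OF lw] subspace_scale[OF S])
      have ss: "s \<bullet> s = 1" using s(1) by (simp add: norm_eq_1)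
      obtain Y' V \<iota> \<iota>' where Y': "open Y'" "x \<in> Y'" "Y' \<subseteq> Y" "open V"
        and hom: "homeomorphism Y' V (\<lambda>y. y + (w y - y \<bullet> s) *\<^sub>R s) \<iota>" and \<iota>: "Ck_on (Suc k) V \<iota>"
        and d\<iota>: "\<forall>v\<in>V. (\<iota> has_derivative \<iota>' v) (at v)" "\<forall>v\<in>V. \<forall>h. \<exists>c. \<iota>' v h = h + c *\<^sub>R s"
        by (rule local_flattening[OF Y(1) w(1) Y(2) s(1,2)]) (rule that)
      let ?\<Theta> = "\<lambda>y. y + (w y - y \<bullet> s) *\<^sub>R s"
      \<comment> \<open>Since \<open>s\<close> belongs to \<open>S\<close> and not to
        \<open>S'\<close>, the dimension drops strictly.\<close>
      define S' where "S' = S \<inter> {v. s \<bullet> v = 0}"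
      have S': "subspace S'" unfolding S'_def by (rule subspace_inter[OF S subspace_hyperplane])
      have "s \<notin> S'" using ss by (auto simp: S'_def)
      moreover have "S' \<subseteq> S" by (simp add: S'_def)
      ultimately have "S' \<subset> S" using s(3) by blast
      then have dim: "dim S' < dim S"
        by (intro dim_psubset) (simp add: span_eq_iff[THEN iffD2, OF S] span_eq_iff[THEN iffD2, OF S'])
      define A1 where "A1 = ?\<Theta> ` (A \<inter> Y')"
      have \<Theta>V: "\<iota> (?\<Theta> y) = y" "?\<Theta> y \<in> V" if "y \<in> Y'" for y
        using homeomorphism_apply1[OF hom that] imageI[OF that, of ?\<Theta>, unfolded homeomorphism_image1[OF hom]] .
      have \<iota>V: "?\<Theta> (\<iota> v) = v" "\<iota> v \<in> Y'" if "v \<in> V" for v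
        using homeomorphism_apply2[OF hom that] imageI[OF that, of \<iota>, unfolded homeomorphism_image2[OF hom]] .
      have A1: "A1 \<subseteq> V \<inter> S'"
      proof
        fix v assume "v \<in> A1"
        then obtain y where y: "y \<in> A" "y \<in> Y'" "v = ?\<Theta> y" unfolding A1_def by blast
        have "w y = 0" using w(2) y Y' by blast
        then have "s \<bullet> v = 0" using y(3) ss by (simp add: inner_diff_right inner_commute)
        moreover have "v \<in> S" using y s(3) Suc.prems S by (auto intro!: subspace_add subspace_scale)
        ultimately show "v \<in> V \<inter> S'" using \<Theta>V(2)[OF y(2)] y(3) by (simp add: S'_def)
      qed
      have cov: "flat_covered V S' A1 (Suc k) A1" by (rule dimIH[OF dim Y'(4) S' A1])
      have \<iota>form: "\<exists>c. \<iota> v = v + c *\<^sub>R s" if "v \<in> V" for v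
      proof -
        have "\<iota> v = v - (w (\<iota> v) - \<iota> v \<bullet> s) *\<^sub>R s"
          using \<iota>V(1)[OF that] by (metis add_diff_cancel)
        then have "\<iota> v = v + (- (w (\<iota> v) - \<iota> v \<bullet> s)) *\<^sub>R s" by (simp only: scaleR_minus_left add_uminus_conv_diff)
        then show ?thesis by blast
      qed
      have comp: "flat_chart X S A (Suc k) T D E (\<lambda>x. \<iota> (\<psi> x)) (\<lambda>x h. \<iota>' (\<psi> x) (\<psi>' x h))"
        if ch: "flat_chart V S' A1 (Suc k) T D E \<psi> \<psi>'" for T D E \<psi> \<psi>'
      proof (rule flat_chart_compose[OF Y'(4) \<iota> bspec[OF d\<iota>(1)] _ _ _ X ch])
        show "\<iota>' v h \<in> S" if "v \<in> V" "h \<in> S'" for v h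
        proof -
          have "\<exists>c. \<iota>' v h = h + c *\<^sub>R s" using bspec[OF d\<iota>(2) that(1)] by (rule spec)
          then obtain c where "\<iota>' v h = h + c *\<^sub>R s" ..
          then show ?thesis using that(2) s(3) by (simp add: S'_def subspace_add[OF S] subspace_scale[OF S])
        qed
        show "\<iota> ` V \<subseteq> X" using \<iota>V(2) Y' Y by blast
        show "\<iota> ` (V \<inter> S') \<subseteq> X \<inter> S"
        proof clarify
          fix v assume v: "v \<in> V" "v \<in> S'"
          obtain c where "\<iota> v = v + c *\<^sub>R s" using \<iota>form[OF v(1)] ..
          then have "\<iota> v \<in> S" using v(2) s(3) by (simp add: S'_def subspace_add[OF S] subspace_scale[OF S])
          then show "\<iota> v \<in> X \<inter> S" using \<iota>V(2)[OF v(1)] Y' Y by blast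
        qed
        show "\<iota> ` A1 \<subseteq> A" using \<Theta>V(1) by (auto simp: A1_def)
      qed auto
      obtain \<F> where \<F>: "countable \<F>" "A1 \<subseteq> \<Union>\<F>" "\<forall>F\<in>\<F>. flat_piece V S' A1 (Suc k) F"
        using cov by (rule flat_coveredE) (rule that)
      have "flat_covered X S A (Suc k) (\<iota> ` A1)"
        unfolding flat_covered_def
      proof (intro exI[of _ "(`) \<iota> ` \<F>"] conjI ballI)
        show "countable ((`) \<iota> ` \<F>)" using \<F>(1) by simp
        show "\<iota> ` A1 \<subseteq> \<Union> ((`) \<iota> ` \<F>)" using \<F>(2) by blast
        fix F' assume "F' \<in> (`) \<iota> ` \<F>"
        then obtain F where F: "F \<in> \<F>" "F' = \<iota> ` F" by blast
        then obtain T D E \<psi> \<psi>' where "dim T \<le> dim S'" "flat_chart V S' A1 (Suc k) T D E \<psi> \<psi>'" "F \<subseteq> \<psi> ` E"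
          using bspec[OF \<F>(3) F(1), unfolded flat_piece_def] by (elim exE conjE)
        then have "dim T \<le> dim S" "flat_chart X S A (Suc k) T D E (\<lambda>x. \<iota> (\<psi> x)) (\<lambda>x h. \<iota>' (\<psi> x) (\<psi>' x h))" "F' \<subseteq> (\<lambda>x. \<iota> (\<psi> x)) ` E"
          using dim comp F(2) by (auto simp del: not_less)
        then show "flat_piece X S A (Suc k) F'"
          unfolding flat_piece_def by (intro exI conjI)
      qed
      moreover have "\<iota> ` A1 = A \<inter> Y'" using \<Theta>V(1) by (force simp: A1_def image_image)
      ultimately show "\<exists>Y. open Y \<and> x \<in> Y \<and> flat_covered X S A (Suc k) ((A - A') \<inter> Y)"
        using Y'(1,2) by (intro exI[of _ Y']) (auto elim: flat_covered_mono)
    qed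
    have "flat_covered X S A (Suc k) (\<Union>{A', A - A'})"
      by (rule flat_covered_Union) (use 1 2 in auto)
    then show ?case by (rule flat_covered_mono) auto
  qed
qed

text \<open>Charts of order \<open>k\<close> are enough: the partial derivatives of \<open>f\<close>
  along \<open>S\<close> have class \<open>k\<close> and vanish on \<open>A\<close>, and one
  integration turns this into oscillation of order \<open>k + 1\<close>, matching the dimension
  bound of the grid estimate.\<close>

theorem negligible_critical_values:
  fixes f :: "'a::euclidean_space \<Rightarrow> real"
  assumes X: "open X" and S: "subspace S" "dim S \<le> Suc k" and A: "A \<subseteq> X \<inter> S"
    and f: "Ck_on (Suc k) X f" and crit: "\<And>x s. x \<in> A \<Longrightarrow> s \<in> S \<Longrightarrow> frechet_derivative f (at x) s = 0"
  shows "negligible (f ` A)"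
proof -
  obtain \<F> where \<F>: "countable \<F>" "A \<subseteq> \<Union>\<F>" "\<forall>F\<in>\<F>. flat_piece X S A k F"
    using flat_covered_all[OF X S(1) A, of k] by (rule flat_coveredE) (rule that)
  have "negligible (f ` F)" if F\<F>: "F \<in> \<F>" for F
  proof -
    obtain T D E \<psi> \<psi>' where T: "dim T \<le> dim S" and ch: "flat_chart X S A k T D E \<psi> \<psi>'" and F: "F \<subseteq> \<psi> ` E"
      using bspec[OF \<F>(3) F\<F>, unfolded flat_piece_def] by (elim exE conjE)
    have "subspace T" "bounded D" "D \<subseteq> T" "E \<subseteq> D"
      using flat_chartD(1,2,4,5)[OF ch] by (auto intro: compact_imp_bounded)
    moreover have "dim T \<le> Suc k" using T S by simp
    moreover have "\<exists>\<delta>>0. \<forall>y\<in>E. \<forall>x\<in>E. norm (x - y) < \<delta> \<longrightarrow> \<bar>f (\<psi> x) - f (\<psi> y)\<bar> \<le> \<epsilon> * norm (x - y) ^ Suc k" if "\<epsilon> > 0" for \<epsilon>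
      using flat_chart_integrate[OF X S(1) ch f crit that] \<open>E \<subseteq> D\<close> by blast
    moreover have "bounded E" "E \<subseteq> T"
      using calculation bounded_subset by blast+
    ultimately have "negligible ((\<lambda>x. f (\<psi> x)) ` E)"
      by (intro negligible_image_small_oscillation[of T "Suc k"])
    then show ?thesis by (rule negligible_subset) (use F in blast)
  qed
  then have "negligible (\<Union>((`) f ` \<F>))" using \<F>(1) by (intro negligible_countable_Union) auto
  then show ?thesis by (rule negligible_subset) (use \<F>(2) in blast)
qed

section \<open>The normal field and the flat set\<close>

locale oriented_hypersurface =
  fixes M :: "'a::euclidean_space set" and \<nu> :: "'a \<Rightarrow> 'a" and n :: nat
  assumes n2: "n \<ge> 2" and dim: "DIM('a) = n + 1"
    and emb: "embedded_submanifold (n + 1) n M" and normal: "unit_normal_field M \<nu>"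
begin

lemma norm_normal: "p \<in> M \<Longrightarrow> norm (\<nu> p) = 1"
  using normal by (simp add: unit_normal_field_def)

lemma normal_continuous: "continuous_on M \<nu>"
  using normal by (simp add: unit_normal_field_def)

lemma tangent_space: "p \<in> M \<Longrightarrow> tangent_space M p = {v. \<nu> p \<bullet> v = 0}"
  using tangent_space_eq[OF _ dim normal] emb by simp

lemma chart_hyperplane:
  fixes S :: "'a set"
  assumes "subspace S" "dim S = n"
  obtains a where "a \<noteq> 0" "S = {x. a \<bullet> x = 0}"
proof -
  obtain a where a: "a \<noteq> 0" "span S \<subseteq> {x. a \<bullet> x = 0}"
    using lowdim_subset_hyperplane[of S] assms dim by auto
  have "S = {x. a \<bullet> x = 0}"
    by (rule subspace_dim_equal) (use assms a dim span_superset[of S] in \<open>auto simp: subspace_hyperplane dim_hyperplane\<close>)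
  then show thesis using that a(1) by blast
qed

text \<open>\<open>F\<close> is the coordinate of a slice chart transverse to the slice, and
  \<open>G\<close> is its gradient. The gradient does not vanish because the derivative of the chart
  is onto: it maps \<open>?B a\<close> to \<open>a\<close>.\<close>

lemma local_defining_function:
  assumes p: "p \<in> M"
  obtains U F G where "open U" "p \<in> U" "Ck_on n U G"
    "\<forall>x\<in>U. (F has_derivative (\<lambda>h. G x \<bullet> h)) (at x)" "\<forall>x\<in>U. G x \<noteq> 0" "\<forall>x\<in>U. x \<in> M \<longleftrightarrow> F x = (0::real)"
proof -
  obtain U V \<phi> \<psi> S where pU: "p \<in> U" and d: "Ck_diffeomorphism (n + 1) U V \<phi> \<psi>"
    and S: "subspace S" "dim S = n" and img: "\<phi> ` (M \<inter> U) = V \<inter> S"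
    using emb p unfolding embedded_submanifold_def by blast
  have opn: "open U" "open V" and hom: "homeomorphism U V \<phi> \<psi>"
    and ck: "Ck_on (Suc n) U \<phi>" "Ck_on (Suc n) V \<psi>"
    using d by (auto simp: Ck_diffeomorphism_def simp del: Ck_on.simps)
  obtain a where a: "a \<noteq> 0" "S = {x. a \<bullet> x = 0}" by (rule chart_hyperplane[OF S])
  define F where "F x = a \<bullet> \<phi> x" for x
  let ?F' = "\<lambda>x. frechet_derivative F (at x)"
  define G where "G x = (\<Sum>b\<in>Basis. ?F' x b *\<^sub>R b)" for x
  have ckF: "Ck_on (Suc n) U F" unfolding F_def by (intro Ck_on_inner Ck_on_const opn ck)
  have dF: "(F has_derivative ?F' x) (at x)" if "x \<in> U" for x by (rule Ck_on_derivative[OF opn(1) ckF that])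
  have FG: "?F' x h = G x \<bullet> h" if "x \<in> U" for x h
  proof -
    note lin = has_derivative_linear[OF dF[OF that]]
    have "?F' x h = ?F' x (\<Sum>b\<in>Basis. (h \<bullet> b) *\<^sub>R b)" by (simp add: euclidean_representation)
    then show ?thesis by (simp add: linear_sum[OF lin] linear_scale[OF lin] G_def inner_sum_left inner_sum_right inner_commute mult.commute)
  qed
  show thesis
  proof (rule that[of U G F])
    show "Ck_on n U G" unfolding G_def
      by (intro Ck_on_sum Ck_on_scaleR Ck_on_const opn) (use ckF in auto)
    show "\<forall>x\<in>U. (F has_derivative (\<lambda>h. G x \<bullet> h)) (at x)"
    proof
      fix x assume x: "x \<in> U"
      have "?F' x = (\<lambda>h. G x \<bullet> h)" by (rule ext) (rule FG[OF x])
      then show "(F has_derivative (\<lambda>h. G x \<bullet> h)) (at x)" using dF[OF x] by simp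
    qed
    show "\<forall>x\<in>U. G x \<noteq> 0"
    proof
      fix x assume x: "x \<in> U"
      have q: "\<phi> x \<in> V" "\<psi> (\<phi> x) = x" using hom x by (auto simp: homeomorphism_def)
      let ?A = "frechet_derivative \<phi> (at x)" and ?B = "frechet_derivative \<psi> (at (\<phi> x))"
      have A: "(\<phi> has_derivative ?A) (at x)" by (rule Ck_on_derivative[OF opn(1) ck(1) x])
      have B: "(\<psi> has_derivative ?B) (at (\<phi> x))" by (rule Ck_on_derivative[OF opn(2) ck(2) q(1)])
      have "((\<phi> \<circ> \<psi>) has_derivative (?A \<circ> ?B)) (at (\<phi> x))"
        using diff_chain_at[OF B] A q by auto
      moreover have "((\<phi> \<circ> \<psi>) has_derivative id) (at (\<phi> x))"
        by (rule has_derivative_transform_within_open[OF has_derivative_id opn(2) q(1)])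
          (use hom in \<open>auto simp: homeomorphism_def\<close>)
      ultimately have "?A \<circ> ?B = id" by (rule has_derivative_unique)
      then have AB: "?A (?B a) = a" by (metis comp_apply id_apply)
      have "(F has_derivative (\<lambda>h. a \<bullet> ?A h)) (at x)" unfolding F_def by (rule has_derivative_inner_right[OF A])
      then have "?F' x = (\<lambda>h. a \<bullet> ?A h)" using dF[OF x] has_derivative_unique by blast
      then have "G x \<bullet> ?B a = a \<bullet> a" using FG[OF x] AB by metis
      then show "G x \<noteq> 0" using a(1) by auto
    qed
    show "\<forall>x\<in>U. x \<in> M \<longleftrightarrow> F x = 0"
    proof
      fix x assume x: "x \<in> U"
      have "F x = 0 \<longleftrightarrow> \<phi> x \<in> V \<inter> S" using hom x by (auto simp: F_def a(2) homeomorphism_def)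
      also have "\<dots> \<longleftrightarrow> \<phi> x \<in> \<phi> ` (M \<inter> U)" by (simp only: img)
      also have "\<dots> \<longleftrightarrow> x \<in> M"
      proof
        assume "\<phi> x \<in> \<phi> ` (M \<inter> U)"
        then obtain m where "m \<in> M" "m \<in> U" "\<phi> x = \<phi> m" by blast
        then show "x \<in> M" using homeomorphism_apply1[OF hom] x by metis
      qed (use x in blast)
      finally show "x \<in> M \<longleftrightarrow> F x = 0" by blast
    qed
  qed (use opn pU in auto)
qed

text \<open>The tangential part \<open>v\<close> of \<open>g\<close> is the velocity of a curve in
  \<open>M\<close>, along which \<open>F\<close> is constantly zero. So
  \<open>g \<bullet> v = 0\<close>, and therefore \<open>v \<bullet> v = 0\<close>.\<close>

lemma gradient_parallel_normal:
  assumes U: "open U" "x \<in> U" "x \<in> M" and F: "(F has_derivative (\<lambda>h. g \<bullet> h)) (at x)"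
    and FM: "\<forall>x\<in>U. x \<in> M \<longleftrightarrow> F x = (0::real)"
  shows "g = (g \<bullet> \<nu> x) *\<^sub>R \<nu> x"
proof -
  have nn: "\<nu> x \<bullet> \<nu> x = 1" using norm_normal[OF U(3)] by (simp add: norm_eq_1)
  define v where "v = g - (g \<bullet> \<nu> x) *\<^sub>R \<nu> x"
  have nv: "\<nu> x \<bullet> v = 0" using nn by (simp add: v_def inner_diff_right inner_commute)
  then have "v \<in> tangent_space M x" using tangent_space[OF U(3)] by simp
  then obtain \<gamma> where g: "\<gamma> 0 = x" "\<forall>\<^sub>F t in nhds 0. \<gamma> t \<in> M" "(\<gamma> has_vector_derivative v) (at (0::real))"
    by (auto simp: tangent_space_def)
  have 1: "((F \<circ> \<gamma>) has_vector_derivative g \<bullet> v) (at 0)"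
    using has_derivative_tangent[of F "\<lambda>h. g \<bullet> h" x UNIV \<gamma> v] F g(1,3) by simp
  have "isCont \<gamma> 0" using g(3) has_vector_derivative_continuous by blast
  then have "(\<gamma> \<longlongrightarrow> \<gamma> 0) (nhds 0)" unfolding isCont_def tendsto_at_iff_tendsto_nhds .
  then have "\<forall>\<^sub>F t in nhds 0. \<gamma> t \<in> U"
    using topological_tendstoD U(1,2) g(1) by blast
  then have ev: "\<forall>\<^sub>F t in nhds 0. (F \<circ> \<gamma>) t = 0" using g(2)
    by eventually_elim (use FM in auto)
  then obtain T where T: "open T" "0 \<in> T" "\<And>t. t \<in> T \<Longrightarrow> (F \<circ> \<gamma>) t = 0"
    unfolding eventually_nhds by blast
  have "((F \<circ> \<gamma>) has_vector_derivative 0) (at 0)"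
    by (rule has_vector_derivative_transform_within_open[where f = "\<lambda>_. 0", OF has_vector_derivative_const T(1,2)])
      (use T(3) in simp)
  then have "g \<bullet> v = 0" using vector_derivative_unique_at[OF 1] by simp
  then have "v \<bullet> v = 0" using nv by (simp add: v_def inner_diff_left)
  then show ?thesis by (simp add: v_def)
qed

lemma local_normal_form:
  assumes p: "p \<in> M"
  obtains W F G where "open W" "p \<in> W" "Ck_on n W G"
    "\<forall>x\<in>W. (F has_derivative (\<lambda>h. G x \<bullet> h)) (at x)" "\<forall>x\<in>W. G x \<noteq> 0" "\<forall>x\<in>W. x \<in> M \<longleftrightarrow> F x = (0::real)"
    "\<forall>x\<in>M \<inter> W. \<nu> x = G x /\<^sub>R norm (G x)"
proof -
  obtain U F G where U: "open U" "p \<in> U" and G: "Ck_on n U G"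
    and dF: "\<forall>x\<in>U. (F has_derivative (\<lambda>h. G x \<bullet> h)) (at x)" and G0: "\<forall>x\<in>U. G x \<noteq> 0"
    and FM: "\<forall>x\<in>U. x \<in> M \<longleftrightarrow> F x = (0::real)"
    by (rule local_defining_function[OF p])
  have par: "G x = (G x \<bullet> \<nu> x) *\<^sub>R \<nu> x" if "x \<in> M" "x \<in> U" for x
    by (rule gradient_parallel_normal[OF U(1) that(2,1) bspec[OF dF that(2)] FM])
  then have nz: "G x \<bullet> \<nu> x \<noteq> 0" if "x \<in> M" "x \<in> U" for x
    using G0 that by (metis scaleR_zero_left)
  \<comment> \<open>The sign by which the gradient must be multiplied to point to the side of \<nu>;
    by continuity it is the same on \<open>M\<close> near \<open>p\<close>.\<close>
  define s where "s = sgn (G p \<bullet> \<nu> p)"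
  have s: "s = 1 \<or> s = - 1" using nz[OF p U(2)] by (auto simp: s_def sgn_if)
  have "continuous_on (M \<inter> U) (\<lambda>x. s * (G x \<bullet> \<nu> x))"
    using Ck_on_continuous[OF G] normal_continuous by (intro continuous_intros) (auto intro: continuous_on_subset)
  then have "openin (top_of_set (M \<inter> U)) ((M \<inter> U) \<inter> (\<lambda>x. s * (G x \<bullet> \<nu> x)) -` {0<..})"
    by (rule continuous_openin_preimage_gen) auto
  then obtain T where T: "open T" "(M \<inter> U) \<inter> (\<lambda>x. s * (G x \<bullet> \<nu> x)) -` {0<..} = (M \<inter> U) \<inter> T"
    unfolding openin_open by blast
  have "s * (G p \<bullet> \<nu> p) > 0" using nz[OF p U(2)] by (simp add: s_def sgn_mult_self_eq linordered_idom_class.mult_sgn_abs abs_sgn[symmetric] mult.commute)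
  then have pT: "p \<in> T" using T(2) p U(2) by blast
  show thesis
  proof (rule that[of "U \<inter> T" "\<lambda>x. s *\<^sub>R G x" "\<lambda>x. s * F x"])
    have o: "open (U \<inter> T)" using U T by blast
    show "Ck_on n (U \<inter> T) (\<lambda>x. s *\<^sub>R G x)"
      by (intro Ck_on_scaleR Ck_on_const o Ck_on_subset[OF U(1) o _ G]) auto
    show "\<forall>x\<in>U \<inter> T. ((\<lambda>x. s * F x) has_derivative (\<lambda>h. (s *\<^sub>R G x) \<bullet> h)) (at x)"
    proof
      fix x assume "x \<in> U \<inter> T"
      then have "(F has_derivative (\<lambda>h. G x \<bullet> h)) (at x)" using dF by blast
      from has_derivative_mult_right[OF this, of s] show "((\<lambda>x. s * F x) has_derivative (\<lambda>h. (s *\<^sub>R G x) \<bullet> h)) (at x)"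
        by simp
    qed
    show "\<forall>x\<in>U \<inter> T. s *\<^sub>R G x \<noteq> 0" "\<forall>x\<in>U \<inter> T. x \<in> M \<longleftrightarrow> s * F x = 0" using G0 FM s by auto
    show "\<forall>x\<in>M \<inter> (U \<inter> T). \<nu> x = (s *\<^sub>R G x) /\<^sub>R norm (s *\<^sub>R G x)"
    proof
      fix x assume x: "x \<in> M \<inter> (U \<inter> T)"
      define c where "c = G x \<bullet> \<nu> x"
      have "s * c > 0" using T(2) x unfolding c_def by blast
      then have sc: "s * c = \<bar>c\<bar>" using s by auto
      have g: "G x = c *\<^sub>R \<nu> x" unfolding c_def by (rule par) (use x in auto)
      have "norm (s *\<^sub>R G x) = \<bar>c\<bar>" using norm_normal[of x] x s by (auto simp: g)
      moreover have "s *\<^sub>R G x = \<bar>c\<bar> *\<^sub>R \<nu> x" by (simp add: g sc)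
      moreover have "\<bar>c\<bar> \<noteq> 0" using \<open>s * c > 0\<close> by auto
      ultimately show "\<nu> x = (s *\<^sub>R G x) /\<^sub>R norm (s *\<^sub>R G x)" by simp
    qed
  qed (use U T pT in auto)
qed

text \<open>The normalised gradient of the defining function. One derivative of \<open>M\<close> is
  spent here, which leaves class \<open>n\<close> for the Morse-Sard argument.\<close>

lemma unit_normal_extension:
  assumes p: "p \<in> M"
  obtains W N where "open W" "p \<in> W" "Ck_on n W N" "\<forall>x\<in>W. norm (N x) = 1" "\<forall>x\<in>M \<inter> W. N x = \<nu> x"
proof -
  obtain W F G where W: "open W" "p \<in> W" and G: "Ck_on n W G"
    and "\<forall>x\<in>W. (F has_derivative (\<lambda>h. G x \<bullet> h)) (at x)" and G0: "\<forall>x\<in>W. G x \<noteq> 0"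
    and "\<forall>x\<in>W. x \<in> M \<longleftrightarrow> F x = (0::real)" and \<nu>: "\<forall>x\<in>M \<inter> W. \<nu> x = G x /\<^sub>R norm (G x)"
    by (rule local_normal_form[OF p])
  show thesis
  proof (rule that[of W "\<lambda>x. inverse (sqrt (G x \<bullet> G x)) *\<^sub>R G x"])
    have 1: "sqrt (G x \<bullet> G x) \<noteq> 0" "G x \<bullet> G x > 0" if "x \<in> W" for x using G0 that by auto
    show "Ck_on n W (\<lambda>x. inverse (sqrt (G x \<bullet> G x)) *\<^sub>R G x)"
      by (intro Ck_on_scaleR[OF W(1) Ck_on_inverse[OF W(1) Ck_on_sqrt[OF W(1) Ck_on_inner[OF W(1) G G] 1(2)] 1(1)] G])
    show "\<forall>x\<in>W. norm (inverse (sqrt (G x \<bullet> G x)) *\<^sub>R G x) = 1" using G0 by (auto simp flip: norm_eq_sqrt_inner)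
    show "\<forall>x\<in>M \<inter> W. inverse (sqrt (G x \<bullet> G x)) *\<^sub>R G x = \<nu> x" using \<nu> by (auto simp flip: norm_eq_sqrt_inner)
  qed (use W in auto)
qed

section \<open>The shape operator\<close>

lemma n_Suc: "n = Suc (n - 1)" using n2 by simp

lemma shape_from_extension:
  assumes p: "p \<in> M" and W: "open W" "p \<in> W" "Ck_on n W N" "\<forall>x\<in>W. norm (N x) = 1" "\<forall>x\<in>M \<inter> W. N x = \<nu> x"
  shows "(\<nu> has_derivative frechet_derivative N (at p)) (at p within M)"
    "frechet_derivative N (at p) h \<bullet> \<nu> p = 0"
    "(N has_derivative frechet_derivative N (at p)) (at p)"
proof -
  let ?D = "frechet_derivative N (at p)"
  show D: "(N has_derivative ?D) (at p)"
    using Ck_on_derivative[OF W(1) _ W(2), of "n - 1" N] W(3) n_Suc by metis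
  then have "(N has_derivative ?D) (at p within M)" by (rule has_derivative_at_withinI)
  then show "(\<nu> has_derivative ?D) (at p within M)"
  proof (rule has_derivative_transform_eventually)
    show "\<forall>\<^sub>F x in at p within M. N x = \<nu> x"
      unfolding eventually_at_topological using W by blast
  qed (use W p in auto)
  have "((\<lambda>x. N x \<bullet> N x) has_derivative (\<lambda>h. N p \<bullet> ?D h + ?D h \<bullet> N p)) (at p)"
    using D by (intro has_derivative_inner)
  moreover have "((\<lambda>x. N x \<bullet> N x) has_derivative (\<lambda>h. 0)) (at p)"
    by (rule has_derivative_transform_within_open[OF has_derivative_const W(1,2)])
      (use W(4) in \<open>simp add: norm_eq_1\<close>)
  ultimately have "(\<lambda>h. N p \<bullet> ?D h + ?D h \<bullet> N p) = (\<lambda>h. 0)" by (rule has_derivative_unique)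
  then have "N p \<bullet> ?D h + ?D h \<bullet> N p = 0" by metis
  moreover have "N p = \<nu> p" using W p by blast
  ultimately show "?D h \<bullet> \<nu> p = 0" by (simp add: inner_commute)
qed

lemma normal_differentiable:
  assumes p: "p \<in> M"
  obtains D where "(\<nu> has_derivative D) (at p within M)" "\<And>h. D h \<bullet> \<nu> p = 0"
  using unit_normal_extension[OF p] shape_from_extension[OF p] by metis

lemma frame: "p \<in> M \<Longrightarrow> orthonormal_basis_of {v. \<nu> p \<bullet> v = 0} (tangent_frame M p)"
  using tangent_frame[of M p] tangent_space by (simp add: subspace_hyperplane)

text \<open>Any derivative \<open>D\<close> of \<nu> within \<open>M\<close> may serve as minus the
  shape operator, since all of them agree on tangent vectors. Later arguments can thus pick a
  \<open>D\<close> whose values are tangent.\<close>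

lemma curvature_shape:
  assumes p: "p \<in> M" and D: "(\<nu> has_derivative D) (at p within M)"
  shows "mean_curvature M \<nu> p = - (\<Sum>e\<in>tangent_frame M p. D e \<bullet> e)"
    "scalar_curvature M \<nu> p = (mean_curvature M \<nu> p)\<^sup>2 - (\<Sum>e\<in>tangent_frame M p. \<Sum>f\<in>tangent_frame M p. (D e \<bullet> f)\<^sup>2)"
proof -
  have "tangent_frame M p \<subseteq> tangent_space M p"
    using frame[OF p] span_superset unfolding orthonormal_basis_of_def tangent_space[OF p] by metis
  then have eq: "frechet_derivative \<nu> (at p within M) e = D e" if "e \<in> tangent_frame M p" for e
    using frechet_derivative_tangent[OF D] that by blast
  show "mean_curvature M \<nu> p = - (\<Sum>e\<in>tangent_frame M p. D e \<bullet> e)"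
    by (simp add: mean_curvature_def surface_divergence_def eq)
  show "scalar_curvature M \<nu> p = (mean_curvature M \<nu> p)\<^sup>2 - (\<Sum>e\<in>tangent_frame M p. \<Sum>f\<in>tangent_frame M p. (D e \<bullet> f)\<^sup>2)"
    by (simp add: scalar_curvature_def norm_sq_second_fundamental_form_def second_fundamental_form_def eq)
qed

text \<open>The tangent frame is chosen anew at each point and need not vary continuously. The
  divergence of a local unit extension refers to no frame, and it is continuous because
  \<open>n \<ge> 1\<close>.\<close>

lemma mean_curvature_continuous: "continuous_on M (mean_curvature M \<nu>)"
  unfolding continuous_on_eq_continuous_within
proof
  fix p assume p: "p \<in> M"
  obtain W N where W: "open W" "p \<in> W" "Ck_on n W N" "\<forall>x\<in>W. norm (N x) = 1" "\<forall>x\<in>M \<inter> W. N x = \<nu> x"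
    by (rule unit_normal_extension[OF p])
  define g where "g x = - (\<Sum>b\<in>Basis. frechet_derivative N (at x) b \<bullet> b)" for x
  have eq: "mean_curvature M \<nu> x = g x" if "x \<in> M" "x \<in> W" for x
    unfolding g_def
  proof (rule mean_curvature_eq_divergence[OF _ dim normal that(1) W(1) that(2)])
    show "embedded_submanifold (Suc n) n M" using emb by simp
    show "N differentiable at x"
      using shape_from_extension(3)[OF that(1) W(1) that(2) W(3-5)] by (auto simp: differentiable_def)
  qed (use W in auto)
  have "Ck_on (Suc (n - 1)) W N" using W(3) n_Suc by simp
  then have "continuous_on W (\<lambda>x. frechet_derivative N (at x) b)" for b
    by (intro Ck_on_continuous[of "n - 1"]) simp
  then have "continuous_on W g" unfolding g_def by (intro continuous_intros)
  then have "isCont g p" using W by (simp add: continuous_on_eq_continuous_at)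
  then have cg: "continuous (at p within M) g" by (rule continuous_at_imp_continuous_at_within)
  obtain d where d: "d > 0" "ball p d \<subseteq> W" using W(1,2) openE by blast
  from cg d(1) p show "continuous (at p within M) (mean_curvature M \<nu>)"
  proof (rule continuous_transform_within)
    fix x assume "x \<in> M" "dist x p < d"
    then show "g x = mean_curvature M \<nu> x" using eq[of x] d(2) by (auto simp: dist_commute)
  qed
qed

end

section \<open>Flat points and their tangent planes\<close>

locale nonneg_scalar_hypersurface = oriented_hypersurface +
  assumes scal: "\<And>p. p \<in> M \<Longrightarrow> scalar_curvature M \<nu> p \<ge> 0"
begin

definition flat_points :: "'a set" where
  "flat_points = {p\<in>M. mean_curvature M \<nu> p = 0}"

lemma shape_flat_point:
  assumes p: "p \<in> flat_points" and D: "(\<nu> has_derivative D) (at p within M)" "\<And>h. D h \<bullet> \<nu> p = 0"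
    and v: "\<nu> p \<bullet> v = 0"
  shows "D v = 0"
proof -
  have pM: "p \<in> M" and H: "mean_curvature M \<nu> p = 0" using p by (auto simp: flat_points_def)
  let ?E = "tangent_frame M p"
  note E = frame[OF pM]
  have fin: "finite ?E" by (rule orthonormal_basis_of_finite[OF E])
  have "(\<Sum>e\<in>?E. \<Sum>f\<in>?E. (D e \<bullet> f)\<^sup>2) \<le> 0"
    using scal[OF pM] curvature_shape(2)[OF pM D(1)] H by simp
  then have "(\<Sum>e\<in>?E. \<Sum>f\<in>?E. (D e \<bullet> f)\<^sup>2) = 0" by (intro antisym sum_nonneg) auto
  then have "\<forall>e\<in>?E. (\<Sum>f\<in>?E. (D e \<bullet> f)\<^sup>2) = 0"
    using sum_nonneg_eq_0_iff[OF fin, of "\<lambda>e. \<Sum>f\<in>?E. (D e \<bullet> f)\<^sup>2"] by (simp add: sum_nonneg)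
  then have ef: "D e \<bullet> f = 0" if "e \<in> ?E" "f \<in> ?E" for e f
    using sum_nonneg_eq_0_iff[OF fin, of "\<lambda>f. (D e \<bullet> f)\<^sup>2"] that by simp
  have De: "D e = 0" if "e \<in> ?E" for e
  proof -
    have "D e \<in> {v. \<nu> p \<bullet> v = 0}" using D(2)[of e] by (simp add: inner_commute)
    from orthonormal_basis_of_expand[OF E this] show ?thesis using ef[OF that] by simp
  qed
  note lin = has_derivative_linear[OF D(1)]
  have "D v = D (\<Sum>e\<in>?E. (v \<bullet> e) *\<^sub>R e)" using orthonormal_basis_of_expand[OF E, of v] v by simp
  also have "\<dots> = 0" by (simp add: linear_sum[OF lin] linear_scale[OF lin] De)
  finally show ?thesis .
qed

text \<open>Morse-Sard in a slice chart: \<open>k\<close> pulled back by \<psi> has class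
  \<open>n\<close> on a subspace of dimension \<open>n\<close>. It is critical at the preimages of
  flat points, because the derivative of \<psi> maps slice directions to tangent vectors, where
  \<open>crit\<close> applies.\<close>

lemma negligible_image_flat_points_local:
  fixes k :: "'a \<Rightarrow> real"
  assumes p: "p \<in> M" and W: "open W" "p \<in> W" and k: "Ck_on n W k" "\<And>x. x \<in> W \<Longrightarrow> (k has_derivative k' x) (at x)"
    and crit: "\<And>x v. x \<in> flat_points \<Longrightarrow> x \<in> W \<Longrightarrow> \<nu> x \<bullet> v = 0 \<Longrightarrow> k' x v = 0"
  shows "\<exists>T. open T \<and> p \<in> T \<and> negligible (k ` (flat_points \<inter> T))"
proof -
  obtain U V \<phi> \<psi> S where pU: "p \<in> U" and d: "Ck_diffeomorphism (n + 1) U V \<phi> \<psi>"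
    and S: "subspace S" "dim S = n" and img: "\<phi> ` (M \<inter> U) = V \<inter> S"
    using emb p unfolding embedded_submanifold_def by blast
  have opn: "open U" "open V" and hom: "homeomorphism U V \<phi> \<psi>" and ck: "Ck_on (Suc n) V \<psi>"
    using d by (auto simp: Ck_diffeomorphism_def simp del: Ck_on.simps)
  have \<psi>M: "\<psi> q \<in> M" if "q \<in> V \<inter> S" for q
  proof -
    have "q \<in> \<phi> ` (M \<inter> U)" unfolding img by (rule that)
    then show ?thesis using homeomorphism_apply1[OF hom] by auto
  qed
  define V' where "V' = V \<inter> \<psi> -` (U \<inter> W)"
  have V': "open V'" unfolding V'_def
    by (rule continuous_open_preimage[OF Ck_on_continuous[OF ck] opn(2) open_Int[OF opn(1) W(1)]])
  have ck': "Ck_on n V' \<psi>" using Ck_on_subset[OF opn(2) V' _ Ck_on_Suc_imp[OF ck]] by (auto simp: V'_def)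
  have d\<psi>: "(\<psi> has_derivative frechet_derivative \<psi> (at q)) (at q)" if "q \<in> V'" for q
    using Ck_on_derivative[OF opn(2) ck, of q] that by (auto simp: V'_def)
  define A where "A = {q\<in>V' \<inter> S. \<psi> q \<in> flat_points}"
  have "negligible ((\<lambda>q. k (\<psi> q)) ` A)"
  proof (rule negligible_critical_values[OF V' S(1), of "n - 1"])
    show "dim S \<le> Suc (n - 1)" using S n_Suc by simp
    show "Ck_on (Suc (n - 1)) V' (\<lambda>q. k (\<psi> q))"
      unfolding n_Suc[symmetric] by (rule Ck_on_compose[OF V' W(1) k(1) ck']) (auto simp: V'_def)
    show "A \<subseteq> V' \<inter> S" by (auto simp: A_def)
    fix q s assume q: "q \<in> A" and s: "s \<in> S"
    have q': "q \<in> V'" "q \<in> S" "\<psi> q \<in> W" "\<psi> q \<in> flat_points" "\<psi> q \<in> M" using q by (auto simp: A_def V'_def flat_points_def)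
    let ?v = "frechet_derivative \<psi> (at q) s"
    have "?v \<in> tangent_space M (\<psi> q)"
    proof -
      let ?c = "\<lambda>t::real. q + t *\<^sub>R s"
      have c: "(?c has_vector_derivative s) (at 0)" by (auto intro!: derivative_eq_intros)
      have "open (?c -` V)" by (intro open_vimage opn continuous_intros)
      then have "\<forall>\<^sub>F t in nhds 0. ?c t \<in> V"
        using eventually_nhds_in_open[of "?c -` V" 0] q' by (simp add: V'_def)
      then have "\<forall>\<^sub>F t in nhds 0. (\<psi> \<circ> ?c) t \<in> M"
        by eventually_elim (use q'(2) s S(1) \<psi>M in \<open>simp add: subspace_add subspace_scale\<close>)
      moreover have "((\<psi> \<circ> ?c) has_vector_derivative ?v) (at 0)"
        using has_derivative_tangent[of \<psi> "frechet_derivative \<psi> (at q)" q UNIV ?c s] d\<psi>[OF q'(1)] c by simp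
      ultimately show ?thesis unfolding tangent_space_def by (intro CollectI exI[of _ "\<psi> \<circ> ?c"]) simp
    qed
    then have "\<nu> (\<psi> q) \<bullet> ?v = 0" using tangent_space[OF q'(5)] by simp
    then have 0: "k' (\<psi> q) ?v = 0" by (rule crit[OF q'(4,3)])
    have "((\<lambda>q. k (\<psi> q)) has_derivative (\<lambda>h. k' (\<psi> q) (frechet_derivative \<psi> (at q) h))) (at q)"
      by (rule has_derivative_compose[OF d\<psi>[OF q'(1)] k(2)[OF q'(3)]])
    from frechet_derivative_at[OF this] have "frechet_derivative (\<lambda>q. k (\<psi> q)) (at q) = (\<lambda>h. k' (\<psi> q) (frechet_derivative \<psi> (at q) h))" ..
    then show "frechet_derivative (\<lambda>q. k (\<psi> q)) (at q) s = 0" using 0 by metis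
  qed
  moreover have "k ` (flat_points \<inter> (U \<inter> W)) \<subseteq> (\<lambda>q. k (\<psi> q)) ` A"
  proof clarify
    fix x assume x: "x \<in> flat_points" "x \<in> U" "x \<in> W"
    have "\<psi> (\<phi> x) = x" using homeomorphism_apply1[OF hom x(2)] .
    moreover have "\<phi> x \<in> \<phi> ` (M \<inter> U)" using x by (intro imageI) (simp add: flat_points_def)
    then have "\<phi> x \<in> V \<inter> S" unfolding img .
    ultimately have "\<phi> x \<in> A" "k x = k (\<psi> (\<phi> x))" using x by (auto simp: A_def V'_def)
    then show "k x \<in> (\<lambda>q. k (\<psi> q)) ` A" by blast
  qed
  ultimately have "negligible (k ` (flat_points \<inter> (U \<inter> W)))" by (rule negligible_subset)
  then show ?thesis using pU W opn by (intro exI[of _ "U \<inter> W"]) auto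
qed

lemma locally_negligible_image:
  fixes g :: "'a \<Rightarrow> real"
  assumes "\<And>p. p \<in> M \<Longrightarrow> \<exists>T. open T \<and> p \<in> T \<and> negligible (g ` (flat_points \<inter> T))"
  shows "negligible (g ` flat_points)"
proof -
  define \<T> where "\<T> = {T. open T \<and> negligible (g ` (flat_points \<inter> T))}"
  have op: "\<And>T. T \<in> \<T> \<Longrightarrow> open T" by (simp add: \<T>_def)
  obtain \<T>' where T: "\<T>' \<subseteq> \<T>" "countable \<T>'" "\<Union>\<T>' = \<Union>\<T>" by (rule Lindelof[OF op])
  have "negligible (\<Union>((\<lambda>T. g ` (flat_points \<inter> T)) ` \<T>'))"
    by (rule negligible_countable_Union) (use T in \<open>auto simp: \<T>_def\<close>)
  moreover have "flat_points \<subseteq> \<Union>\<T>'" unfolding T(3)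
  proof
    fix p assume "p \<in> flat_points"
    then have "p \<in> M" by (simp add: flat_points_def)
    from assms[OF this] obtain T where "open T \<and> p \<in> T \<and> negligible (g ` (flat_points \<inter> T))" by (elim exE)
    then show "p \<in> \<Union>\<T>" by (intro UnionI[of T]) (simp_all add: \<T>_def)
  qed
  then have "g ` flat_points \<subseteq> \<Union>((\<lambda>T. g ` (flat_points \<inter> T)) ` \<T>')" by blast
  ultimately show ?thesis by (rule negligible_subset)
qed

text \<open>A connected set of reals with two points contains a nondegenerate interval, which is not
  negligible.\<close>

lemma constant_on_connected_negligible_image:
  fixes g :: "'a \<Rightarrow> real"
  assumes "connected C" "continuous_on C g" "negligible (g ` C)" "x \<in> C" "y \<in> C"
  shows "g x = g y"
proof -
  have con: "connected (g ` C)" using assms(1,2) by (rule connected_continuous_image[rotated])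
  have False if "g a < g b" "a \<in> C" "b \<in> C" for a b
  proof -
    have "{g a..g b} \<subseteq> g ` C" using connected_contains_Icc[OF con] that by blast
    then have "negligible {g a..g b}" using assms(3) negligible_subset by blast
    then have "negligible (cbox (g a) (g b))" by simp
    then show False using that(1) unfolding negligible_interval by (simp add: box_real)
  qed
  from this[OF _ assms(4,5)] this[OF _ assms(5,4)] show ?thesis by (cases "g x" "g y" rule: linorder_cases) auto
qed

text \<open>An affine tangent plane is given by its normal \<nu> and its offset
  \<open>\<nu> x \<bullet> x\<close>. Both are critical along \<open>M\<close> at flat points: the
  derivative of the extended normal vanishes on tangent vectors there, and the remaining term
  \<open>N x \<bullet> v\<close> of the offset is zero because \<open>v\<close> is tangent.\<close>

lemma tangent_plane_constant:
  assumes C: "connected C" "C \<subseteq> flat_points" "x \<in> C" "y \<in> C"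
  shows "\<nu> x = \<nu> y" "\<nu> x \<bullet> x = \<nu> y \<bullet> y"
proof -
  have CM: "C \<subseteq> M" using C by (auto simp: flat_points_def)
  have c: "continuous_on C \<nu>" by (rule continuous_on_subset[OF normal_continuous CM])
  have neg: "negligible ((\<lambda>x. \<nu> x \<bullet> b) ` flat_points)" "negligible ((\<lambda>x. \<nu> x \<bullet> x) ` flat_points)" for b
  proof (rule_tac [!] locally_negligible_image)
    fix p assume p: "p \<in> M"
    obtain W N where W: "open W" "p \<in> W" "Ck_on n W N" "\<forall>x\<in>W. norm (N x) = 1" "\<forall>x\<in>M \<inter> W. N x = \<nu> x"
      by (rule unit_normal_extension[OF p])
    let ?N' = "\<lambda>x. frechet_derivative N (at x)"
    have dN: "(N has_derivative ?N' x) (at x)" if "x \<in> W" for x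
      using Ck_on_derivative[OF W(1) _ that, of "n - 1" N] W(3) n_Suc by metis
    have N0: "?N' x v = 0" if "x \<in> flat_points" "x \<in> W" "\<nu> x \<bullet> v = 0" for x v
    proof -
      have xM: "x \<in> M" using that by (simp add: flat_points_def)
      note s = shape_from_extension[OF xM W(1) that(2) W(3-5)]
      show ?thesis by (rule shape_flat_point[OF that(1) s(1) s(2) that(3)])
    qed
    have im: "f ` (flat_points \<inter> T) = g ` (flat_points \<inter> T)" if "\<And>x. x \<in> M \<inter> W \<Longrightarrow> f x = g x" "T \<subseteq> W" for f g :: "'a \<Rightarrow> real" and T
      using that by (intro image_cong) (auto simp: flat_points_def)
    have res: "\<exists>T. open T \<and> p \<in> T \<and> negligible (g ` (flat_points \<inter> T))"
      if k: "Ck_on n W k" "\<And>x. x \<in> W \<Longrightarrow> (k has_derivative k' x) (at x)"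
        "\<And>x v. x \<in> flat_points \<Longrightarrow> x \<in> W \<Longrightarrow> \<nu> x \<bullet> v = 0 \<Longrightarrow> k' x v = 0" and g: "\<And>x. x \<in> M \<inter> W \<Longrightarrow> k x = g x" for k k' and g :: "'a \<Rightarrow> real"
    proof -
      obtain T where T: "open T" "p \<in> T" "negligible (k ` (flat_points \<inter> T))"
        using negligible_image_flat_points_local[OF p W(1,2) k] by blast
      have "negligible (k ` (flat_points \<inter> (T \<inter> W)))" by (rule negligible_subset[OF T(3)]) blast
      then have "negligible (g ` (flat_points \<inter> (T \<inter> W)))" using im[of k g "T \<inter> W"] g by simp
      then show ?thesis using T W by (intro exI[of _ "T \<inter> W"]) auto
    qed
    show "\<exists>T. open T \<and> p \<in> T \<and> negligible ((\<lambda>x. \<nu> x \<bullet> b) ` (flat_points \<inter> T))"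
    proof (rule res)
      show "Ck_on n W (\<lambda>x. N x \<bullet> b)" by (intro Ck_on_inner Ck_on_const W)
      show "((\<lambda>x. N x \<bullet> b) has_derivative (\<lambda>h. ?N' x h \<bullet> b)) (at x)" if "x \<in> W" for x
        by (rule has_derivative_inner_left[OF dN[OF that]])
    qed (use N0 W in auto)
    show "\<exists>T. open T \<and> p \<in> T \<and> negligible ((\<lambda>x. \<nu> x \<bullet> x) ` (flat_points \<inter> T))"
    proof (rule res)
      show "Ck_on n W (\<lambda>x. N x \<bullet> x)" by (intro Ck_on_inner Ck_on_linear bounded_linear_ident W)
      show "((\<lambda>x. N x \<bullet> x) has_derivative (\<lambda>h. N x \<bullet> h + ?N' x h \<bullet> x)) (at x)" if "x \<in> W" for x
        by (rule has_derivative_inner[OF dN[OF that] has_derivative_ident])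
      show "N x \<bullet> v + ?N' x v \<bullet> x = 0" if "x \<in> flat_points" "x \<in> W" "\<nu> x \<bullet> v = 0" for x v
        using N0[OF that] that W(5) by (auto simp: flat_points_def)
    qed (use W in auto)
  qed
  have "\<nu> x \<bullet> b = \<nu> y \<bullet> b" for b
    by (rule constant_on_connected_negligible_image[OF C(1) _ negligible_subset[OF neg(1)[of b]] C(3,4)])
      (use C(2) c in \<open>auto intro!: continuous_intros\<close>)
  then show "\<nu> x = \<nu> y" by (metis inner_diff_left right_minus_eq inner_eq_zero_iff)
  show "\<nu> x \<bullet> x = \<nu> y \<bullet> y"
    by (rule constant_on_connected_negligible_image[OF C(1) _ negligible_subset[OF neg(2)] C(3,4)])
      (use C(2) c in \<open>auto intro!: continuous_intros\<close>)
qed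

end

section \<open>Second differences and maximum principles\<close>

text \<open>The symmetric second derivative along a line. First-order terms cancel, so its existence
  does not presuppose differentiability, and at a contact point it can be compared with that of a
  test function.\<close>

definition second_difference :: "('a::real_normed_vector \<Rightarrow> real) \<Rightarrow> 'a \<Rightarrow> 'a \<Rightarrow> real \<Rightarrow> bool" where
  "second_difference f x h c \<longleftrightarrow>
     ((\<lambda>t. (f (x + t *\<^sub>R h) + f (x - t *\<^sub>R h) - 2 * f x) / t\<^sup>2) \<longlongrightarrow> c) (at 0)"

text \<open>One application of l'Hopital leads to the symmetric difference quotient of
  \<open>g'\<close>, so \<open>g'\<close> has to be differentiable at 0 only.\<close>

lemma second_difference_1d:
  fixes g :: "real \<Rightarrow> real"
  assumes g: "\<forall>\<^sub>F t in nhds 0. (g has_real_derivative g' t) (at t)" and g': "(g' has_real_derivative c) (at 0)"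
  shows "((\<lambda>t. (g t + g (- t) - 2 * g 0) / t\<^sup>2) \<longlongrightarrow> c) (at 0)"
proof -
  obtain d where d: "d > 0" "\<And>t. \<bar>t\<bar> < d \<Longrightarrow> (g has_real_derivative g' t) (at t)"
    using g unfolding eventually_nhds_metric by (auto simp: dist_real_def)
  have ev: "\<forall>\<^sub>F t in at 0. \<bar>t\<bar> < d \<and> t \<noteq> 0"
    unfolding eventually_at using d(1) by (intro exI[of _ d]) (auto simp: dist_real_def)
  have dm: "((\<lambda>t. g (- t)) has_real_derivative - g' (- t)) (at t)" if "\<bar>t\<bar> < d" for t
    using DERIV_chain2[OF d(2)[of "- t"] DERIV_minus[OF DERIV_ident]] that by simp
  have der: "((\<lambda>t. g t + g (- t) - 2 * g 0) has_real_derivative g' t - g' (- t)) (at t)" if "\<bar>t\<bar> < d" for t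
    using DERIV_diff[OF DERIV_add[OF d(2)[OF that] dm[OF that]] DERIV_const[of "2 * g 0"]] by simp
  show ?thesis
  proof (rule lhopital[where f' = "\<lambda>t. g' t - g' (- t)" and g' = "\<lambda>t. 2 * t"])
    have "isCont (\<lambda>t. g t + g (- t) - 2 * g 0) 0" using DERIV_isCont[OF der[of 0]] d(1) by simp
    then show "((\<lambda>t. g t + g (- t) - 2 * g 0) \<longlongrightarrow> 0) (at 0)" unfolding isCont_def by simp
    have "((\<lambda>t::real. t\<^sup>2) \<longlongrightarrow> 0\<^sup>2) (at 0)" by (intro tendsto_intros)
    then show "((\<lambda>t::real. t\<^sup>2) \<longlongrightarrow> 0) (at 0)" by simp
    show "\<forall>\<^sub>F t in at (0::real). t\<^sup>2 \<noteq> 0" "\<forall>\<^sub>F t in at (0::real). 2 * t \<noteq> 0"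
      by (auto intro: eventually_mono[OF ev])
    show "\<forall>\<^sub>F t in at 0. ((\<lambda>t. g t + g (- t) - 2 * g 0) has_real_derivative g' t - g' (- t)) (at t)"
      using ev by eventually_elim (simp add: der)
    show "\<forall>\<^sub>F t::real in at 0. ((\<lambda>t. t\<^sup>2) has_real_derivative 2 * t) (at t)"
      by (intro always_eventually allI) (auto intro!: derivative_eq_intros)
    have c1: "((\<lambda>t. (g' t - g' 0) / t) \<longlongrightarrow> c) (at 0)"
      using g' unfolding has_field_derivative_iff by simp
    have um: "filterlim (\<lambda>t::real. - t) (at 0) (at 0)"
      unfolding filterlim_at
    proof
      show "\<forall>\<^sub>F t in at (0::real). - t \<in> UNIV \<and> - t \<noteq> 0" using ev by eventually_elim simp
      show "((\<lambda>t::real. - t) \<longlongrightarrow> 0) (at 0)" using tendsto_minus[OF tendsto_ident_at[of "0::real" UNIV]] by simp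
    qed
    have c2: "((\<lambda>t. (g' (- t) - g' 0) / (- t)) \<longlongrightarrow> c) (at 0)"
      by (rule filterlim_compose[OF c1 um])
    have "((\<lambda>t. ((g' t - g' 0) / t + (g' (- t) - g' 0) / (- t)) / 2) \<longlongrightarrow> (c + c) / 2) (at 0)"
      by (intro tendsto_divide tendsto_add c1 c2 tendsto_const) simp
    then have c3: "((\<lambda>t. ((g' t - g' 0) / t + (g' (- t) - g' 0) / (- t)) / 2) \<longlongrightarrow> c) (at 0)" by simp
    have "\<forall>\<^sub>F t in at 0. ((g' t - g' 0) / t + (g' (- t) - g' 0) / (- t)) / 2 = (g' t - g' (- t)) / (2 * t)"
      using ev
    proof eventually_elim
      case (elim t)
      have "(g' t - g' 0) / t + (g' (- t) - g' 0) / (- t) = ((g' t - g' 0) - (g' (- t) - g' 0)) / t"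
        by (simp only: divide_minus_right diff_divide_distrib)
      then show ?case by simp
    qed
    with c3 show "((\<lambda>t. (g' t - g' (- t)) / (2 * t)) \<longlongrightarrow> c) (at 0)"
      by (rule Lim_transform_eventually)
  qed
qed

lemma second_difference_line:
  assumes "\<forall>\<^sub>F t in nhds 0. ((\<lambda>t. f (x + t *\<^sub>R h)) has_real_derivative g' t) (at t)"
    and "(g' has_real_derivative c) (at 0)"
  shows "second_difference f x h c"
  using second_difference_1d[OF assms] by (simp add: second_difference_def)

lemma second_difference_gradient:
  fixes f :: "'a::euclidean_space \<Rightarrow> real"
  assumes U: "open U" "x \<in> U" and f: "\<And>y. y \<in> U \<Longrightarrow> (f has_derivative (\<lambda>v. P y \<bullet> v)) (at y)"
    and P: "(P has_derivative Q) (at x)"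
  shows "second_difference f x h (Q h \<bullet> h)"
proof (rule second_difference_line)
  have lin: "((\<lambda>t::real. x + t *\<^sub>R h) has_derivative (\<lambda>s. s *\<^sub>R h)) (at t)" for t
    by (auto intro!: derivative_eq_intros)
  have "open ((\<lambda>t::real. x + t *\<^sub>R h) -` U)" by (intro open_vimage U continuous_intros)
  then have "\<forall>\<^sub>F t in nhds 0. x + t *\<^sub>R h \<in> U"
    using eventually_nhds_in_open[of "(\<lambda>t::real. x + t *\<^sub>R h) -` U" 0] U(2) by simp
  then show "\<forall>\<^sub>F t in nhds 0. ((\<lambda>t. f (x + t *\<^sub>R h)) has_real_derivative P (x + t *\<^sub>R h) \<bullet> h) (at t)"
  proof eventually_elim
    case (elim t)
    have "((\<lambda>t. f (x + t *\<^sub>R h)) has_derivative (\<lambda>s. P (x + t *\<^sub>R h) \<bullet> (s *\<^sub>R h))) (at t)"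
      by (rule has_derivative_compose[OF lin f[OF elim]])
    moreover have "(\<lambda>s. P (x + t *\<^sub>R h) \<bullet> (s *\<^sub>R h)) = (*) (P (x + t *\<^sub>R h) \<bullet> h)" by (simp add: fun_eq_iff)
    ultimately show ?case unfolding has_field_derivative_def by simp
  qed
  have "((\<lambda>t. P (x + t *\<^sub>R h)) has_derivative (\<lambda>s. Q (s *\<^sub>R h))) (at 0)"
    using has_derivative_compose[OF lin[of 0]] P by simp
  from has_derivative_inner_left[OF this, of h]
  have "((\<lambda>t. P (x + t *\<^sub>R h) \<bullet> h) has_derivative (\<lambda>s. Q (s *\<^sub>R h) \<bullet> h)) (at 0)" .
  moreover have "(\<lambda>s. Q (s *\<^sub>R h) \<bullet> h) = (*) (Q h \<bullet> h)"
    using linear_scale[OF has_derivative_linear[OF P]] by (simp add: fun_eq_iff)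
  ultimately show "((\<lambda>t. P (x + t *\<^sub>R h) \<bullet> h) has_real_derivative Q h \<bullet> h) (at 0)"
    unfolding has_field_derivative_def by simp
qed

lemma second_difference_contact:
  assumes "second_difference f x h a" "second_difference \<phi> x h b"
    and ev: "\<forall>\<^sub>F t in nhds 0. f (x + t *\<^sub>R h) - \<phi> (x + t *\<^sub>R h) \<le> f x - \<phi> x"
  shows "a \<le> b"
proof (rule tendsto_le[OF _ assms(2,1)[unfolded second_difference_def]])
  obtain d where d: "d > 0" "\<And>t. \<bar>t\<bar> < d \<Longrightarrow> f (x + t *\<^sub>R h) - \<phi> (x + t *\<^sub>R h) \<le> f x - \<phi> x"
    using ev unfolding eventually_nhds_metric by (auto simp: dist_real_def)
  show "\<forall>\<^sub>F t in at 0. (f (x + t *\<^sub>R h) + f (x - t *\<^sub>R h) - 2 * f x) / t\<^sup>2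
      \<le> (\<phi> (x + t *\<^sub>R h) + \<phi> (x - t *\<^sub>R h) - 2 * \<phi> x) / t\<^sup>2"
    unfolding eventually_at
  proof (intro exI[of _ d] conjI ballI impI d(1))
    fix t :: real assume "t \<noteq> 0 \<and> dist t 0 < d"
    then have "f (x + t *\<^sub>R h) - \<phi> (x + t *\<^sub>R h) \<le> f x - \<phi> x" "f (x + (- t) *\<^sub>R h) - \<phi> (x + (- t) *\<^sub>R h) \<le> f x - \<phi> x"
      using d(2)[of t] d(2)[of "- t"] by (auto simp: dist_real_def)
    then have "f (x + t *\<^sub>R h) + f (x - t *\<^sub>R h) - 2 * f x \<le> \<phi> (x + t *\<^sub>R h) + \<phi> (x - t *\<^sub>R h) - 2 * \<phi> x"
      by (simp add: algebra_simps)
    then show "(f (x + t *\<^sub>R h) + f (x - t *\<^sub>R h) - 2 * f x) / t\<^sup>2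
      \<le> (\<phi> (x + t *\<^sub>R h) + \<phi> (x - t *\<^sub>R h) - 2 * \<phi> x) / t\<^sup>2"
      by (intro divide_right_mono) auto
  qed
qed auto

lemma norm_sq_line:
  "(norm (x + t *\<^sub>R h - c))\<^sup>2 = (norm (x - c))\<^sup>2 + 2 * t * ((x - c) \<bullet> h) + t\<^sup>2 * (h \<bullet> h)"
  for x h c :: "'a::real_inner"
  unfolding power2_norm_eq_inner by (simp add: inner_simps inner_commute algebra_simps power2_eq_square)

text \<open>The Hopf barrier on a ball of radius \<rho> about \<open>c\<close>: zero on the sphere
  and, for positive \<eta> and nonnegative \<open>L\<close>, negative inside. The square of
  \<open>s\<close> adds the strongly negative radial term
  \<open>- 8 * \<eta> * L * ((x - c) \<bullet> h)\<^sup>2\<close>.\<close>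

lemma second_difference_barrier:
  fixes x h c :: "'a::real_inner" and \<rho> L \<eta> :: real
  defines "s \<equiv> (\<lambda>y. \<rho>\<^sup>2 - (norm (y - c))\<^sup>2)"
  shows "second_difference (\<lambda>y. - \<eta> * (s y + L * (s y)\<^sup>2)) x h
    (2 * \<eta> * (1 + 2 * L * s x) * (norm h)\<^sup>2 - 8 * \<eta> * L * ((x - c) \<bullet> h)\<^sup>2)"
proof (rule second_difference_line)
  define a b where "a = (x - c) \<bullet> h" and "b = h \<bullet> h"
  define S where "S t = s x - 2 * t * a - t\<^sup>2 * b" for t
  have S: "s (x + t *\<^sub>R h) = S t" for t
    unfolding s_def S_def a_def b_def norm_sq_line by simp
  have dS: "(S has_real_derivative (- 2 * a - 2 * t * b)) (at t)" for t
    unfolding S_def by (auto intro!: derivative_eq_intros)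
  have "((\<lambda>t. - \<eta> * (S t + L * (S t)\<^sup>2)) has_real_derivative - \<eta> * ((- 2 * a - 2 * t * b) * (1 + 2 * L * S t))) (at t)" for t
    by (rule derivative_eq_intros dS refl | simp add: algebra_simps)+
  then show "\<forall>\<^sub>F t in nhds 0. ((\<lambda>t. - \<eta> * (s (x + t *\<^sub>R h) + L * (s (x + t *\<^sub>R h))\<^sup>2)) has_real_derivative
      - \<eta> * ((- 2 * a - 2 * t * b) * (1 + 2 * L * S t))) (at t)"
    unfolding S by (intro always_eventually allI)
  have "((\<lambda>t. - \<eta> * ((- 2 * a - 2 * t * b) * (1 + 2 * L * S t))) has_real_derivative
      - \<eta> * ((- 2 * b) * (1 + 2 * L * S 0) + (- 2 * a) * (2 * L * (- 2 * a)))) (at 0)"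
    by (rule derivative_eq_intros dS refl | simp add: algebra_simps)+
  moreover have "- \<eta> * ((- 2 * b) * (1 + 2 * L * S 0) + (- 2 * a) * (2 * L * (- 2 * a)))
      = 2 * \<eta> * (1 + 2 * L * s x) * (norm h)\<^sup>2 - 8 * \<eta> * L * ((x - c) \<bullet> h)\<^sup>2"
    by (simp add: S_def a_def b_def power2_norm_eq_inner) (simp add: algebra_simps power2_eq_square)
  ultimately show "((\<lambda>t. - \<eta> * ((- 2 * a - 2 * t * b) * (1 + 2 * L * S t))) has_real_derivative
      2 * \<eta> * (1 + 2 * L * s x) * (norm h)\<^sup>2 - 8 * \<eta> * L * ((x - c) \<bullet> h)\<^sup>2) (at 0)"
    by simp
qed

text \<open>Along a tangent of the sphere about \<open>c\<close> through \<open>x\<close> the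
  gradient contributes nothing, so for positive \<open>m\<close> and \<open>k\<close> the second
  difference is strictly negative at every nonzero \<open>h\<close>.\<close>

lemma second_difference_exp:
  fixes x h c :: "'a::real_inner"
  assumes "(x - c) \<bullet> h = 0"
  shows "second_difference (\<lambda>y. m * exp (- k * (norm (y - c))\<^sup>2)) x h (- 2 * k * m * exp (- k * (norm (x - c))\<^sup>2) * (norm h)\<^sup>2)"
proof (rule second_difference_line)
  define b N where "b = h \<bullet> h" and "N = (norm (x - c))\<^sup>2"
  have S: "(norm (x + t *\<^sub>R h - c))\<^sup>2 = N + t\<^sup>2 * b" for t
    unfolding norm_sq_line assms N_def b_def by simp
  have "((\<lambda>t. m * exp (- k * (N + t\<^sup>2 * b))) has_real_derivative m * (exp (- k * (N + t\<^sup>2 * b)) * (- k * (2 * t * b)))) (at t)" for t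
    by (rule derivative_eq_intros refl | simp)+
  then show "\<forall>\<^sub>F t in nhds 0. ((\<lambda>t. m * exp (- k * (norm (x + t *\<^sub>R h - c))\<^sup>2)) has_real_derivative
      m * (exp (- k * (N + t\<^sup>2 * b)) * (- k * (2 * t * b)))) (at t)"
    unfolding S by (intro always_eventually allI)
  show "((\<lambda>t. m * (exp (- k * (N + t\<^sup>2 * b)) * (- k * (2 * t * b)))) has_real_derivative
      - 2 * k * m * exp (- k * (norm (x - c))\<^sup>2) * (norm h)\<^sup>2) (at 0)"
    unfolding N_def[symmetric] power2_norm_eq_inner[of h] b_def[symmetric]
    by (rule derivative_eq_intros refl | simp)+
qed

lemma second_difference_touching_le:
  fixes f \<phi> :: "'a::euclidean_space \<Rightarrow> real"
  assumes "second_difference f x h a" "second_difference \<phi> x h b"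
    and W: "open W" "x \<in> W" and x: "x \<bullet> e = 0" "h \<bullet> e = 0"
    and le: "\<And>y. y \<in> W \<Longrightarrow> y \<bullet> e = 0 \<Longrightarrow> f y - \<phi> y \<le> f x - \<phi> x"
  shows "a \<le> b"
proof (rule second_difference_contact[OF assms(1,2)])
  have "open ((\<lambda>t::real. x + t *\<^sub>R h) -` W)" by (intro open_vimage W continuous_intros)
  then have "\<forall>\<^sub>F t in nhds 0. x + t *\<^sub>R h \<in> W"
    using eventually_nhds_in_open[of "(\<lambda>t::real. x + t *\<^sub>R h) -` W" 0] W(2) by simp
  then show "\<forall>\<^sub>F t in nhds 0. f (x + t *\<^sub>R h) - \<phi> (x + t *\<^sub>R h) \<le> f x - \<phi> x"
    by eventually_elim (use le x in \<open>simp add: inner_add_left\<close>)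
qed

text \<open>If \<open>f\<close> took positive values arbitrarily near \<open>p\<close>, the product
  of \<open>f\<close> with \<open>exp (k * \<theta>)\<close> would have a positive maximum inside a
  small disc for large \<open>k\<close>. There \<open>f\<close> is touched from above by a multiple
  of \<open>exp (- k * \<theta>)\<close>, whose second difference is negative in each direction
  orthogonal to \<open>x + p\<close>, against \<open>two\<close>.\<close>

lemma nonpositive_near_exposed_point:
  fixes f :: "'a::euclidean_space \<Rightarrow> real" and q :: "'a \<Rightarrow> 'a \<Rightarrow> real"
  assumes p: "p \<bullet> e = 0" and \<delta>: "\<delta> > 0"
    and cont: "continuous_on ({x. x \<bullet> e = 0} \<inter> ball p \<delta>) f"
    and sd: "\<And>x h. x \<bullet> e = 0 \<Longrightarrow> x \<in> ball p \<delta> \<Longrightarrow> h \<bullet> e = 0 \<Longrightarrow> second_difference f x h (q x h)"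
    and two: "\<And>x a. x \<bullet> e = 0 \<Longrightarrow> x \<in> ball p \<delta> \<Longrightarrow> \<exists>h. h \<noteq> 0 \<and> h \<bullet> a = 0 \<and> h \<bullet> e = 0 \<and> 0 \<le> q x h"
    and out: "\<And>x. x \<bullet> e = 0 \<Longrightarrow> x \<in> ball p \<delta> \<Longrightarrow> norm p \<le> norm x \<Longrightarrow> f x = 0"
  shows "\<exists>\<rho>>0. \<rho> \<le> \<delta> \<and> (\<forall>x\<in>ball p \<rho>. x \<bullet> e = 0 \<longrightarrow> f x \<le> 0)"
proof (rule ccontr)
  assume neg: "\<not> ?thesis"
  define HP where "HP = {x. x \<bullet> e = 0}"
  define \<theta> where "\<theta> x = (norm (x - - p))\<^sup>2" for x
  define D where "D = HP \<inter> cball p (\<delta> / 2)"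
  have "closed HP" unfolding HP_def using closed_hyperplane[of e 0] by (simp add: inner_commute)
  then have Dc: "compact D" unfolding D_def by (intro closed_Int_compact) auto
  have Dsub: "D \<subseteq> {x. x \<bullet> e = 0} \<inter> ball p \<delta>" using \<delta> by (auto simp: D_def HP_def)
  have cD: "continuous_on D f" by (rule continuous_on_subset[OF cont Dsub])
  have pD: "p \<in> D" using p \<delta> by (simp add: D_def HP_def)
  obtain G where G: "\<And>x. x \<in> D \<Longrightarrow> \<bar>f x\<bar> \<le> G"
  proof -
    have "bounded (f ` D)" using compact_continuous_image[OF cD Dc] by (rule compact_imp_bounded)
    then show thesis using that by (auto simp: bounded_iff)
  qed
  \<comment> \<open>The largest value that \<theta> can take on the rim of the disc where
    \<open>f\<close> is positive: the parallelogram law with \<open>norm x < norm p\<close> and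
    \<open>dist p x = \<delta> / 2\<close>. At \<open>p\<close> itself \<theta> is larger.\<close>
  define c0 where "c0 = 4 * (norm p)\<^sup>2 - (\<delta> / 2)\<^sup>2"
  have "continuous_on UNIV \<theta>" unfolding \<theta>_def by (intro continuous_intros)
  then have "open (\<theta> -` {c0<..})" by (intro open_vimage) auto
  moreover have "p \<in> \<theta> -` {c0<..}"
  proof -
    have "p - - p = 2 *\<^sub>R p" by (simp add: scaleR_2)
    then have "\<theta> p = 4 * (norm p)\<^sup>2" unfolding \<theta>_def by (simp add: power_mult_distrib)
    then show ?thesis using \<delta> by (simp add: c0_def)
  qed
  ultimately obtain r where r: "r > 0" "ball p r \<subseteq> \<theta> -` {c0<..}" by (meson openE)
  define r' where "r' = min r (\<delta> / 2)"
  have "r' > 0" "r' \<le> \<delta>" using r \<delta> by (auto simp: r'_def)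
  then obtain y where y: "y \<in> ball p r'" "y \<bullet> e = 0" "f y > 0" using neg by force
  have yD: "y \<in> D" using y by (auto simp: D_def HP_def r'_def)
  have \<theta>y: "\<theta> y > c0" using y(1) r(2) by (auto simp: r'_def)
  \<comment> \<open>With this \<open>k\<close> the inequality \<open>1 + u \<le> exp u\<close>
    already makes the value of \<open>F\<close> at \<open>y\<close> exceed its bound
    \<open>G * exp (k * c0)\<close> on the rim.\<close>
  define k where "k = (G / f y) / (\<theta> y - c0)"
  have Gy: "f y \<le> G" using G[OF yD] by simp
  have k: "k > 0" using y(3) Gy \<theta>y by (simp add: k_def)
  define F where "F x = f x * exp (k * \<theta> x)" for x
  have cF: "continuous_on D F" unfolding F_def \<theta>_def by (intro continuous_intros cD)
  obtain x where x: "x \<in> D" "\<And>z. z \<in> D \<Longrightarrow> F z \<le> F x"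
    using continuous_attains_sup[OF Dc _ cF] pD by blast
  have xHP: "x \<bullet> e = 0" "x \<in> ball p \<delta>" using x(1) Dsub by auto
  have Fy: "F y > 0" using y(3) by (simp add: F_def)
  have Fx: "F x > 0" using x(2)[OF yD] Fy by linarith
  then have fx: "f x > 0" by (simp add: F_def zero_less_mult_iff)
  have nx: "norm x < norm p" using out[OF xHP] fx by force
  have int: "x \<in> ball p (\<delta> / 2)"
  proof (rule ccontr)
    assume "x \<notin> ball p (\<delta> / 2)"
    then have d: "dist p x = \<delta> / 2" using x(1) by (simp add: D_def)
    have "\<theta> x + (dist p x)\<^sup>2 = 2 * (norm x)\<^sup>2 + 2 * (norm p)\<^sup>2"
      unfolding \<theta>_def dist_norm power2_norm_eq_inner by (simp add: inner_simps inner_commute)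
    moreover have "(norm x)\<^sup>2 \<le> (norm p)\<^sup>2" using nx by (intro power_mono) auto
    ultimately have "\<theta> x \<le> c0" unfolding d c0_def by linarith
    then have "k * \<theta> x \<le> k * c0" using k by simp
    then have "F x \<le> G * exp (k * c0)"
      unfolding F_def using G[OF x(1)] fx by (intro mult_mono) auto
    moreover have "G * exp (k * c0) < f y * exp (k * \<theta> y)"
    proof -
      have "G / f y < 1 + k * (\<theta> y - c0)" using \<theta>y by (simp add: k_def)
      also have "\<dots> \<le> exp (k * (\<theta> y - c0))" by (rule exp_ge_add_one_self)
      finally have "G < f y * exp (k * (\<theta> y - c0))" using y(3) by (simp add: field_simps)
      then have "G * exp (k * c0) < f y * exp (k * (\<theta> y - c0)) * exp (k * c0)" by simp
      then show ?thesis by (simp add: mult.assoc algebra_simps flip: exp_add)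
    qed
    ultimately show False using x(2)[OF yD] unfolding F_def by linarith
  qed
  \<comment> \<open>The prescribed vector is \<open>x + p\<close>, the normal at \<open>x\<close> of
    the sphere about \<open>- p\<close>.\<close>
  obtain h where h: "h \<noteq> 0" "h \<bullet> (x - - p) = 0" "h \<bullet> e = 0" "0 \<le> q x h" using two[OF xHP] by blast
  define \<phi> where "\<phi> z = F x * exp (- k * (norm (z - - p))\<^sup>2)" for z
  have "second_difference \<phi> x h (- 2 * k * F x * exp (- k * (norm (x - - p))\<^sup>2) * (norm h)\<^sup>2)"
    unfolding \<phi>_def by (rule second_difference_exp) (use h(2) in \<open>simp add: inner_commute\<close>)
  moreover have "f z - \<phi> z \<le> f x - \<phi> x" if "z \<in> ball p (\<delta> / 2)" "z \<bullet> e = 0" for z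
  proof -
    have "\<phi> x = f x" by (simp add: \<phi>_def F_def \<theta>_def flip: exp_add)
    moreover have "f z * exp (k * \<theta> z) \<le> F x" using x(2)[of z] that by (simp add: F_def D_def HP_def)
    then have "f z * exp (k * \<theta> z) * exp (- k * \<theta> z) \<le> F x * exp (- k * \<theta> z)" by (intro mult_right_mono) auto
    then have "f z \<le> \<phi> z" by (simp add: \<phi>_def \<theta>_def mult.assoc flip: exp_add)
    ultimately show ?thesis by simp
  qed
  ultimately have "q x h \<le> - 2 * k * F x * exp (- k * (norm (x - - p))\<^sup>2) * (norm h)\<^sup>2"
    using second_difference_touching_le[OF sd[OF xHP h(3)] _ open_ball int xHP(1) h(3)] by blast
  moreover have "2 * k * F x * exp (- k * (norm (x - - p))\<^sup>2) * (norm h)\<^sup>2 > 0" using k Fx h(1) by simp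
  ultimately show False using h(4) by (simp only: mult_minus_left)
qed

text \<open>Hopf's argument. A ball about \<open>y0\<close> on which \<open>f\<close> is negative
  touches a zero \<open>p'\<close> of \<open>f\<close>. The barrier forces \<open>f\<close> to leave
  zero at a linear rate on the inner side of \<open>p'\<close>, while \<open>f \<le> 0\<close> on
  the outer side, so the second difference at \<open>p'\<close> would be minus infinity. Since
  \<open>q\<close> is not assumed quadratic, ellipticity is expressed by \<open>tr\<close>, a test
  against forms with one strongly negative direction.\<close>

lemma strong_maximum_principle:
  fixes f :: "'a::euclidean_space \<Rightarrow> real" and q :: "'a \<Rightarrow> 'a \<Rightarrow> real" and N :: real
  assumes p: "p \<bullet> e = 0" "f p = 0" and \<delta>: "\<delta> > 0" and N: "N \<ge> 1"
    and cont: "continuous_on ({x. x \<bullet> e = 0} \<inter> ball p \<delta>) f"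
    and sd: "\<And>x h. x \<bullet> e = 0 \<Longrightarrow> x \<in> ball p \<delta> \<Longrightarrow> h \<bullet> e = 0 \<Longrightarrow> second_difference f x h (q x h)"
    and tr: "\<And>x \<alpha> \<beta> z. x \<bullet> e = 0 \<Longrightarrow> x \<in> ball p \<delta> \<Longrightarrow> 0 \<le> \<alpha> \<Longrightarrow> 0 \<le> \<beta> \<Longrightarrow> z \<bullet> e = 0 \<Longrightarrow>
        (\<And>h. h \<bullet> e = 0 \<Longrightarrow> q x h \<le> \<alpha> * (norm h)\<^sup>2 - \<beta> * (z \<bullet> h)\<^sup>2) \<Longrightarrow> \<beta> * (norm z)\<^sup>2 \<le> 2 * N * \<alpha>"
    and le: "\<And>x. x \<bullet> e = 0 \<Longrightarrow> x \<in> ball p \<delta> \<Longrightarrow> f x \<le> 0"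
    and y0: "y0 \<bullet> e = 0" "y0 \<in> ball p (\<delta> / 2)"
  shows "f y0 = 0"
proof (rule ccontr)
  assume "f y0 \<noteq> 0"
  define HP where "HP = {x. x \<bullet> e = 0}"
  have "closed HP" unfolding HP_def using closed_hyperplane[of e 0] by (simp add: inner_commute)
  \<comment> \<open>The ball of radius \<open>R\<close> about \<open>y0\<close> stays in
    \<open>ball p \<delta>\<close> because \<open>p\<close> and \<open>y0\<close> are less than
    \<open>\<delta> / 2\<close> apart.\<close>
  define R where "R = dist y0 p"
  have R: "R < \<delta> / 2" using y0(2) by (simp add: R_def dist_commute)
  have inb: "x \<in> ball p \<delta>" if "dist y0 x \<le> R" for x
    using dist_triangle[of p x y0] that R by (simp add: R_def dist_commute)
  define K where "K = HP \<inter> cball y0 R"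
  have Kc: "compact K" unfolding K_def using \<open>closed HP\<close> by (intro closed_Int_compact) auto
  have K: "x \<bullet> e = 0 \<and> x \<in> ball p \<delta>" if "x \<in> K" for x using that inb by (auto simp: K_def HP_def)
  have cK: "continuous_on K f" by (rule continuous_on_subset[OF cont]) (use K in auto)
  have "closed (K \<inter> f -` {0})"
    using continuous_closed_preimage[OF cK compact_imp_closed[OF Kc] closed_singleton] .
  then have Zc: "compact (K \<inter> f -` {0})"
    using Kc by (metis compact_Int_closed inf.left_idem)
  have pK: "p \<in> K \<inter> f -` {0}" using p by (simp add: K_def HP_def R_def)
  obtain p' where p': "p' \<in> K" "f p' = 0" "\<And>z. z \<in> K \<Longrightarrow> f z = 0 \<Longrightarrow> dist y0 p' \<le> dist y0 z"
  proof -
    assume *: "\<And>p'. p' \<in> K \<Longrightarrow> f p' = 0 \<Longrightarrow> (\<And>z. z \<in> K \<Longrightarrow> f z = 0 \<Longrightarrow> dist y0 p' \<le> dist y0 z) \<Longrightarrow> thesis"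
    have "K \<inter> f -` {0} \<noteq> {}" using pK by blast
    from distance_attains_inf[OF compact_imp_closed[OF Zc] this, of y0]
    obtain x where x: "x \<in> K \<inter> f -` {0}" "\<And>z. z \<in> K \<inter> f -` {0} \<Longrightarrow> dist y0 x \<le> dist y0 z" by blast
    show thesis by (rule *[of x]) (use x in auto)
  qed
  define \<rho> where "\<rho> = dist y0 p'"
  have \<rho>: "\<rho> > 0" "\<rho> \<le> R" using p' \<open>f y0 \<noteq> 0\<close> by (auto simp: \<rho>_def K_def)
  have neg: "f x < 0" if "x \<bullet> e = 0" "dist y0 x < \<rho>" for x
  proof -
    have "x \<in> K" using that \<rho> by (simp add: K_def HP_def)
    then have "f x \<noteq> 0" using p'(3) that by (force simp: \<rho>_def)
    then show ?thesis using le K[OF \<open>x \<in> K\<close>] by force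
  qed
  define s where "s x = \<rho>\<^sup>2 - (norm (x - y0))\<^sup>2" for x
  \<comment> \<open>\<sigma> and \<open>L\<close> are fitted to \<open>tr\<close>. With
    \<open>L = N / \<rho>\<^sup>2\<close>, contact with the barrier at relative depth \<tau> would
    give \<open>2 * (1 - \<tau>) \<le> 1 + 2 * N * \<tau>\<close>, that is
    \<open>\<tau> \<ge> 1 / (2 * N + 2)\<close>, so it is excluded in the shell of depth below
    \<sigma>.\<close>
  define \<sigma> where "\<sigma> = 1 / (2 * N + 2)"
  define L where "L = N / \<rho>\<^sup>2"
  have \<sigma>: "\<sigma> > 0" "\<sigma> \<le> 1 / 4" using N by (auto simp: \<sigma>_def field_simps)
  have L: "L > 0" using N \<rho> by (simp add: L_def)
  have cs: "continuous_on X s" for X unfolding s_def by (intro continuous_intros)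
  define I where "I = K \<inter> s -` {\<sigma> * \<rho>\<^sup>2}"
  define A where "A = K \<inter> s -` {0..\<sigma> * \<rho>\<^sup>2}"
  have Ic: "compact I" "compact A"
    unfolding I_def A_def
    by (intro compact_Int_closed Kc closed_vimage closed_atLeastAtMost closed_singleton cs)+
  have sdist: "s x = \<rho>\<^sup>2 - (dist y0 x)\<^sup>2" for x by (simp add: s_def dist_norm norm_minus_commute)
  \<comment> \<open>Here \<open>I\<close> is the inner boundary sphere of the shell, a compact set
    on which \<open>f\<close> is negative; the value 1 is a default for the case that it is
    empty.\<close>
  obtain m where m: "m > 0" "\<And>x. x \<in> I \<Longrightarrow> f x \<le> - m"
  proof (cases "I = {}")
    case True then show thesis using that[of 1] by auto
  next
    case False
    have "continuous_on I f" by (rule continuous_on_subset[OF cK]) (simp add: I_def)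
    from continuous_attains_sup[OF Ic(1) False this]
    obtain x where x: "x \<in> I" "\<And>z. z \<in> I \<Longrightarrow> f z \<le> f x" by blast
    have "0 < \<sigma> * \<rho>\<^sup>2" using \<sigma> \<rho> by simp
    then have "(dist y0 x)\<^sup>2 < \<rho>\<^sup>2" using x(1) by (simp add: I_def sdist)
    then have "dist y0 x < \<rho>" using \<rho> by (simp add: power2_less_imp_less)
    then have "f x < 0" using neg K x(1) by (simp add: I_def)
    then show thesis using that[of "- f x"] x(2) by simp
  qed
  \<comment> \<open>Scales the barrier to equal \<open>- m\<close> on the inner sphere.\<close>
  define \<eta> where "\<eta> = m / (\<sigma> * \<rho>\<^sup>2 + L * (\<sigma> * \<rho>\<^sup>2)\<^sup>2)"
  have pos: "\<sigma> * \<rho>\<^sup>2 + L * (\<sigma> * \<rho>\<^sup>2)\<^sup>2 > 0" using \<sigma> \<rho> L by (intro add_pos_pos mult_pos_pos zero_less_power) auto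
  have \<eta>: "\<eta> > 0" "\<eta> * (\<sigma> * \<rho>\<^sup>2 + L * (\<sigma> * \<rho>\<^sup>2)\<^sup>2) = m" using pos m(1) by (auto simp: \<eta>_def)
  define \<phi> where "\<phi> y = - \<eta> * (s y + L * (s y)\<^sup>2)" for y
  have c\<phi>: "continuous_on X \<phi>" for X unfolding \<phi>_def by (intro continuous_intros cs)
  have barrier: "f x \<le> \<phi> x" if xA: "x \<in> A" for x
  proof (rule ccontr)
    assume "\<not> f x \<le> \<phi> x"
    have "continuous_on A (\<lambda>x. f x - \<phi> x)"
      by (intro continuous_intros c\<phi> continuous_on_subset[OF cK]) (auto simp: A_def)
    from continuous_attains_sup[OF Ic(2) _ this]
    obtain y where y: "y \<in> A" "\<And>z. z \<in> A \<Longrightarrow> f z - \<phi> z \<le> f y - \<phi> y"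
      using xA by blast
    have yp: "f y - \<phi> y > 0" using y(2)[OF xA] \<open>\<not> f x \<le> \<phi> x\<close> by linarith
    have yK: "y \<bullet> e = 0" "y \<in> ball p \<delta>" "y \<in> K" using y(1) K by (auto simp: A_def)
    have sy: "0 \<le> s y" "s y \<le> \<sigma> * \<rho>\<^sup>2" using y(1) by (auto simp: A_def)
    have "s y \<noteq> 0" using yp le[OF yK(1,2)] by (auto simp: \<phi>_def)
    moreover have "s y \<noteq> \<sigma> * \<rho>\<^sup>2"
    proof
      assume eq: "s y = \<sigma> * \<rho>\<^sup>2"
      then have "f y \<le> - m" using m(2) yK by (simp add: I_def)
      then show False using yp \<eta>(2) unfolding \<phi>_def eq by simp
    qed
    ultimately have sy': "0 < s y" "s y < \<sigma> * \<rho>\<^sup>2" using sy by auto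
    define W where "W = s -` {0<..<\<sigma> * \<rho>\<^sup>2}"
    have W: "open W" "y \<in> W" unfolding W_def using sy' cs[of UNIV] by (auto intro!: open_vimage)
    have loc: "f z - \<phi> z \<le> f y - \<phi> y" if "z \<in> W" "z \<bullet> e = 0" for z
    proof (rule y(2))
      have sz: "0 < s z" "s z < \<sigma> * \<rho>\<^sup>2" using that by (auto simp: W_def)
      then have "(dist y0 z)\<^sup>2 < \<rho>\<^sup>2" by (simp add: sdist)
      then have "dist y0 z < \<rho>" using \<rho> by (simp add: power2_less_imp_less)
      then show "z \<in> A" using that \<rho> sz by (simp add: A_def K_def HP_def)
    qed
    have q: "q y h \<le> 2 * \<eta> * (1 + 2 * L * s y) * (norm h)\<^sup>2 - 8 * \<eta> * L * ((y - y0) \<bullet> h)\<^sup>2" if "h \<bullet> e = 0" for h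
      by (rule second_difference_touching_le[OF sd[OF yK(1,2) that] _ W yK(1) that loc])
        (use second_difference_barrier[of \<eta> \<rho> y0 L y h] in \<open>simp add: \<phi>_def[abs_def] s_def\<close>)
    \<comment> \<open>Premise \<open>tr\<close> with \<alpha> and \<beta> read off from the second
      difference of the barrier and \<open>z = y - y0\<close> the radial vector.\<close>
    have "8 * \<eta> * L * (norm (y - y0))\<^sup>2 \<le> 2 * N * (2 * \<eta> * (1 + 2 * L * s y))"
      by (rule tr[OF yK(1,2) _ _ _ q]) (use \<eta> L sy' yK y0 in \<open>auto simp: inner_diff_left\<close>)
    moreover have "(norm (y - y0))\<^sup>2 = \<rho>\<^sup>2 - s y" by (simp add: s_def)
    ultimately have "\<eta> * (8 * L * (\<rho>\<^sup>2 - s y)) \<le> \<eta> * (4 * N * (1 + 2 * L * s y))" by (simp add: algebra_simps)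
    then have le2: "2 * (L * (\<rho>\<^sup>2 - s y)) \<le> N * (1 + 2 * (L * s y))" using \<eta>(1) by (simp add: mult.assoc)
    define \<tau> where "\<tau> = s y / \<rho>\<^sup>2"
    have s\<tau>: "s y = \<tau> * \<rho>\<^sup>2" using \<rho> by (simp add: \<tau>_def)
    have e12: "L * (\<rho>\<^sup>2 - s y) = N * (1 - \<tau>)" "L * s y = N * \<tau>"
      using \<rho> unfolding s\<tau> L_def by (auto simp: field_simps)
    have "N * (2 * (1 - \<tau>)) \<le> N * (1 + 2 * (N * \<tau>))"
      using le2 unfolding e12 by (simp only: mult.left_commute)
    then have "2 * (1 - \<tau>) \<le> 1 + 2 * (N * \<tau>)" using N by (simp only: mult_le_cancel_left_pos)
    then have "1 \<le> (2 * N + 2) * \<tau>" by (simp add: algebra_simps)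
    moreover have "\<tau> < \<sigma>" using sy'(2) \<rho> by (simp add: s\<tau>)
    then have "(2 * N + 2) * \<tau> < (2 * N + 2) * \<sigma>" using N by simp
    moreover have "(2 * N + 2) * \<sigma> = 1" using N by (simp add: \<sigma>_def)
    ultimately show False by linarith
  qed
  define d where "d = p' - y0"
  have nd: "norm d = \<rho>" by (simp add: d_def \<rho>_def dist_norm norm_minus_commute)
  have p'e: "p' \<bullet> e = 0" "p' \<in> ball p \<delta>" using K[OF p'(1)] by auto
  have de: "d \<bullet> e = 0" using p'e y0 by (simp add: d_def inner_diff_left)
  have lim: "((\<lambda>t. (f (p' + t *\<^sub>R d) + f (p' - t *\<^sub>R d)) / t\<^sup>2) \<longlongrightarrow> q p' d) (at 0)"
    using sd[OF p'e de] p'(2) by (simp add: second_difference_def)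
  have "\<forall>\<^sub>F t in at 0. (f (p' + t *\<^sub>R d) + f (p' - t *\<^sub>R d)) / t\<^sup>2 > q p' d - 1"
    using order_tendstoD(1)[OF lim, of "q p' d - 1"] by simp
  then obtain t1 where t1: "t1 > 0" "\<And>t. t \<noteq> 0 \<Longrightarrow> \<bar>t\<bar> < t1 \<Longrightarrow> (f (p' + t *\<^sub>R d) + f (p' - t *\<^sub>R d)) / t\<^sup>2 > q p' d - 1"
    unfolding eventually_at by (auto simp: dist_real_def)
  obtain r where r: "r > 0" "ball p' r \<subseteq> ball p \<delta>" using p'e(2) open_ball open_contains_ball by metis
  \<comment> \<open>In order: \<open>t\<close> lies in the window given by the limit at
    \<open>p'\<close>, the outer point stays in the ball, the inner point stays in the shell, and
    the linear decrease dominates the quadratic term.\<close>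
  define t where "t = min (t1 / 2) (min (r / (2 * \<rho>)) (min (\<sigma> / 2) (\<eta> * \<rho>\<^sup>2 / (\<bar>q p' d - 1\<bar> + 1 + \<eta> * \<rho>\<^sup>2))))"
  have "\<eta> * \<rho>\<^sup>2 > 0" using \<eta> \<rho> by simp
  then have t: "t > 0" "t < t1" "t * \<rho> < r" "t \<le> \<sigma> / 2" "t * (\<bar>q p' d - 1\<bar> + 1 + \<eta> * \<rho>\<^sup>2) \<le> \<eta> * \<rho>\<^sup>2"
  proof -
    show "t > 0" using t1 r \<rho> \<sigma> \<open>\<eta> * \<rho>\<^sup>2 > 0\<close> by (simp add: t_def)
    show "t < t1" using t1 by (simp add: t_def)
    have "t \<le> r / (2 * \<rho>)" unfolding t_def by linarith
    then have "t * \<rho> \<le> r / 2" using \<rho> by (simp add: field_simps)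
    then show "t * \<rho> < r" using r by linarith
    show "t \<le> \<sigma> / 2" unfolding t_def by linarith
    have "t \<le> \<eta> * \<rho>\<^sup>2 / (\<bar>q p' d - 1\<bar> + 1 + \<eta> * \<rho>\<^sup>2)" unfolding t_def by linarith
    moreover have "\<bar>q p' d - 1\<bar> + 1 + \<eta> * \<rho>\<^sup>2 > 0" using \<open>\<eta> * \<rho>\<^sup>2 > 0\<close> by linarith
    ultimately show "t * (\<bar>q p' d - 1\<bar> + 1 + \<eta> * \<rho>\<^sup>2) \<le> \<eta> * \<rho>\<^sup>2" by (simp add: pos_le_divide_eq)
  qed
  have "p' + t *\<^sub>R d \<in> ball p' r" using t nd by (simp add: dist_norm)
  then have 1: "f (p' + t *\<^sub>R d) \<le> 0" using le r(2) p'e de by (auto simp: inner_add_left)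
  have "p' - t *\<^sub>R d - y0 = (1 - t) *\<^sub>R d" by (simp add: d_def algebra_simps)
  then have "s (p' - t *\<^sub>R d) = \<rho>\<^sup>2 - ((1 - t) * \<rho>)\<^sup>2" unfolding s_def by (simp add: nd power_mult_distrib)
  then have st: "s (p' - t *\<^sub>R d) = \<rho>\<^sup>2 * (2 * t - t\<^sup>2)" by (simp add: power2_eq_square algebra_simps)
  have tt: "t\<^sup>2 \<le> t" using t(1,4) \<sigma> by (simp add: power2_eq_square)
  have st2: "0 \<le> s (p' - t *\<^sub>R d)" "s (p' - t *\<^sub>R d) \<le> \<sigma> * \<rho>\<^sup>2"
  proof -
    show "0 \<le> s (p' - t *\<^sub>R d)" unfolding st using tt t(1) by (intro mult_nonneg_nonneg) auto
    have "2 * t - t\<^sup>2 \<le> \<sigma>" using t(4) zero_le_power2[of t] by linarith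
    then show "s (p' - t *\<^sub>R d) \<le> \<sigma> * \<rho>\<^sup>2" unfolding st using mult_left_mono[of "2 * t - t\<^sup>2" \<sigma> "\<rho>\<^sup>2"] by (simp add: mult.commute[of \<sigma>])
  qed
  have "(dist y0 (p' - t *\<^sub>R d))\<^sup>2 \<le> \<rho>\<^sup>2" using st2(1) by (simp add: sdist)
  then have "dist y0 (p' - t *\<^sub>R d) \<le> \<rho>" by (rule power2_le_imp_le) (use \<rho> in simp)
  then have "p' - t *\<^sub>R d \<in> A" using st2 \<rho> p'e de by (simp add: A_def K_def HP_def inner_diff_left)
  from barrier[OF this] have "f (p' - t *\<^sub>R d) \<le> - (\<eta> * (s (p' - t *\<^sub>R d) + L * (s (p' - t *\<^sub>R d))\<^sup>2))"
    by (simp add: \<phi>_def)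
  moreover have "\<eta> * s (p' - t *\<^sub>R d) \<le> \<eta> * (s (p' - t *\<^sub>R d) + L * (s (p' - t *\<^sub>R d))\<^sup>2)"
    using \<eta>(1) L by (intro mult_left_mono) auto
  ultimately have "f (p' - t *\<^sub>R d) \<le> - \<eta> * s (p' - t *\<^sub>R d)" by simp
  then have "f (p' + t *\<^sub>R d) + f (p' - t *\<^sub>R d) \<le> - \<eta> * (\<rho>\<^sup>2 * (2 * t - t\<^sup>2))" using 1 unfolding st by linarith
  moreover have "q p' d - 1 < (f (p' + t *\<^sub>R d) + f (p' - t *\<^sub>R d)) / t\<^sup>2" using t1(2)[of t] t by simp
  then have "(q p' d - 1) * t\<^sup>2 < f (p' + t *\<^sub>R d) + f (p' - t *\<^sub>R d)" using t(1) by (simp add: pos_less_divide_eq)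
  ultimately have "(q p' d - 1) * t\<^sup>2 < - \<eta> * (\<rho>\<^sup>2 * (2 * t - t\<^sup>2))" by linarith
  then have "t * ((q p' d - 1) * t + (\<eta> * \<rho>\<^sup>2) * (2 - t)) < 0" by (simp add: algebra_simps power2_eq_square)
  then have "(q p' d - 1) * t + (\<eta> * \<rho>\<^sup>2) * (2 - t) < 0" using t(1) by (simp add: mult_less_0_iff)
  moreover have "- (t * \<bar>q p' d - 1\<bar>) \<le> (q p' d - 1) * t"
  proof -
    have "- \<bar>q p' d - 1\<bar> \<le> q p' d - 1" by linarith
    then have "t * (- \<bar>q p' d - 1\<bar>) \<le> t * (q p' d - 1)" using t(1) by (intro mult_left_mono) auto
    then show ?thesis by (simp add: mult.commute)
  qed
  moreover have "t * \<bar>q p' d - 1\<bar> + t + t * (\<eta> * \<rho>\<^sup>2) \<le> \<eta> * \<rho>\<^sup>2" using t(5) by (simp add: distrib_left)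
  moreover have "(\<eta> * \<rho>\<^sup>2) * (2 - t) = 2 * (\<eta> * \<rho>\<^sup>2) - t * (\<eta> * \<rho>\<^sup>2)" by (simp only: mult.commute[of "\<eta> * \<rho>\<^sup>2" "2 - t"] left_diff_distrib)
  ultimately show False using t(1) \<open>\<eta> * \<rho>\<^sup>2 > 0\<close> by linarith
qed

section \<open>Curvature inequalities\<close>

lemma orthonormal_basis_of_card:
  assumes "orthonormal_basis_of V E"
  shows "card E = dim V"
proof -
  have "0 \<notin> E" using assms by (auto simp: orthonormal_basis_of_def)
  then have "independent E" using assms pairwise_orthogonal_independent
    by (auto simp: orthonormal_basis_of_def)
  then show ?thesis using assms dim_span_eq_card_independent
    by (metis orthonormal_basis_of_def)
qed

lemma orthonormal_basis_of_exists:
  assumes "subspace V"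
  obtains E where "orthonormal_basis_of V E"
proof -
  obtain E where "pairwise orthogonal E" "\<And>x. x \<in> E \<Longrightarrow> norm x = 1" "span E = V"
    using orthonormal_basis_subspace[OF assms] by metis
  then show thesis using that unfolding orthonormal_basis_of_def by blast
qed

lemma orthonormal_basis_of_subset:
  assumes "orthonormal_basis_of V E" shows "E \<subseteq> V"
  using assms span_superset by (auto simp: orthonormal_basis_of_def)

lemma orthonormal_basis_of_insert:
  fixes w :: "'a::euclidean_space"
  assumes T: "subspace T" "w \<in> T" "norm w = 1" and E: "orthonormal_basis_of (T \<inter> {v. w \<bullet> v = 0}) E"
  shows "orthonormal_basis_of T (insert w E)" "w \<notin> E"
proof -
  have ET: "E \<subseteq> T \<inter> {v. w \<bullet> v = 0}" by (rule orthonormal_basis_of_subset[OF E])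
  show "w \<notin> E" using ET T(3) by (auto simp: norm_eq_1)
  have "x \<in> span (insert w E)" if "x \<in> T" for x
  proof -
    have "x - (w \<bullet> x) *\<^sub>R w \<in> T \<inter> {v. w \<bullet> v = 0}"
      using that T by (simp add: inner_diff_right norm_eq_1 subspace_diff subspace_scale)
    then have "x - (w \<bullet> x) *\<^sub>R w \<in> span E" using E by (simp add: orthonormal_basis_of_def)
    then show ?thesis unfolding span_insert by blast
  qed
  moreover have "span (insert w E) \<subseteq> T"
    using ET T by (intro span_minimal) auto
  ultimately have "span (insert w E) = T" by blast
  then show "orthonormal_basis_of T (insert w E)"
    using E ET T unfolding orthonormal_basis_of_def pairwise_insert orthogonal_def
    by (auto simp: inner_commute)
qed

lemma orthonormal_basis_of_parseval:
  assumes E: "orthonormal_basis_of V E" and x: "x \<in> V"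
  shows "(\<Sum>e\<in>E. (x \<bullet> e)\<^sup>2) = (norm x)\<^sup>2"
proof -
  have "x \<bullet> x = x \<bullet> (\<Sum>e\<in>E. (x \<bullet> e) *\<^sub>R e)"
    using orthonormal_basis_of_expand[OF E x] by simp
  then show ?thesis unfolding power2_norm_eq_inner by (simp add: inner_sum_right power2_eq_square)
qed

text \<open>Cauchy-Schwarz over pairs of basis vectors: the coefficients
  \<open>(w \<bullet> e) * (w \<bullet> f)\<close> form a unit vector by Parseval.\<close>

lemma quadratic_form_le_norm:
  fixes D :: "'a::euclidean_space \<Rightarrow> 'a"
  assumes E: "orthonormal_basis_of V E" and D: "linear D" and w: "w \<in> V" "norm w = 1"
  shows "(D w \<bullet> w)\<^sup>2 \<le> (\<Sum>e\<in>E. \<Sum>f\<in>E. (D e \<bullet> f)\<^sup>2)"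
proof -
  have fin: "finite E" by (rule orthonormal_basis_of_finite[OF E])
  let ?w = "\<Sum>e\<in>E. (w \<bullet> e) *\<^sub>R e"
  have "D w \<bullet> w = D ?w \<bullet> ?w" using orthonormal_basis_of_expand[OF E w(1)] by simp
  also have "\<dots> = (\<Sum>f\<in>E. \<Sum>e\<in>E. (w \<bullet> f) * ((w \<bullet> e) * (D e \<bullet> f)))"
    by (simp add: linear_sum[OF D] linear_scale[OF D] inner_sum_left inner_sum_right sum_distrib_left)
  also have "\<dots> = (\<Sum>e\<in>E. \<Sum>f\<in>E. ((w \<bullet> e) * (w \<bullet> f)) * (D e \<bullet> f))"
    by (subst sum.swap) (simp only: mult.assoc mult.left_commute)
  also have "\<dots> = (\<Sum>p\<in>E \<times> E. ((w \<bullet> fst p) * (w \<bullet> snd p)) * (D (fst p) \<bullet> snd p))"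
    by (simp add: sum.cartesian_product case_prod_beta)
  finally have eq: "D w \<bullet> w = (\<Sum>p\<in>E \<times> E. ((w \<bullet> fst p) * (w \<bullet> snd p)) * (D (fst p) \<bullet> snd p))" .
  have "(D w \<bullet> w)\<^sup>2 \<le> (\<Sum>p\<in>E \<times> E. ((w \<bullet> fst p) * (w \<bullet> snd p))\<^sup>2) * (\<Sum>p\<in>E \<times> E. (D (fst p) \<bullet> snd p)\<^sup>2)"
    unfolding eq by (rule Cauchy_Schwarz_ineq_sum)
  also have "(\<Sum>p\<in>E \<times> E. ((w \<bullet> fst p) * (w \<bullet> snd p))\<^sup>2) = (\<Sum>e\<in>E. (w \<bullet> e)\<^sup>2) * (\<Sum>f\<in>E. (w \<bullet> f)\<^sup>2)"
    by (simp add: sum_product sum.cartesian_product case_prod_beta power_mult_distrib)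
  also have "\<dots> = 1" using orthonormal_basis_of_parseval[OF E w(1)] w(2) by simp
  finally show ?thesis by (simp add: sum.cartesian_product case_prod_beta)
qed

text \<open>If \<open>\<nu> \<bullet> e\<close> is nonzero, this is the vector orthogonal to \<nu>
  that differs from \<open>h\<close> by a multiple of \<open>e\<close>: the tangent vector of a
  graph above the base direction \<open>h\<close>.\<close>

definition tangent_lift :: "'a::real_inner \<Rightarrow> 'a \<Rightarrow> 'a \<Rightarrow> 'a" where
  "tangent_lift e \<nu> h = h - ((\<nu> \<bullet> h) / (\<nu> \<bullet> e)) *\<^sub>R e"

lemma tangent_lift_proj:
  assumes "\<nu> \<bullet> e \<noteq> 0" "\<nu> \<bullet> v = 0" "norm e = 1"
  shows "tangent_lift e \<nu> (v - (v \<bullet> e) *\<^sub>R e) = v"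
  using assms by (simp add: tangent_lift_def inner_diff_right)

text \<open>For a unit tangent vector \<open>w\<close>, the value of the second fundamental form at
  \<open>w\<close> is at most \<open>|A|\<close>, hence at most \<open>H\<close>. The trace over the
  orthogonal complement of \<open>w\<close> is therefore nonnegative, and some basis vector of it
  has a nonnegative value. Two tangent dimensions make this complement nonzero.\<close>

lemma curvature_two_directions:
  fixes D :: "'a::euclidean_space \<Rightarrow> 'a"
  assumes \<nu>: "norm \<nu> = 1" "norm e = 1" "\<nu> \<bullet> e > 0" and D: "linear D"
    and E: "orthonormal_basis_of {v. \<nu> \<bullet> v = 0} E" "card E \<ge> 2"
    and H: "(\<Sum>v\<in>E. D v \<bullet> v) \<le> 0" "(\<Sum>v\<in>E. \<Sum>w\<in>E. (D v \<bullet> w)\<^sup>2) \<le> (\<Sum>v\<in>E. D v \<bullet> v)\<^sup>2"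
  shows "\<exists>h. h \<noteq> 0 \<and> h \<bullet> a = 0 \<and> h \<bullet> e = 0 \<and> 0 \<le> - (D (tangent_lift e \<nu> h) \<bullet> tangent_lift e \<nu> h) / (\<nu> \<bullet> e)"
proof -
  let ?T = "{v. \<nu> \<bullet> v = 0}"
  have T: "subspace ?T" by (rule subspace_hyperplane)
  define b where "b = a - (a \<bullet> e) *\<^sub>R e"
  \<comment> \<open>The projection of \<open>a\<close> to the base and from there to the tangent
    space. A tangent vector orthogonal to \<open>c\<close> has a base projection orthogonal to
    \<open>a\<close>, so \<open>w\<close> is taken along \<open>c\<close>, or arbitrarily if
    \<open>c\<close> vanishes.\<close>
  define c where "c = b - (b \<bullet> \<nu>) *\<^sub>R \<nu>"
  have cT: "c \<in> ?T" using \<nu>(1) by (simp add: c_def inner_diff_right norm_eq_1 inner_commute)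
  obtain w where w: "w \<in> ?T" "norm w = 1" "\<And>v. v \<in> ?T \<Longrightarrow> w \<bullet> v = 0 \<Longrightarrow> c \<bullet> v = 0"
  proof (cases "c = 0")
    case True
    have "E \<noteq> {}" using E(2) by auto
    then obtain w where "w \<in> E" by blast
    then show thesis using that[of w] True E orthonormal_basis_of_subset[OF E(1)]
      by (auto simp: orthonormal_basis_of_def)
  next
    case False
    show thesis
      by (rule that[of "c /\<^sub>R norm c"]) (use False cT in auto)
  qed
  obtain F where F: "orthonormal_basis_of (?T \<inter> {v. w \<bullet> v = 0}) F"
    using orthonormal_basis_of_exists[OF subspace_inter[OF T subspace_hyperplane]] by blast
  have F2: "orthonormal_basis_of ?T (insert w F)" "w \<notin> F"
    using orthonormal_basis_of_insert[OF T w(1,2) F] by auto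
  have finF: "finite F" by (rule orthonormal_basis_of_finite[OF F])
  have "card (insert w F) = card E"
    using orthonormal_basis_of_card[OF F2(1)] orthonormal_basis_of_card[OF E(1)] by simp
  then have "F \<noteq> {}" using E(2) by auto
  have "(D w \<bullet> w)\<^sup>2 \<le> (\<Sum>v\<in>E. D v \<bullet> v)\<^sup>2"
    using quadratic_form_le_norm[OF E(1) D w(1,2)] H(2) by linarith
  then have "\<bar>D w \<bullet> w\<bar> \<le> \<bar>\<Sum>v\<in>E. D v \<bullet> v\<bar>" using abs_le_square_iff by blast
  moreover have "(\<Sum>v\<in>E. D v \<bullet> v) = D w \<bullet> w + (\<Sum>v\<in>F. D v \<bullet> v)"
    using trace_orthonormal_basis_of[OF E(1) F2(1) D] finF F2(2) by simp
  ultimately have "(\<Sum>v\<in>F. D v \<bullet> v) \<le> 0" using H(1) by linarith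
  then obtain v where v: "v \<in> F" "D v \<bullet> v \<le> 0"
    using sum_pos[OF finF \<open>F \<noteq> {}\<close>, of "\<lambda>v. D v \<bullet> v"] by force
  have vT: "\<nu> \<bullet> v = 0" "w \<bullet> v = 0" using orthonormal_basis_of_subset[OF F] v(1) by auto
  have vn: "norm v = 1" using F v(1) by (auto simp: orthonormal_basis_of_def)
  define h where "h = v - (v \<bullet> e) *\<^sub>R e"
  have lift: "tangent_lift e \<nu> h = v" unfolding h_def using \<nu> vT by (intro tangent_lift_proj) auto
  have "h \<noteq> 0" using lift vn by (auto simp: tangent_lift_def)
  moreover have "h \<bullet> e = 0" using \<nu>(2) by (simp add: h_def inner_diff_left norm_eq_1)
  moreover have "h \<bullet> a = 0"
  proof -
    have "c \<bullet> v = 0" using w(3) vT by simp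
    then have "b \<bullet> v = 0" using vT by (simp add: c_def inner_diff_left)
    then show ?thesis by (simp add: b_def h_def inner_diff_left inner_diff_right inner_commute)
  qed
  ultimately show ?thesis using lift v(2) \<nu>(3)
    by (intro exI[of _ h]) (simp add: divide_nonpos_pos)
qed

text \<open>Summing \<open>q\<close> over a tangent orthonormal basis turns nonnegative mean
  curvature into a bound for the tangential part of \<open>z\<close>. The base projections have norm
  at most 1 and the same product with \<open>z\<close>. Tilt at most 45 degrees makes that part
  carry at least half of \<open>(norm z)\<^sup>2\<close>, whence the factor 2.\<close>

lemma curvature_trace_bound:
  fixes D :: "'a::euclidean_space \<Rightarrow> 'a" and \<alpha> \<beta> :: real
  assumes \<nu>: "norm \<nu> = 1" "norm e = 1" "\<nu> \<bullet> e > 0" "(\<nu> \<bullet> e)\<^sup>2 \<ge> 1 / 2" and D: "linear D"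
    and E: "orthonormal_basis_of {v. \<nu> \<bullet> v = 0} E"
    and H: "(\<Sum>v\<in>E. D v \<bullet> v) \<le> 0" and \<alpha>: "0 \<le> \<alpha>" "0 \<le> \<beta>" "z \<bullet> e = 0"
    and q: "\<And>h. h \<bullet> e = 0 \<Longrightarrow> - (D (tangent_lift e \<nu> h) \<bullet> tangent_lift e \<nu> h) / (\<nu> \<bullet> e) \<le> \<alpha> * (norm h)\<^sup>2 - \<beta> * (z \<bullet> h)\<^sup>2"
  shows "\<beta> * (norm z)\<^sup>2 \<le> 2 * real (card E) * \<alpha>"
proof -
  let ?k = "\<nu> \<bullet> e"
  have ET: "E \<subseteq> {v. \<nu> \<bullet> v = 0}" by (rule orthonormal_basis_of_subset[OF E])
  have 1: "- (D v \<bullet> v) / ?k \<le> \<alpha> - \<beta> * (z \<bullet> v)\<^sup>2" if v: "v \<in> E" for v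
  proof -
    define h where "h = v - (v \<bullet> e) *\<^sub>R e"
    have vT: "\<nu> \<bullet> v = 0" using ET v by auto
    have vn: "norm v = 1" using E v by (auto simp: orthonormal_basis_of_def)
    have lift: "tangent_lift e \<nu> h = v" unfolding h_def using \<nu> vT by (intro tangent_lift_proj) auto
    have he: "h \<bullet> e = 0" using \<nu>(2) by (simp add: h_def inner_diff_left norm_eq_1)
    have zh: "z \<bullet> h = z \<bullet> v" using \<alpha>(3) by (simp add: h_def inner_diff_right)
    have "(norm h)\<^sup>2 = h \<bullet> v" using he by (simp add: power2_norm_eq_inner h_def inner_diff_left inner_diff_right)
    also have "\<dots> = 1 - (v \<bullet> e)\<^sup>2" using vn by (simp add: h_def inner_diff_left inner_diff_right norm_eq_1 power2_eq_square inner_commute)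
    finally have "(norm h)\<^sup>2 \<le> 1" by simp
    then have "\<alpha> * (norm h)\<^sup>2 \<le> \<alpha>" using \<alpha>(1) by (simp add: mult_left_le)
    then show ?thesis using q[OF he] unfolding lift zh by linarith
  qed
  have "0 \<le> - (\<Sum>v\<in>E. D v \<bullet> v) / ?k" using H \<nu>(3) by (intro divide_nonneg_pos) auto
  also have "\<dots> = (\<Sum>v\<in>E. - (D v \<bullet> v) / ?k)" by (simp add: sum_negf sum_divide_distrib)
  also have "\<dots> \<le> (\<Sum>v\<in>E. \<alpha> - \<beta> * (z \<bullet> v)\<^sup>2)" by (intro sum_mono 1)
  also have "\<dots> = card E * \<alpha> - \<beta> * (\<Sum>v\<in>E. (z \<bullet> v)\<^sup>2)" by (simp add: sum_subtractf sum_distrib_left)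
  finally have 2: "\<beta> * (\<Sum>v\<in>E. (z \<bullet> v)\<^sup>2) \<le> card E * \<alpha>" by simp
  have "{v. \<nu> \<bullet> v = 0} = UNIV \<inter> {v. \<nu> \<bullet> v = 0}" by simp
  then have E2: "orthonormal_basis_of UNIV (insert \<nu> E)" "\<nu> \<notin> E"
    using orthonormal_basis_of_insert[OF subspace_UNIV UNIV_I \<nu>(1), of E] E by auto
  have "(norm z)\<^sup>2 = (z \<bullet> \<nu>)\<^sup>2 + (\<Sum>v\<in>E. (z \<bullet> v)\<^sup>2)"
    using orthonormal_basis_of_parseval[OF E2(1) UNIV_I, of z] E2(2) orthonormal_basis_of_finite[OF E] by simp
  \<comment> \<open>As \<open>z\<close> is orthogonal to \<open>e\<close>, only the component of
    \<nu> orthogonal to \<open>e\<close> counts, and its square is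
    \<open>1 - (\<nu> \<bullet> e)\<^sup>2\<close>.\<close>
  moreover have "(z \<bullet> \<nu>)\<^sup>2 \<le> (norm z)\<^sup>2 / 2"
  proof -
    define \<mu> where "\<mu> = \<nu> - ?k *\<^sub>R e"
    have "z \<bullet> \<nu> = z \<bullet> \<mu>" using \<alpha>(3) by (simp add: \<mu>_def inner_diff_right)
    then have "(z \<bullet> \<nu>)\<^sup>2 \<le> (norm z)\<^sup>2 * (norm \<mu>)\<^sup>2"
      using Cauchy_Schwarz_ineq[of z \<mu>] by (simp add: power2_norm_eq_inner)
    also have "(norm \<mu>)\<^sup>2 = 1 - ?k\<^sup>2"
      using \<nu>(1,2) unfolding power2_norm_eq_inner \<mu>_def
      by (simp add: inner_diff_left inner_diff_right norm_eq_1 power2_eq_square inner_commute)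
    also have "(norm z)\<^sup>2 * (1 - ?k\<^sup>2) \<le> (norm z)\<^sup>2 * (1 / 2)" using \<nu>(4) by (intro mult_left_mono) auto
    finally show ?thesis by simp
  qed
  ultimately have "(norm z)\<^sup>2 \<le> 2 * (\<Sum>v\<in>E. (z \<bullet> v)\<^sup>2)" by linarith
  then have "\<beta> * (norm z)\<^sup>2 \<le> \<beta> * (2 * (\<Sum>v\<in>E. (z \<bullet> v)\<^sup>2))" using \<alpha>(2) by (rule mult_left_mono)
  then show ?thesis using 2 by simp
qed

section \<open>Graphs over a hyperplane\<close>

definition eproj :: "'a::real_inner \<Rightarrow> 'a \<Rightarrow> 'a" where
  "eproj e x = x - (x \<bullet> e) *\<^sub>R e"

lemma eproj_linear: "linear (eproj e)"
  by (intro linearI) (simp_all add: eproj_def inner_add_left scaleR_add_left scaleR_diff_right)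

lemma eproj_continuous: "continuous_on X (eproj e)"
  unfolding eproj_def by (intro continuous_intros)

lemma eproj_diff: "eproj e (x - y) = eproj e x - eproj e y"
  by (simp add: eproj_def inner_diff_left scaleR_diff_left)

lemma eproj_add: "eproj e (x + y) = eproj e x + eproj e y"
  by (simp add: eproj_def inner_add_left scaleR_add_left)

lemma eproj_uminus [simp]: "eproj (- e) = eproj e"
  by (simp add: eproj_def fun_eq_iff)

context
  fixes e :: "'a::euclidean_space" assumes e: "norm e = 1"
begin

lemma eproj_inner: "eproj e x \<bullet> e = 0"
  using e by (simp add: eproj_def inner_diff_left norm_eq_1)

lemma eproj_id: "x \<bullet> e = 0 \<Longrightarrow> eproj e x = x"
  by (simp add: eproj_def)

lemma eproj_shift: "eproj e (x + t *\<^sub>R e) = eproj e x"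
  using e by (simp add: eproj_def inner_add_left norm_eq_1 scaleR_add_left)

lemma norm_eproj_le: "norm (eproj e x) \<le> norm x"
proof -
  have "(norm (eproj e x))\<^sup>2 = (norm x)\<^sup>2 - (x \<bullet> e)\<^sup>2"
    using e unfolding power2_norm_eq_inner eproj_def
    by (simp add: inner_diff_left inner_diff_right norm_eq_1 power2_eq_square inner_commute)
  then have "(norm (eproj e x))\<^sup>2 \<le> (norm x)\<^sup>2" by simp
  then show ?thesis by (rule power2_le_imp_le) simp
qed

lemma eproj_eqD: "eproj e x = eproj e y \<Longrightarrow> x = y + (x \<bullet> e - y \<bullet> e) *\<^sub>R e"
proof -
  assume "eproj e x = eproj e y"
  then have "x = y - (y \<bullet> e) *\<^sub>R e + (x \<bullet> e) *\<^sub>R e" unfolding eproj_def by (metis diff_add_cancel)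
  then show ?thesis by (simp only: scaleR_diff_left diff_add_eq add_diff_eq)
qed

end

section \<open>Local behaviour of the hypersurface along a transverse direction\<close>

context oriented_hypersurface
begin

lemma normal_gradient:
  assumes p: "p \<in> M"
  obtains W F G where "open W" "p \<in> W" "continuous_on W G"
    "\<forall>x\<in>W. (F has_derivative (\<lambda>h. G x \<bullet> h)) (at x)" "\<forall>x\<in>W. x \<in> M \<longleftrightarrow> F x = (0::real)"
    "\<forall>x\<in>M \<inter> W. G x = norm (G x) *\<^sub>R \<nu> x \<and> norm (G x) > 0"
proof -
  obtain W F G where W: "open W" "p \<in> W" and G: "Ck_on n W G"
    and dF: "\<forall>x\<in>W. (F has_derivative (\<lambda>h. G x \<bullet> h)) (at x)" and G0: "\<forall>x\<in>W. G x \<noteq> 0"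
    and FM: "\<forall>x\<in>W. x \<in> M \<longleftrightarrow> F x = (0::real)" and \<nu>: "\<forall>x\<in>M \<inter> W. \<nu> x = G x /\<^sub>R norm (G x)"
    by (rule local_normal_form[OF p])
  show thesis
  proof (rule that[OF W Ck_on_continuous[OF G] dF FM], intro ballI conjI)
    fix x assume x: "x \<in> M \<inter> W"
    then show "norm (G x) > 0" using G0 by simp
    moreover have "\<nu> x = G x /\<^sub>R norm (G x)" using \<nu> x by (rule bspec)
    ultimately show "G x = norm (G x) *\<^sub>R \<nu> x" by (metis norm_eq_zero order_less_irrefl right_inverse scaleR_one scaleR_scaleR zero_less_norm_iff)
  qed
qed

text \<open>Near \<open>p\<close> the defining function is strictly increasing along
  \<open>e\<close>, so by the mean value theorem a vertical segment cannot have two zeros.\<close>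

lemma vertical_difference:
  assumes p: "p \<in> M" and e: "\<nu> p \<bullet> e > 0"
  shows "\<exists>T. open T \<and> p \<in> T \<and> (\<forall>x\<in>M \<inter> T. \<forall>t. x + t *\<^sub>R e \<in> M \<inter> T \<longrightarrow> t = 0)"
proof -
  obtain W F G where W: "open W" "p \<in> W" "continuous_on W G"
    and dF: "\<forall>x\<in>W. (F has_derivative (\<lambda>h. G x \<bullet> h)) (at x)" and FM: "\<forall>x\<in>W. x \<in> M \<longleftrightarrow> F x = (0::real)"
    and \<nu>: "\<forall>x\<in>M \<inter> W. G x = norm (G x) *\<^sub>R \<nu> x \<and> norm (G x) > 0"
    by (rule normal_gradient[OF p])
  have Gp: "G p = norm (G p) *\<^sub>R \<nu> p" "norm (G p) > 0" using \<nu> p W(2) by blast+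
  have "G p \<bullet> e = norm (G p) * (\<nu> p \<bullet> e)" by (subst Gp(1)) simp
  then have pos: "G p \<bullet> e > 0" using e Gp(2) by simp
  have "continuous_on W (\<lambda>x. G x \<bullet> e)" by (intro continuous_intros W(3))
  from continuous_open_preimage[OF this W(1) open_greaterThan]
  have "open (W \<inter> (\<lambda>x. G x \<bullet> e) -` {0<..})" .
  moreover have "p \<in> W \<inter> (\<lambda>x. G x \<bullet> e) -` {0<..}" using pos W(2) by simp
  ultimately obtain r where r: "r > 0" "ball p r \<subseteq> W \<inter> (\<lambda>x. G x \<bullet> e) -` {0<..}" by (rule openE)
  have "t = 0" if x: "x \<in> M" "x \<in> ball p r" and y: "x + t *\<^sub>R e \<in> M" "x + t *\<^sub>R e \<in> ball p r" for x t
  proof (rule ccontr)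
    assume t: "t \<noteq> 0"
    have seg: "x + s *\<^sub>R (t *\<^sub>R e) \<in> ball p r" if "s \<in> {0..1}" for s
    proof -
      have "x + s *\<^sub>R (t *\<^sub>R e) = (1 - s) *\<^sub>R x + s *\<^sub>R (x + t *\<^sub>R e)" by (simp add: algebra_simps)
      then show ?thesis using convexD[OF convex_ball x(2) y(2), of "1 - s" s] that by simp
    qed
    have der: "((\<lambda>s. F (x + s *\<^sub>R (t *\<^sub>R e))) has_real_derivative G (x + s *\<^sub>R (t *\<^sub>R e)) \<bullet> (t *\<^sub>R e)) (at s)" if "0 \<le> s" "s \<le> 1" for s
    proof -
      have "x + s *\<^sub>R (t *\<^sub>R e) \<in> W" using seg[of s] that r(2) by auto
      then have "(F has_derivative (\<lambda>h. G (x + s *\<^sub>R (t *\<^sub>R e)) \<bullet> h)) (at (x + s *\<^sub>R (t *\<^sub>R e)))" using dF by blast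
      moreover have "((\<lambda>s. x + s *\<^sub>R (t *\<^sub>R e)) has_derivative (\<lambda>h. h *\<^sub>R (t *\<^sub>R e))) (at s)"
        by (auto intro!: derivative_eq_intros)
      ultimately have "((\<lambda>s. F (x + s *\<^sub>R (t *\<^sub>R e))) has_derivative (\<lambda>h. G (x + s *\<^sub>R (t *\<^sub>R e)) \<bullet> (h *\<^sub>R (t *\<^sub>R e)))) (at s)"
        by (rule has_derivative_compose[rotated])
      then show ?thesis unfolding has_field_derivative_def by (rule has_derivative_eq_rhs) (simp add: fun_eq_iff)
    qed
    have "\<exists>s>0. s < 1 \<and> F (x + 1 *\<^sub>R (t *\<^sub>R e)) - F (x + 0 *\<^sub>R (t *\<^sub>R e)) = (1 - 0) * (G (x + s *\<^sub>R (t *\<^sub>R e)) \<bullet> (t *\<^sub>R e))"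
      by (rule MVT2[where f = "\<lambda>s. F (x + s *\<^sub>R (t *\<^sub>R e))"]) (simp, rule der)
    then obtain s where s: "0 < s" "s < 1" "F (x + 1 *\<^sub>R (t *\<^sub>R e)) - F (x + 0 *\<^sub>R (t *\<^sub>R e)) = (1 - 0) * (G (x + s *\<^sub>R (t *\<^sub>R e)) \<bullet> (t *\<^sub>R e))"
      by blast
    have "x \<in> W" "x + t *\<^sub>R e \<in> W" using r(2) x(2) y(2) by auto
    then have "F x = 0" "F (x + t *\<^sub>R e) = 0" using FM x(1) y(1) by auto
    then have "G (x + s *\<^sub>R (t *\<^sub>R e)) \<bullet> e = 0" using s(3) t by simp
    moreover have "G (x + s *\<^sub>R (t *\<^sub>R e)) \<bullet> e > 0" using seg[of s] s r(2) by auto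
    ultimately show False by simp
  qed
  then show ?thesis using r(1) by (intro exI[of _ "ball p r"]) auto
qed

text \<open>Existence half of the implicit function theorem, by intermediate values:
  \<open>F\<close> has opposite signs at \<open>p + t *\<^sub>R e\<close> and
  \<open>p - t *\<^sub>R e\<close>, and these signs persist on neighbouring vertical
  segments.\<close>

lemma vertical_lift:
  assumes p: "p \<in> M" and e: "norm e = 1" "\<nu> p \<bullet> e > 0" and T: "open T" "p \<in> T"
  shows "\<exists>r>0. \<forall>y. norm (eproj e y - eproj e p) < r \<longrightarrow> (\<exists>m\<in>M \<inter> T. eproj e m = eproj e y)"
proof -
  obtain W F G where W: "open W" "p \<in> W" "continuous_on W G"
    and dF: "\<forall>x\<in>W. (F has_derivative (\<lambda>h. G x \<bullet> h)) (at x)" and FM: "\<forall>x\<in>W. x \<in> M \<longleftrightarrow> F x = (0::real)"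
    and \<nu>: "\<forall>x\<in>M \<inter> W. G x = norm (G x) *\<^sub>R \<nu> x \<and> norm (G x) > 0"
    by (rule normal_gradient[OF p])
  have Gp: "G p = norm (G p) *\<^sub>R \<nu> p" "norm (G p) > 0" using \<nu> p W(2) by blast+
  have "G p \<bullet> e = norm (G p) * (\<nu> p \<bullet> e)" by (subst Gp(1)) simp
  then have pos: "G p \<bullet> e > 0" using e Gp(2) by simp
  have Fp: "F p = 0" using FM p W(2) by blast
  obtain \<rho> where \<rho>: "\<rho> > 0" "ball p \<rho> \<subseteq> W \<inter> T" using W(1,2) T openE[of "W \<inter> T" p] by blast
  have Fc: "isCont F x" if "x \<in> W" for x using dF that has_derivative_continuous by blast
  have "((\<lambda>s. p + s *\<^sub>R e) has_derivative (\<lambda>h. h *\<^sub>R e)) (at 0)" by (auto intro!: derivative_eq_intros)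
  moreover have "(F has_derivative (\<lambda>h. G p \<bullet> h)) (at (p + 0 *\<^sub>R e))" using dF W(2) by simp
  ultimately have "((\<lambda>s. F (p + s *\<^sub>R e)) has_derivative (\<lambda>h. G p \<bullet> (h *\<^sub>R e))) (at 0)" by (rule has_derivative_compose)
  then have der: "((\<lambda>s. F (p + s *\<^sub>R e)) has_real_derivative G p \<bullet> e) (at 0)"
    unfolding has_field_derivative_def by (rule has_derivative_eq_rhs) (simp add: fun_eq_iff)
  obtain d1 where d1: "d1 > 0" "\<And>h. 0 < h \<Longrightarrow> h < d1 \<Longrightarrow> F (p + 0 *\<^sub>R e) < F (p + (0 + h) *\<^sub>R e)"
    using DERIV_pos_inc_right[OF der pos] by blast
  obtain d2 where d2: "d2 > 0" "\<And>h. 0 < h \<Longrightarrow> h < d2 \<Longrightarrow> F (p + (0 - h) *\<^sub>R e) < F (p + 0 *\<^sub>R e)"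
    using DERIV_pos_inc_left[OF der pos] by blast
  define t where "t = min (\<rho> / 2) (min d1 d2) / 2"
  have t: "0 < t" "t < \<rho> / 2" "t < d1" "t < d2" using \<rho>(1) d1(1) d2(1) by (auto simp: t_def)
  have sgn: "F (p + t *\<^sub>R e) > 0" "F (p + (- t) *\<^sub>R e) < 0" using d1(2)[OF t(1,3)] d2(2)[OF t(1,4)] Fp by auto
  have inW: "p + s *\<^sub>R e + w \<in> W \<inter> T" if "\<bar>s\<bar> \<le> t" "norm w < \<rho> / 2" for s w
  proof -
    have "norm (s *\<^sub>R e + w) \<le> \<bar>s\<bar> + norm w" using norm_triangle_ineq[of "s *\<^sub>R e" w] e by simp
    also have "\<dots> < \<rho>" using that t by linarith
    finally have "dist (p + s *\<^sub>R e + w) p < \<rho>" by (simp add: dist_norm add.assoc)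
    then have "dist p (p + s *\<^sub>R e + w) < \<rho>" by (simp only: dist_commute)
    then show ?thesis using \<rho>(2) by auto
  qed
  have c1: "isCont F (p + t *\<^sub>R e)" "isCont F (p + (- t) *\<^sub>R e)"
    using Fc inW[of t 0] inW[of "- t" 0] t \<rho> by auto
  obtain r1 where r1: "r1 > 0" "\<And>y. dist y (p + t *\<^sub>R e) < r1 \<Longrightarrow> F y > 0"
  proof -
    have "\<forall>\<^sub>F y in nhds (p + t *\<^sub>R e). F y > 0"
      using c1(1) sgn(1) unfolding isCont_def tendsto_at_iff_tendsto_nhds by (rule order_tendstoD(1))
    then show thesis using that unfolding eventually_nhds_metric by blast
  qed
  obtain r2 where r2: "r2 > 0" "\<And>y. dist y (p + (- t) *\<^sub>R e) < r2 \<Longrightarrow> F y < 0"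
  proof -
    have "\<forall>\<^sub>F y in nhds (p + (- t) *\<^sub>R e). F y < 0"
      using c1(2) sgn(2) unfolding isCont_def tendsto_at_iff_tendsto_nhds by (rule order_tendstoD(2))
    then show thesis using that unfolding eventually_nhds_metric by blast
  qed
  define r where "r = min (\<rho> / 2) (min r1 r2)"
  show ?thesis
  proof (intro exI[of _ r] conjI allI impI)
    show "r > 0" using \<rho> r1 r2 by (simp add: r_def)
    fix y assume "norm (eproj e y - eproj e p) < r"
    moreover define w where "w = eproj e y - eproj e p"
    ultimately have w: "norm w < \<rho> / 2" "norm w < r1" "norm w < r2" by (auto simp: r_def)
    have we: "w \<bullet> e = 0" using e by (simp add: w_def inner_diff_left eproj_inner)
    define \<phi> where "\<phi> s = F (p + s *\<^sub>R e + w)" for s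
    have "dist (p + (- t) *\<^sub>R e + w) (p + (- t) *\<^sub>R e) = norm w" "dist (p + t *\<^sub>R e + w) (p + t *\<^sub>R e) = norm w"
      by (simp_all add: dist_norm)
    then have "\<phi> (- t) < 0" "0 < \<phi> t" unfolding \<phi>_def by (metis r2(2) w(3), metis r1(2) w(2))
    then have "\<phi> (- t) \<le> 0" "0 \<le> \<phi> t" by simp_all
    moreover have "continuous_on {- t..t} \<phi>"
    proof -
      have "continuous_on W F" using Fc continuous_at_imp_continuous_on by blast
      moreover have "(\<lambda>s. p + s *\<^sub>R e + w) ` {- t..t} \<subseteq> W" using inW[OF _ w(1)] by auto
      ultimately show ?thesis unfolding \<phi>_def
        by (rule continuous_on_compose2[OF _ continuous_on_add[OF continuous_on_add[OF continuous_on_const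
              continuous_on_scaleR[OF continuous_on_id continuous_on_const]] continuous_on_const]])
    qed
    ultimately obtain s where s: "- t \<le> s" "s \<le> t" "\<phi> s = 0"
      using IVT'[of \<phi> "- t" 0 t] t(1) by force
    have m: "p + s *\<^sub>R e + w \<in> W \<inter> T" using inW[OF _ w(1), of s] s by auto
    then have "p + s *\<^sub>R e + w \<in> M" using FM s(3) by (auto simp: \<phi>_def)
    moreover have "eproj e (p + s *\<^sub>R e + w) = eproj e y"
    proof -
      have "eproj e (p + s *\<^sub>R e + w) = eproj e p + w"
        using eproj_shift[OF e(1), of p s] eproj_id[OF e(1) we] by (simp only: eproj_add)
      then show ?thesis by (simp add: w_def)
    qed
    ultimately show "\<exists>m\<in>M \<inter> T. eproj e m = eproj e y" using m by blast
  qed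
qed

text \<open>Both \<open>m\<close> and \<open>p\<close> are zeros of the defining function, so its
  first-order remainder at \<open>p\<close> is the linear term itself; dividing by the length of the
  gradient gives the estimate.\<close>

lemma tangent_first_order:
  assumes p: "p \<in> M" and \<epsilon>: "\<epsilon> > 0"
  shows "\<exists>\<delta>>0. \<forall>m\<in>M. norm (m - p) < \<delta> \<longrightarrow> \<bar>\<nu> p \<bullet> (m - p)\<bar> \<le> \<epsilon> * norm (m - p)"
proof -
  obtain W F G where W: "open W" "p \<in> W" "continuous_on W G"
    and dF: "\<forall>x\<in>W. (F has_derivative (\<lambda>h. G x \<bullet> h)) (at x)" and FM: "\<forall>x\<in>W. x \<in> M \<longleftrightarrow> F x = (0::real)"
    and \<nu>: "\<forall>x\<in>M \<inter> W. G x = norm (G x) *\<^sub>R \<nu> x \<and> norm (G x) > 0"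
    by (rule normal_gradient[OF p])
  have G: "G p = norm (G p) *\<^sub>R \<nu> p" "norm (G p) > 0" using \<nu> p W(2) by blast+
  have Fp: "F p = 0" using FM p W(2) by blast
  have "(F has_derivative (\<lambda>h. G p \<bullet> h)) (at p)" using dF W(2) by blast
  moreover have "\<epsilon> * norm (G p) > 0" using \<epsilon> G(2) by simp
  ultimately obtain d where d: "d > 0" "\<And>m. norm (m - p) < d \<Longrightarrow> norm (F m - F p - G p \<bullet> (m - p)) \<le> \<epsilon> * norm (G p) * norm (m - p)"
    unfolding has_derivative_at_alt by blast
  obtain \<rho> where \<rho>: "\<rho> > 0" "ball p \<rho> \<subseteq> W" using W(1,2) openE by blast
  show ?thesis
  proof (intro exI[of _ "min d \<rho>"] conjI ballI impI)
    show "min d \<rho> > 0" using d \<rho> by simp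
    fix m assume m: "m \<in> M" "norm (m - p) < min d \<rho>"
    then have "m \<in> W" using \<rho>(2) by (auto simp: dist_norm norm_minus_commute)
    then have "F m = 0" using FM m(1) by blast
    then have "\<bar>G p \<bullet> (m - p)\<bar> \<le> \<epsilon> * norm (G p) * norm (m - p)" using d(2)[of m] m(2) Fp by simp
    moreover have "G p \<bullet> (m - p) = norm (G p) * (\<nu> p \<bullet> (m - p))" by (subst G(1)) simp
    ultimately have "norm (G p) * \<bar>\<nu> p \<bullet> (m - p)\<bar> \<le> norm (G p) * (\<epsilon> * norm (m - p))"
      by (simp add: abs_mult mult.commute mult.left_commute)
    then show "\<bar>\<nu> p \<bullet> (m - p)\<bar> \<le> \<epsilon> * norm (m - p)" using G(2) by simp
  qed
qed

end

text \<open>Both notions are invariant under translation along \<open>e\<close>. Sets over the hyperplane \<open>e\<close>-perp are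
  represented throughout by such cylinders, so that interior, frontier and components can be taken
  in the full space.\<close>

definition graph_lift :: "'a::real_inner set \<Rightarrow> 'a \<Rightarrow> 'a \<Rightarrow> 'a" where
  "graph_lift G e y = (THE m. m \<in> G \<and> eproj e m = eproj e y)"

definition graph_domain :: "'a::real_inner set \<Rightarrow> 'a \<Rightarrow> 'a set" where
  "graph_domain G e = {y. \<exists>m\<in>G. eproj e m = eproj e y}"

text \<open>The bound in \<open>steep\<close> is the one demanded by the trace estimate; it also
  keeps the slopes of the graph bounded.\<close>

locale graph_patch = nonneg_scalar_hypersurface +
  fixes e :: 'a and T :: "'a set"
  assumes e: "norm e = 1" and T: "open T" and inj: "inj_on (eproj e) (M \<inter> T)"
    and pos: "\<And>x. x \<in> M \<inter> T \<Longrightarrow> \<nu> x \<bullet> e > 0" and steep: "\<And>x. x \<in> M \<inter> T \<Longrightarrow> (\<nu> x \<bullet> e)\<^sup>2 \<ge> 1 / 2"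
begin

abbreviation "\<sigma> \<equiv> graph_lift (M \<inter> T) e"
abbreviation "U \<equiv> graph_domain (M \<inter> T) e"

lemma lift_eq: "m \<in> M \<inter> T \<Longrightarrow> eproj e m = eproj e y \<Longrightarrow> \<sigma> y = m"
  unfolding graph_lift_def using inj by (intro the_equality) (auto simp: inj_on_def)

lemma lift: "y \<in> U \<Longrightarrow> \<sigma> y \<in> M \<inter> T" "y \<in> U \<Longrightarrow> eproj e (\<sigma> y) = eproj e y"
  using lift_eq unfolding graph_domain_def by blast+

lemma lift_self: "m \<in> M \<inter> T \<Longrightarrow> \<sigma> m = m" by (rule lift_eq) auto

lemma patch_subset: "M \<inter> T \<subseteq> U" unfolding graph_domain_def by blast

lemma domain_cong: "eproj e y = eproj e y' \<Longrightarrow> y \<in> U \<longleftrightarrow> y' \<in> U"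
  unfolding graph_domain_def by simp

lemma lift_cong: "eproj e y = eproj e y' \<Longrightarrow> \<sigma> y = \<sigma> y'"
  unfolding graph_lift_def by simp

text \<open>Openness of the domain and continuity of the lift in one statement; both follow from
  \<open>vertical_lift\<close> and uniqueness of the lift.\<close>

lemma lift_nhd:
  assumes y: "y \<in> U" and T': "open T'" "\<sigma> y \<in> T'"
  shows "\<exists>r>0. \<forall>z. dist z y < r \<longrightarrow> z \<in> U \<and> \<sigma> z \<in> T'"
proof -
  have m: "\<sigma> y \<in> M" "\<sigma> y \<in> T" using lift[OF y] by auto
  obtain r where r: "r > 0" "\<And>z. norm (eproj e z - eproj e (\<sigma> y)) < r \<Longrightarrow> \<exists>m\<in>M \<inter> (T \<inter> T'). eproj e m = eproj e z"
    using vertical_lift[OF m(1) e pos[OF lift(1)[OF y]] open_Int[OF T T'(1)]] m T'(2) by blast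
  have "z \<in> U \<and> \<sigma> z \<in> T'" if "dist z y < r" for z
  proof -
    have "norm (eproj e z - eproj e (\<sigma> y)) < r"
      using that norm_eproj_le[OF e, of "z - y"] by (simp add: lift(2)[OF y] eproj_diff dist_norm)
    then obtain m where m: "m \<in> M \<inter> (T \<inter> T')" "eproj e m = eproj e z" using r(2) by blast
    then have "\<sigma> z = m" by (intro lift_eq) auto
    then show ?thesis using m unfolding graph_domain_def by auto
  qed
  then show ?thesis using r(1) by blast
qed

lemma open_domain: "open U"
  unfolding open_dist using lift_nhd[OF _ T] lift(1) by blast

lemma continuous_lift: "continuous_on U \<sigma>"
  unfolding continuous_on_eq_continuous_at[OF open_domain]
proof
  fix y assume y: "y \<in> U"
  show "isCont \<sigma> y"
    unfolding continuous_at_eps_delta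
  proof (intro allI impI)
    fix \<epsilon> :: real assume "\<epsilon> > 0"
    then have "\<exists>r>0. \<forall>z. dist z y < r \<longrightarrow> z \<in> U \<and> \<sigma> z \<in> ball (\<sigma> y) \<epsilon>" by (intro lift_nhd y) auto
    then show "\<exists>d>0. \<forall>x'. dist x' y < d \<longrightarrow> dist (\<sigma> x') (\<sigma> y) < \<epsilon>" by (auto simp: dist_commute)
  qed
qed

definition height :: "'a \<Rightarrow> real" where "height y = \<sigma> y \<bullet> e"
text \<open>The gradient of the height. Over the domain it is orthogonal to \<open>e\<close>, and it
  equals minus the part of the normal orthogonal to \<open>e\<close> divided by its component along
  \<open>e\<close>.\<close>

definition slope :: "'a \<Rightarrow> 'a" where "slope y = e - inverse (\<nu> (\<sigma> y) \<bullet> e) *\<^sub>R \<nu> (\<sigma> y)"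

lemma lift_height: "y \<in> U \<Longrightarrow> \<sigma> y = eproj e y + height y *\<^sub>R e"
  using lift(2)[of y] by (simp add: eproj_def height_def algebra_simps)

lemma slope_inner:
  assumes "y \<in> U" shows "slope y \<bullet> h = - (\<nu> (\<sigma> y) \<bullet> eproj e h) / (\<nu> (\<sigma> y) \<bullet> e)"
proof -
  define k where "k = \<nu> (\<sigma> y) \<bullet> e"
  have "k \<noteq> 0" using pos[OF lift(1)[OF assms]] by (simp add: k_def)
  then have eq: "(\<nu> (\<sigma> y) \<bullet> h - (h \<bullet> e) * k) / k = (\<nu> (\<sigma> y) \<bullet> h) / k - h \<bullet> e" by (simp add: diff_divide_distrib)
  have A: "\<nu> (\<sigma> y) \<bullet> eproj e h = \<nu> (\<sigma> y) \<bullet> h - (h \<bullet> e) * k" by (simp add: eproj_def inner_diff_right k_def)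
  have B: "slope y \<bullet> h = h \<bullet> e - (\<nu> (\<sigma> y) \<bullet> h) / k"
    by (simp add: slope_def inner_diff_left k_def[symmetric] inner_commute[of e h] divide_inverse mult.commute)
  show ?thesis unfolding k_def[symmetric] A B minus_divide_left[symmetric] eq by simp
qed

text \<open>The points of the graph above \<open>z\<close> and \<open>y\<close> differ by
  \<open>w + \<kappa> *\<^sub>R e\<close>. First-order tangency at \<open>\<sigma> y\<close>
  determines \<kappa> up to an error small against \<open>norm w + \<bar>\<kappa>\<bar>\<close>, and
  the share of \<kappa> is absorbed.\<close>

lemma height_derivative:
  assumes y: "y \<in> U"
  shows "(height has_derivative (\<lambda>h. slope y \<bullet> h)) (at y)"
  unfolding has_derivative_at_alt
proof (intro conjI allI impI)
  show "bounded_linear (\<lambda>h. slope y \<bullet> h)" by (rule bounded_linear_inner_right)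
  fix \<epsilon> :: real assume \<epsilon>: "\<epsilon> > 0"
  define x k where "x = \<sigma> y" and "k = \<nu> x \<bullet> e"
  have x: "x \<in> M" "x \<in> T" using lift[OF y] by (auto simp: x_def)
  have k: "k > 0" "k\<^sup>2 \<ge> 1 / 2" using pos steep x by (auto simp: k_def)
  have k2: "1 / k \<le> 2"
  proof -
    have "k \<ge> 1 / 2" by (rule power2_le_imp_le) (use k in \<open>auto simp: power2_eq_square\<close>)
    then show ?thesis using k(1) by (simp add: field_simps)
  qed
  \<comment> \<open>The bound \<open>1 / 8\<close> makes the absorption yield
    \<open>\<bar>\<kappa>\<bar> \<le> 3 * norm w\<close>; then the error is at most
    \<open>8 * \<epsilon>' * norm w\<close>, which explains \<open>\<epsilon> / 8\<close>.\<close>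
  define \<epsilon>' where "\<epsilon>' = min (1 / 8) (\<epsilon> / 8)"
  have \<epsilon>': "\<epsilon>' > 0" "\<epsilon>' \<le> 1 / 8" "8 * \<epsilon>' \<le> \<epsilon>" using \<epsilon> by (auto simp: \<epsilon>'_def)
  obtain \<delta> where \<delta>: "\<delta> > 0" "\<And>m. m \<in> M \<Longrightarrow> norm (m - x) < \<delta> \<Longrightarrow> \<bar>\<nu> x \<bullet> (m - x)\<bar> \<le> \<epsilon>' * norm (m - x)"
    using tangent_first_order[OF x(1) \<epsilon>'(1)] by blast
  have "\<exists>r>0. \<forall>z. dist z y < r \<longrightarrow> z \<in> U \<and> \<sigma> z \<in> ball x \<delta>"
    by (rule lift_nhd[OF y]) (use \<delta>(1) in \<open>auto simp: x_def\<close>)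
  then obtain r where r: "r > 0" "\<And>z. dist z y < r \<Longrightarrow> z \<in> U \<and> \<sigma> z \<in> ball x \<delta>" by blast
  show "\<exists>d>0. \<forall>z. norm (z - y) < d \<longrightarrow> norm (height z - height y - slope y \<bullet> (z - y)) \<le> \<epsilon> * norm (z - y)"
  proof (intro exI[of _ r] conjI allI impI r(1))
    fix z assume "norm (z - y) < r"
    then have z: "z \<in> U" "norm (\<sigma> z - x) < \<delta>" using r(2)[of z] by (auto simp: dist_norm norm_minus_commute)
    define w where "w = eproj e (z - y)"
    define \<kappa> where "\<kappa> = height z - height y"
    have d: "\<sigma> z - x = w + \<kappa> *\<^sub>R e"
      using lift_height[OF z(1)] lift_height[OF y] by (simp add: x_def w_def \<kappa>_def eproj_diff algebra_simps)
    have n: "norm (\<sigma> z - x) \<le> norm w + \<bar>\<kappa>\<bar>" unfolding d using norm_triangle_ineq[of w "\<kappa> *\<^sub>R e"] e by simp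
    have sl: "slope y \<bullet> (z - y) = - (\<nu> x \<bullet> w) / k" using slope_inner[OF y] by (simp add: w_def k_def x_def)
    have nd: "\<nu> x \<bullet> (\<sigma> z - x) = \<nu> x \<bullet> w + \<kappa> * k" by (simp add: d inner_add_right k_def)
    have "\<kappa> - slope y \<bullet> (z - y) = (\<nu> x \<bullet> (\<sigma> z - x)) * (1 / k)" using k(1) by (simp add: sl nd field_simps)
    then have "\<bar>\<kappa> - slope y \<bullet> (z - y)\<bar> = \<bar>\<nu> x \<bullet> (\<sigma> z - x)\<bar> * (1 / k)" using k(1) by (simp add: abs_mult)
    also have "\<dots> \<le> (\<epsilon>' * norm (\<sigma> z - x)) * 2"
      using \<delta>(2)[of "\<sigma> z"] lift(1)[OF z(1)] z(2) k2 k(1) \<epsilon>'(1) by (intro mult_mono) auto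
    also have "\<dots> \<le> (\<epsilon>' * (norm w + \<bar>\<kappa>\<bar>)) * 2" using n \<epsilon>'(1) by (intro mult_right_mono mult_left_mono) auto
    finally have err: "\<bar>\<kappa> - slope y \<bullet> (z - y)\<bar> \<le> 2 * \<epsilon>' * (norm w + \<bar>\<kappa>\<bar>)" by simp
    have "\<bar>\<nu> x \<bullet> w\<bar> \<le> norm w" using Cauchy_Schwarz_ineq2[of "\<nu> x" w] norm_normal[OF x(1)] by simp
    then have "\<bar>\<nu> x \<bullet> w\<bar> * (1 / k) \<le> norm w * 2" using k2 k(1) by (intro mult_mono) auto
    then have s1: "\<bar>slope y \<bullet> (z - y)\<bar> \<le> 2 * norm w" using k(1) by (simp add: sl abs_divide)
    have "2 * \<epsilon>' * (norm w + \<bar>\<kappa>\<bar>) \<le> 1 / 4 * (norm w + \<bar>\<kappa>\<bar>)" using \<epsilon>'(2) by (intro mult_right_mono) auto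
    with err have "\<bar>\<kappa> - slope y \<bullet> (z - y)\<bar> \<le> 1 / 4 * (norm w + \<bar>\<kappa>\<bar>)" by (rule order_trans)
    moreover have "\<bar>\<kappa>\<bar> \<le> \<bar>\<kappa> - slope y \<bullet> (z - y)\<bar> + \<bar>slope y \<bullet> (z - y)\<bar>" by linarith
    ultimately have "\<bar>\<kappa>\<bar> \<le> 3 * norm w" using s1 by (simp add: field_simps)
    then have "2 * \<epsilon>' * (norm w + \<bar>\<kappa>\<bar>) \<le> 2 * \<epsilon>' * (4 * norm w)" using \<epsilon>'(1) by (intro mult_left_mono) auto
    also have "\<dots> \<le> \<epsilon> * norm w" using mult_right_mono[OF \<epsilon>'(3), of "norm w"] by simp
    also have "\<dots> \<le> \<epsilon> * norm (z - y)" unfolding w_def using norm_eproj_le[OF e] \<epsilon> by (intro mult_left_mono) auto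
    finally show "norm (height z - height y - slope y \<bullet> (z - y)) \<le> \<epsilon> * norm (z - y)" using err by (simp add: \<kappa>_def)
  qed
qed

text \<open>Relates the Hessian of the height to the second fundamental form: the derivative of the
  slope tested against \<open>h\<close> is the form on the tangent lift of \<open>h\<close>, divided
  by \<open>\<nu> \<bullet> e\<close>. The normal is differentiable only within \<open>M\<close>, so
  the chain rule is applied to its composition with the lift.\<close>

lemma slope_derivative:
  assumes y: "y \<in> U" and D: "(\<nu> has_derivative D) (at (\<sigma> y) within M)"
  obtains Q where "(slope has_derivative Q) (at y)"
    "\<forall>h. h \<bullet> e = 0 \<longrightarrow> Q h \<bullet> h = - (D (tangent_lift e (\<nu> (\<sigma> y)) h) \<bullet> tangent_lift e (\<nu> (\<sigma> y)) h) / (\<nu> (\<sigma> y) \<bullet> e)"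
    "(\<forall>v. \<nu> (\<sigma> y) \<bullet> v = 0 \<longrightarrow> D v = 0) \<longrightarrow> (\<forall>h. Q h = 0)"
proof -
  define x k where "x = \<sigma> y" and "k = \<nu> x \<bullet> e"
  have k: "k \<noteq> 0" using pos[OF lift(1)[OF y]] by (simp add: k_def x_def)
  let ?s = "\<lambda>h. eproj e h + (slope y \<bullet> h) *\<^sub>R e"
  have "((\<lambda>z. eproj e z + height z *\<^sub>R e) has_derivative ?s) (at y)"
    by (intro has_derivative_add has_derivative_scaleR_left height_derivative[OF y] bounded_linear_imp_has_derivative
        eproj_linear[THEN linear_conv_bounded_linear[THEN iffD1]])
  then have ds: "(\<sigma> has_derivative ?s) (at y)"
    by (rule has_derivative_transform_within_open[OF _ open_domain y]) (simp add: lift_height)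
  have "(\<nu> has_derivative D) (at (\<sigma> y) within \<sigma> ` U)"
    by (rule has_derivative_subset[OF D]) (use lift(1) in blast)
  then have "(\<nu> \<circ> \<sigma> has_derivative D \<circ> ?s) (at y within U)"
    by (rule diff_chain_within[OF has_derivative_at_withinI[OF ds]])
  then have dN: "((\<lambda>z. \<nu> (\<sigma> z)) has_derivative (\<lambda>h. D (?s h))) (at y)"
    using at_within_open[OF y open_domain] by (simp add: o_def)
  define Q where "Q h = - (inverse k *\<^sub>R D (?s h) + (- (inverse k * (D (?s h) \<bullet> e) * inverse k)) *\<^sub>R \<nu> x)" for h
  have dk: "((\<lambda>z. \<nu> (\<sigma> z) \<bullet> e) has_derivative (\<lambda>h. D (?s h) \<bullet> e)) (at y)"
    by (rule has_derivative_inner_left[OF dN])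
  have "((\<lambda>z. inverse (\<nu> (\<sigma> z) \<bullet> e)) has_derivative (\<lambda>h. - (inverse k * (D (?s h) \<bullet> e) * inverse k))) (at y)"
    using Deriv.has_derivative_inverse[OF _ dk] k unfolding k_def x_def by blast
  from has_derivative_diff[OF has_derivative_const[of e] has_derivative_scaleR[OF this dN]]
  have dQ: "(slope has_derivative Q) (at y)"
    unfolding slope_def[abs_def] Q_def by (rule has_derivative_eq_rhs) (simp add: fun_eq_iff k_def x_def)
  have sl: "?s h = h - ((\<nu> x \<bullet> eproj e h) / k + h \<bullet> e) *\<^sub>R e" for h
  proof -
    define X where "X = \<nu> x \<bullet> eproj e h"
    have "slope y \<bullet> h = - (X / k)" using slope_inner[OF y, of h] by (simp add: X_def k_def x_def)
    then show ?thesis unfolding X_def[symmetric] by (simp add: eproj_def algebra_simps)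
  qed
  have st: "\<nu> x \<bullet> ?s h = 0" for h
  proof -
    have "(slope y \<bullet> h) * k = - (\<nu> x \<bullet> eproj e h)" using slope_inner[OF y, of h] k by (simp add: k_def x_def)
    then show ?thesis by (simp add: inner_add_right k_def[symmetric])
  qed
  show thesis
  proof (rule that[OF dQ])
    show "(\<forall>v. \<nu> (\<sigma> y) \<bullet> v = 0 \<longrightarrow> D v = 0) \<longrightarrow> (\<forall>h. Q h = 0)"
      using st unfolding Q_def x_def by auto
    show "\<forall>h. h \<bullet> e = 0 \<longrightarrow> Q h \<bullet> h = - (D (tangent_lift e (\<nu> (\<sigma> y)) h) \<bullet> tangent_lift e (\<nu> (\<sigma> y)) h) / (\<nu> (\<sigma> y) \<bullet> e)"
    proof (intro allI impI)
      fix h assume h: "h \<bullet> e = 0"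
      have v: "?s h = tangent_lift e (\<nu> x) h" using sl[of h] h by (simp add: tangent_lift_def k_def[symmetric] eproj_id[OF e h])
      define d where "d = D (tangent_lift e (\<nu> x) h)"
      have "Q h \<bullet> h = - (d \<bullet> h / k - (d \<bullet> e) * (\<nu> x \<bullet> h) / k / k)"
        unfolding Q_def v d_def[symmetric] by (simp add: inner_diff_left inner_add_left divide_inverse)
      also have "\<dots> = - (d \<bullet> tangent_lift e (\<nu> x) h) / k"
        using k by (simp add: tangent_lift_def inner_diff_right k_def[symmetric] field_simps)
      finally show "Q h \<bullet> h = - (D (tangent_lift e (\<nu> (\<sigma> y)) h) \<bullet> tangent_lift e (\<nu> (\<sigma> y)) h) / (\<nu> (\<sigma> y) \<bullet> e)"
        by (simp add: d_def k_def x_def)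
    qed
  qed
qed

end

section \<open>Second differences of locally affine and locally equal functions\<close>

lemma second_difference_affine:
  assumes "\<forall>\<^sub>F t in nhds 0. f (x + t *\<^sub>R h) = a + t * b"
  shows "second_difference f x h 0"
proof -
  obtain d where d: "d > 0" "\<And>t. \<bar>t\<bar> < d \<Longrightarrow> f (x + t *\<^sub>R h) = a + t * b"
    using assms unfolding eventually_nhds_metric by (auto simp: dist_real_def)
  have "\<forall>\<^sub>F t in at 0. 0 = (f (x + t *\<^sub>R h) + f (x - t *\<^sub>R h) - 2 * f x) / t\<^sup>2"
    unfolding eventually_at
  proof (intro exI[of _ d] conjI ballI impI d(1))
    fix t :: real assume "t \<noteq> 0 \<and> dist t 0 < d"
    then have "f (x + t *\<^sub>R h) = a + t * b" "f (x + (- t) *\<^sub>R h) = a + (- t) * b" "f (x + 0 *\<^sub>R h) = a + 0 * b"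
      using d(2)[of t] d(2)[of "- t"] d(2)[of 0] d(1) by (auto simp: dist_real_def)
    then show "0 = (f (x + t *\<^sub>R h) + f (x - t *\<^sub>R h) - 2 * f x) / t\<^sup>2" by simp
  qed
  then show ?thesis unfolding second_difference_def by (rule Lim_transform_eventually[OF tendsto_const])
qed

lemma second_difference_cong:
  assumes "second_difference g x h c" "\<forall>\<^sub>F t in nhds 0. g (x + t *\<^sub>R h) = f (x + t *\<^sub>R h)"
  shows "second_difference f x h c"
proof -
  obtain d where d: "d > 0" "\<And>t. \<bar>t\<bar> < d \<Longrightarrow> g (x + t *\<^sub>R h) = f (x + t *\<^sub>R h)"
    using assms(2) unfolding eventually_nhds_metric by (auto simp: dist_real_def)
  have "\<forall>\<^sub>F t in at 0. (g (x + t *\<^sub>R h) + g (x - t *\<^sub>R h) - 2 * g x) / t\<^sup>2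
      = (f (x + t *\<^sub>R h) + f (x - t *\<^sub>R h) - 2 * f x) / t\<^sup>2"
    unfolding eventually_at
  proof (intro exI[of _ d] conjI ballI impI d(1))
    fix t :: real assume "t \<noteq> 0 \<and> dist t 0 < d"
    then have "g (x + t *\<^sub>R h) = f (x + t *\<^sub>R h)" "g (x + (- t) *\<^sub>R h) = f (x + (- t) *\<^sub>R h)" "g (x + 0 *\<^sub>R h) = f (x + 0 *\<^sub>R h)"
      using d(2)[of t] d(2)[of "- t"] d(2)[of 0] d(1) by (auto simp: dist_real_def)
    then show "(g (x + t *\<^sub>R h) + g (x - t *\<^sub>R h) - 2 * g x) / t\<^sup>2
      = (f (x + t *\<^sub>R h) + f (x - t *\<^sub>R h) - 2 * f x) / t\<^sup>2" by simp
  qed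
  with assms(1)[unfolded second_difference_def] show ?thesis
    unfolding second_difference_def by (rule Lim_transform_eventually)
qed

lemma eventually_line:
  fixes x h :: "'a::real_normed_vector"
  assumes "open W" "x \<in> W"
  shows "\<forall>\<^sub>F t::real in nhds 0. x + t *\<^sub>R h \<in> W"
proof -
  have "open ((\<lambda>t::real. x + t *\<^sub>R h) -` W)" by (intro open_vimage assms continuous_intros)
  then show ?thesis using eventually_nhds_in_open[of "(\<lambda>t::real. x + t *\<^sub>R h) -` W" 0] assms(2) by simp
qed

section \<open>The Hessian of the height and the tangent planes\<close>

context graph_patch
begin

lemma slope_flat:
  assumes y: "y \<in> U" "\<sigma> y \<in> flat_points"
  shows "(slope has_derivative (\<lambda>h. 0)) (at y)"
proof -
  have yM: "\<sigma> y \<in> M" using lift(1)[OF y(1)] by blast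
  obtain D where D: "(\<nu> has_derivative D) (at (\<sigma> y) within M)" "\<And>h. D h \<bullet> \<nu> (\<sigma> y) = 0"
    using normal_differentiable[OF yM] by blast
  have "\<forall>v. \<nu> (\<sigma> y) \<bullet> v = 0 \<longrightarrow> D v = 0" using shape_flat_point[OF y(2) D] by blast
  moreover obtain Q where Q: "(slope has_derivative Q) (at y)" "(\<forall>v. \<nu> (\<sigma> y) \<bullet> v = 0 \<longrightarrow> D v = 0) \<longrightarrow> (\<forall>h. Q h = 0)"
    by (rule slope_derivative[OF y(1) D(1)])
  ultimately have "Q = (\<lambda>h. 0)" by auto
  then show ?thesis using Q(1) by simp
qed

text \<open>Everything that the maximum principles ask of the Hessian at a point of positive mean
  curvature. The last property, a consequence of nonzero trace, is what contradicts the vanishing of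
  the excess near the exposed point.\<close>

lemma slope_quadratic:
  assumes y: "y \<in> U" and H: "mean_curvature M \<nu> (\<sigma> y) > 0"
  obtains Q where "(slope has_derivative Q) (at y)"
    "\<forall>a. \<exists>h. h \<noteq> 0 \<and> h \<bullet> a = 0 \<and> h \<bullet> e = 0 \<and> 0 \<le> Q h \<bullet> h"
    "\<forall>\<alpha> \<beta> z. 0 \<le> \<alpha> \<longrightarrow> 0 \<le> \<beta> \<longrightarrow> z \<bullet> e = 0 \<longrightarrow> (\<forall>h. h \<bullet> e = 0 \<longrightarrow> Q h \<bullet> h \<le> \<alpha> * (norm h)\<^sup>2 - \<beta> * (z \<bullet> h)\<^sup>2) \<longrightarrow> \<beta> * (norm z)\<^sup>2 \<le> 2 * real n * \<alpha>"
    "\<exists>h. h \<bullet> e = 0 \<and> Q h \<bullet> h \<noteq> 0"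
proof -
  define x where "x = \<sigma> y"
  have x: "x \<in> M" "x \<in> M \<inter> T" using lift(1)[OF y] by (auto simp: x_def)
  obtain D where D: "(\<nu> has_derivative D) (at x within M)" "\<And>h. D h \<bullet> \<nu> x = 0"
    using normal_differentiable[OF x(1)] by blast
  obtain Q where Q: "(slope has_derivative Q) (at y)"
    "\<forall>h. h \<bullet> e = 0 \<longrightarrow> Q h \<bullet> h = - (D (tangent_lift e (\<nu> x) h) \<bullet> tangent_lift e (\<nu> x) h) / (\<nu> x \<bullet> e)"
    unfolding x_def by (rule slope_derivative[OF y D(1)[unfolded x_def]])
  let ?E = "tangent_frame M x"
  note E = frame[OF x(1)]
  have lin: "linear D" by (rule has_derivative_linear[OF D(1)])
  have "\<nu> x \<noteq> 0" using norm_normal[OF x(1)] by auto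
  then have cardE: "card ?E = n"
    using orthonormal_basis_of_card[OF E] dim_hyperplane[of "\<nu> x"] dim by simp
  have Hs: "(\<Sum>v\<in>?E. D v \<bullet> v) < 0" using H curvature_shape(1)[OF x(1) D(1)] by (simp add: x_def)
  have Rs: "(\<Sum>v\<in>?E. \<Sum>w\<in>?E. (D v \<bullet> w)\<^sup>2) \<le> (\<Sum>v\<in>?E. D v \<bullet> v)\<^sup>2"
    using scal[OF x(1)] curvature_shape[OF x(1) D(1)] by simp
  note nx = norm_normal[OF x(1)]
  show thesis
  proof (rule that[OF Q(1)])
    show "\<forall>a. \<exists>h. h \<noteq> 0 \<and> h \<bullet> a = 0 \<and> h \<bullet> e = 0 \<and> 0 \<le> Q h \<bullet> h"
    proof
      fix a
      have "card ?E \<ge> 2" using cardE n2 by simp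
      from curvature_two_directions[OF nx e pos[OF x(2)] lin E this less_imp_le[OF Hs] Rs, of a]
      obtain h where "h \<noteq> 0" "h \<bullet> a = 0" "h \<bullet> e = 0" "0 \<le> - (D (tangent_lift e (\<nu> x) h) \<bullet> tangent_lift e (\<nu> x) h) / (\<nu> x \<bullet> e)"
        by blast
      then show "\<exists>h. h \<noteq> 0 \<and> h \<bullet> a = 0 \<and> h \<bullet> e = 0 \<and> 0 \<le> Q h \<bullet> h" using Q(2) by (intro exI[of _ h]) simp
    qed
    show "\<forall>\<alpha> \<beta> z. 0 \<le> \<alpha> \<longrightarrow> 0 \<le> \<beta> \<longrightarrow> z \<bullet> e = 0 \<longrightarrow> (\<forall>h. h \<bullet> e = 0 \<longrightarrow> Q h \<bullet> h \<le> \<alpha> * (norm h)\<^sup>2 - \<beta> * (z \<bullet> h)\<^sup>2) \<longrightarrow> \<beta> * (norm z)\<^sup>2 \<le> 2 * real n * \<alpha>"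
    proof (intro allI impI)
      fix \<alpha> \<beta> z assume *: "0 \<le> \<alpha>" "0 \<le> \<beta>" "z \<bullet> e = 0" "\<forall>h. h \<bullet> e = 0 \<longrightarrow> Q h \<bullet> h \<le> \<alpha> * (norm h)\<^sup>2 - \<beta> * (z \<bullet> h)\<^sup>2"
      have "- (D (tangent_lift e (\<nu> x) h) \<bullet> tangent_lift e (\<nu> x) h) / (\<nu> x \<bullet> e) \<le> \<alpha> * (norm h)\<^sup>2 - \<beta> * (z \<bullet> h)\<^sup>2" if "h \<bullet> e = 0" for h
      proof -
        have "Q h \<bullet> h \<le> \<alpha> * (norm h)\<^sup>2 - \<beta> * (z \<bullet> h)\<^sup>2" using *(4) that by simp
        then show ?thesis using Q(2) that by simp
      qed
      from curvature_trace_bound[OF nx e pos[OF x(2)] steep[OF x(2)] lin E less_imp_le[OF Hs] *(1-3) this]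
      show "\<beta> * (norm z)\<^sup>2 \<le> 2 * real n * \<alpha>" by (simp add: cardE)
    qed
    show "\<exists>h. h \<bullet> e = 0 \<and> Q h \<bullet> h \<noteq> 0"
    proof (rule ccontr)
      assume neg: "\<nexists>h. h \<bullet> e = 0 \<and> Q h \<bullet> h \<noteq> 0"
      have "D v \<bullet> v = 0" if "v \<in> ?E" for v
      proof -
        have "\<nu> x \<bullet> v = 0" using orthonormal_basis_of_subset[OF E] that by blast
        then have l: "tangent_lift e (\<nu> x) (eproj e v) = v"
          unfolding eproj_def using pos[OF x(2)] e by (intro tangent_lift_proj) auto
        have he: "eproj e v \<bullet> e = 0" by (rule eproj_inner[OF e])
        then have "Q (eproj e v) \<bullet> eproj e v = 0" using neg by simp
        then have "- (D (tangent_lift e (\<nu> x) (eproj e v)) \<bullet> tangent_lift e (\<nu> x) (eproj e v)) / (\<nu> x \<bullet> e) = 0"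
          using Q(2) he by simp
        then show ?thesis unfolding l using pos[OF x(2)] by simp
      qed
      then show False using Hs by simp
    qed
  qed
qed

text \<open>For \<open>y\<close> orthogonal to \<open>e\<close>, the height at which the vertical
  line through \<open>y\<close> meets the affine tangent plane of \<open>M\<close> at
  \<open>\<sigma> z\<close>.\<close>

definition plane :: "'a \<Rightarrow> 'a \<Rightarrow> real" where
  "plane z y = (\<nu> (\<sigma> z) \<bullet> \<sigma> z - \<nu> (\<sigma> z) \<bullet> y) / (\<nu> (\<sigma> z) \<bullet> e)"

lemma plane_line: "plane z (x + t *\<^sub>R h) = plane z x + t * (- (\<nu> (\<sigma> z) \<bullet> h) / (\<nu> (\<sigma> z) \<bullet> e))"
  by (simp add: plane_def inner_add_right diff_divide_distrib add_divide_distrib)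

lemma plane_eq:
  assumes z: "z \<in> U" "z \<bullet> e = 0" and y: "y \<bullet> e = 0"
  shows "plane z y = height z + slope z \<bullet> (y - z)"
proof -
  have k: "\<nu> (\<sigma> z) \<bullet> e \<noteq> 0" using pos[OF lift(1)[OF z(1)]] by simp
  have 1: "\<nu> (\<sigma> z) \<bullet> \<sigma> z = \<nu> (\<sigma> z) \<bullet> z + height z * (\<nu> (\<sigma> z) \<bullet> e)"
    by (subst (2) lift_height[OF z(1)]) (simp add: inner_add_right eproj_id[OF e z(2)])
  have 2: "eproj e (y - z) = y - z" by (rule eproj_id[OF e]) (simp add: inner_diff_left z y)
  have "(\<nu> (\<sigma> z) \<bullet> z + height z * (\<nu> (\<sigma> z) \<bullet> e) - \<nu> (\<sigma> z) \<bullet> y) / (\<nu> (\<sigma> z) \<bullet> e)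
      = height z + (- (\<nu> (\<sigma> z) \<bullet> (y - z))) / (\<nu> (\<sigma> z) \<bullet> e)"
    using k by (simp add: inner_diff_right add_divide_distrib diff_divide_distrib)
  then show ?thesis unfolding plane_def 1 slope_inner[OF z(1)] 2 .
qed

text \<open>The slope has derivative zero at \<open>x\<close>, so it differs from
  \<open>slope x\<close> by a small multiple of the distance. Integrating along the segment makes
  the height agree with its tangent plane up to a small multiple of the squared distance.\<close>

lemma flat_estimate:
  assumes x: "x \<in> U" "\<sigma> x \<in> flat_points" and \<epsilon>: "\<epsilon> > 0"
  shows "\<exists>d>0. ball x d \<subseteq> U \<and> (\<forall>y\<in>ball x d. norm (slope y - slope x) \<le> \<epsilon> * norm (y - x) \<and>
      \<bar>height y - height x - slope x \<bullet> (y - x)\<bar> \<le> \<epsilon> * (norm (y - x))\<^sup>2)"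
proof -
  obtain d1 where d1: "d1 > 0" "\<And>y. norm (y - x) < d1 \<Longrightarrow> norm (slope y - slope x - 0) \<le> \<epsilon> * norm (y - x)"
    using slope_flat[OF x] \<epsilon> unfolding has_derivative_at_alt by blast
  obtain d2 where d2: "d2 > 0" "ball x d2 \<subseteq> U" using openE[OF open_domain x(1)] by blast
  define d where "d = min d1 d2"
  have sub: "ball x d \<subseteq> U" using d2(2) by (auto simp: d_def)
  have sl: "norm (slope y - slope x) \<le> \<epsilon> * norm (y - x)" if "y \<in> ball x d" for y
    using d1(2)[of y] that by (simp add: d_def dist_norm norm_minus_commute)
  have "\<bar>height y - height x - slope x \<bullet> (y - x)\<bar> \<le> \<epsilon> * (norm (y - x))\<^sup>2" if y: "y \<in> ball x d" for y
  proof -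
    have seg: "closed_segment x y \<subseteq> ball x d"
      using y by (intro closed_segment_subset convex_ball) (auto simp: d_def d1 d2)
    have "norm ((height y - slope x \<bullet> y) - (height x - slope x \<bullet> x)) \<le> (\<epsilon> * norm (y - x)) * norm (y - x)"
    proof (rule differentiable_bound[of "closed_segment x y" "\<lambda>w. height w - slope x \<bullet> w" "\<lambda>w h. slope w \<bullet> h - slope x \<bullet> h"])
      fix w assume w: "w \<in> closed_segment x y"
      then have wb: "w \<in> ball x d" using seg by blast
      then have "w \<in> U" using sub by blast
      have "((\<lambda>w. height w - slope x \<bullet> w) has_derivative (\<lambda>h. slope w \<bullet> h - slope x \<bullet> h)) (at w)"
        by (intro has_derivative_diff height_derivative \<open>w \<in> U\<close> bounded_linear_imp_has_derivative bounded_linear_inner_right)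
      then show "((\<lambda>w. height w - slope x \<bullet> w) has_derivative (\<lambda>h. slope w \<bullet> h - slope x \<bullet> h)) (at w within closed_segment x y)"
        by (rule has_derivative_at_withinI)
      have "norm (w - x) \<le> norm (y - x)" using segment_bound(1)[OF w] by simp
      then have "norm (slope w - slope x) \<le> \<epsilon> * norm (y - x)"
        using sl[OF wb] \<epsilon> by (meson mult_le_cancel_left_pos order_trans)
      then have b: "norm ((slope w - slope x) \<bullet> h) \<le> (\<epsilon> * norm (y - x)) * norm h" for h
        using Cauchy_Schwarz_ineq2[of "slope w - slope x" h] by (metis mult_right_mono norm_ge_zero order_trans real_norm_def)
      show "onorm (\<lambda>h. slope w \<bullet> h - slope x \<bullet> h) \<le> \<epsilon> * norm (y - x)"
        by (rule onorm_le) (use b in \<open>simp add: inner_diff_left\<close>)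
    qed auto
    moreover have "(height y - slope x \<bullet> y) - (height x - slope x \<bullet> x) = height y - height x - slope x \<bullet> (y - x)"
      by (simp add: inner_diff_right)
    ultimately show ?thesis by (simp add: power2_eq_square mult.assoc)
  qed
  then show ?thesis using sl sub d1(1) d2(1) by (intro exI[of _ d]) (auto simp: d_def)
qed

end

section \<open>Faces bounded by the flat set\<close>

text \<open>\<open>K\<close> is the flat cylinder inside \<open>U0\<close>, and \<open>Y\<close> is the unbounded component of the complement of the
  face \<open>\<Omega>\<close>.\<close>

locale graph_face = graph_patch +
  fixes \<Omega> U0 K Y :: "'a set" and R :: real
  assumes \<Omega>: "open \<Omega>" "connected \<Omega>" "\<Omega> \<noteq> {}" "\<Omega> \<subseteq> U0"
    and cyl: "\<And>y y'. y \<in> \<Omega> \<Longrightarrow> eproj e y = eproj e y' \<Longrightarrow> y' \<in> \<Omega>"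
    and R: "\<And>y. y \<in> \<Omega> \<Longrightarrow> norm (eproj e y) < R"
    and curv: "\<And>y. y \<in> \<Omega> \<Longrightarrow> mean_curvature M \<nu> (\<sigma> y) > 0"
    and U0: "open U0" "U0 \<subseteq> U" and K: "closed K" "K \<subseteq> U0" "\<And>y. y \<in> K \<Longrightarrow> \<sigma> y \<in> flat_points"
    and fr: "frontier \<Omega> \<subseteq> K \<union> frontier U0"
    and Y: "Y \<in> components (- \<Omega>)" "\<And>y. norm (eproj e y) \<ge> R \<Longrightarrow> y \<in> Y" "frontier Y \<subseteq> K"
begin

lemma KU: "K \<subseteq> U" and \<Omega>U: "\<Omega> \<subseteq> U" using K U0 \<Omega> by auto

text \<open>In Euclidean space the frontier of a complementary component of a connected set is
  connected. Here it lies in the union of the disjoint closed sets \<open>K\<close> and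
  \<open>frontier U0\<close>, so once it meets \<open>U0\<close> it lies entirely in
  \<open>K\<close>.\<close>

lemma island_frontier:
  assumes "Y' \<in> components (- \<Omega>)"
  shows "frontier Y' \<subseteq> frontier \<Omega>" "connected (frontier Y')" "frontier Y' \<inter> U0 \<noteq> {} \<Longrightarrow> frontier Y' \<subseteq> K"
proof -
  show 1: "frontier Y' \<subseteq> frontier \<Omega>"
    using frontier_of_components_subset[OF assms] by simp
  show 2: "connected (frontier Y')" by (rule connected_frontier_component_complement[OF \<Omega>(2) assms])
  have d: "U0 \<inter> frontier U0 = {}" using frontier_disjoint_eq[of U0] U0(1) by blast
  assume "frontier Y' \<inter> U0 \<noteq> {}"
  then have "frontier Y' \<inter> K \<noteq> {}" using 1 fr d by blast
  moreover have "K \<inter> frontier Y' = {} \<or> frontier U0 \<inter> frontier Y' = {}"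
    by (rule connected_closedD[OF 2 _ _ K(1) frontier_closed]) (use d K(2) 1 fr in blast)+
  ultimately show "frontier Y' \<subseteq> K" using 1 fr by blast
qed

lemma plane_const:
  assumes "Y' \<in> components (- \<Omega>)" "frontier Y' \<subseteq> K" "z \<in> frontier Y'" "z' \<in> frontier Y'"
  shows "plane z = plane z'"
proof -
  have c: "connected (\<sigma> ` frontier Y')"
    by (rule connected_continuous_image[OF continuous_on_subset[OF continuous_lift] island_frontier(2)[OF assms(1)]])
      (use assms(2) KU in blast)
  have s: "\<sigma> ` frontier Y' \<subseteq> flat_points" using assms(2) K(3) by blast
  have "\<nu> (\<sigma> z) = \<nu> (\<sigma> z')" "\<nu> (\<sigma> z) \<bullet> \<sigma> z = \<nu> (\<sigma> z') \<bullet> \<sigma> z'"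
    using tangent_plane_constant[OF c s] assms(3,4) by blast+
  then show ?thesis by (simp add: plane_def fun_eq_iff)
qed

lemma hyperplane_direction:
  obtains h where "norm h = 1" "h \<bullet> e = 0" "0 \<le> h \<bullet> x"
proof -
  have "dim {v. e \<bullet> v = 0} = n" using dim_hyperplane[of e] e dim by force
  then have "\<not> {v. e \<bullet> v = 0} \<subseteq> {0}" using n2 dim_subset[of "{v. e \<bullet> v = 0}" "{0}"] by auto
  then obtain v where v: "e \<bullet> v = 0" "v \<noteq> 0" by blast
  define w where "w = v /\<^sub>R norm v"
  have w: "norm w = 1" "w \<bullet> e = 0" using v by (auto simp: w_def inner_commute)
  show thesis
  proof (cases "0 \<le> w \<bullet> x")
    case True then show thesis using that w by blast
  next
    case False then show thesis using that[of "- w"] w by simp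
  qed
qed

text \<open>\<open>p\<close> maximises the norm over the closure of the face within the hyperplane.
  From a point at least as far out as \<open>p\<close> a ray of increasing norm avoids the face and
  runs into the region beyond \<open>R\<close>, so that point belongs to \<open>Y\<close>.\<close>

lemma exposed_point:
  obtains p where "p \<bullet> e = 0" "p \<in> K" "p \<in> frontier Y" "p \<in> closure \<Omega>"
    "\<And>x. x \<bullet> e = 0 \<Longrightarrow> norm p \<le> norm x \<Longrightarrow> x \<in> Y"
proof -
  define S where "S = closure \<Omega> \<inter> {x. x \<bullet> e = 0}"
  have hp: "closed {x. x \<bullet> e = 0}" using closed_hyperplane[of e 0] by (simp add: inner_commute)
  have "closure \<Omega> \<subseteq> {y. norm (eproj e y) \<le> R}"
  proof (rule closure_minimal)
    show "\<Omega> \<subseteq> {y. norm (eproj e y) \<le> R}" using R less_imp_le by blast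
    show "closed {y. norm (eproj e y) \<le> R}"
      by (intro closed_Collect_le continuous_intros eproj_continuous)
  qed
  then have "norm x \<le> R" if "x \<in> S" for x using that eproj_id[OF e, of x] by (auto simp: S_def)
  then have "bounded S" by (auto simp: bounded_iff)
  then have Sc: "compact S" unfolding compact_eq_bounded_closed using hp by (auto simp: S_def)
  have pr: "eproj e y \<in> \<Omega>" if "y \<in> \<Omega>" for y
    using cyl[OF that, of "eproj e y"] eproj_id[OF e eproj_inner[OF e, of y]] by simp
  obtain y0 where y0: "y0 \<in> \<Omega>" using \<Omega>(3) by blast
  have "eproj e y0 \<in> S" using pr[OF y0] closure_subset[of \<Omega>] eproj_inner[OF e] by (auto simp: S_def)
  then have "S \<noteq> {}" by blast
  from continuous_attains_sup[OF Sc this continuous_on_norm[OF continuous_on_id]]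
  obtain p where p: "p \<in> S" "\<And>x. x \<in> S \<Longrightarrow> norm x \<le> norm p" by blast
  have far: "norm (x + s *\<^sub>R h) > norm x" if "norm h = 1" "0 \<le> h \<bullet> x" "s > 0" for x h :: 'a and s :: real
  proof -
    have "(norm (x + s *\<^sub>R h))\<^sup>2 = (norm x)\<^sup>2 + 2 * s * (h \<bullet> x) + s\<^sup>2 * (h \<bullet> h)"
      unfolding power2_norm_eq_inner by (simp add: inner_add_left inner_add_right inner_commute power2_eq_square)
    moreover have "h \<bullet> h = 1" using that(1) by (simp add: norm_eq_1)
    moreover have "2 * s * (h \<bullet> x) \<ge> 0" "s\<^sup>2 * 1 > 0" using that by auto
    ultimately have "(norm x)\<^sup>2 < (norm (x + s *\<^sub>R h))\<^sup>2" by (simp only:)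
    then show ?thesis by (rule power2_less_imp_less) simp
  qed
  have out: "x \<in> Y" if x: "x \<bullet> e = 0" "norm p \<le> norm x" for x
  proof -
    obtain h where h: "norm h = 1" "h \<bullet> e = 0" "0 \<le> h \<bullet> x" by (rule hyperplane_direction)
    have he: "(x + s *\<^sub>R h) \<bullet> e = 0" for s using x h by (simp add: inner_add_left)
    have no: "x + s *\<^sub>R h \<notin> \<Omega>" if "s > 0" for s
    proof
      assume "x + s *\<^sub>R h \<in> \<Omega>"
      then have "x + s *\<^sub>R h \<in> S" using closure_subset[of \<Omega>] he by (auto simp: S_def)
      then show False using p(2) far[OF h(1,3) that] x(2) by force
    qed
    \<comment> \<open>The start of the ray needs its own argument: \<Omega> is open, so it would
      contain points of the ray beyond \<open>x\<close> as well.\<close>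
    have no0: "x \<notin> \<Omega>"
    proof
      assume "x \<in> \<Omega>"
      then obtain r where r: "r > 0" "ball x r \<subseteq> \<Omega>" using \<Omega>(1) openE by blast
      have "x + (r / 2) *\<^sub>R h \<in> ball x r" using r h by (simp add: dist_norm)
      then show False using no[of "r / 2"] r by auto
    qed
    define L where "L = (\<lambda>s. x + s *\<^sub>R h) ` {0..}"
    have "connected L" unfolding L_def
      by (intro connected_continuous_image continuous_intros) (simp add: convex_connected)
    moreover have "L \<subseteq> - \<Omega>"
    proof
      fix v assume "v \<in> L"
      then obtain s where "s \<ge> 0" "v = x + s *\<^sub>R h" by (auto simp: L_def)
      then show "v \<in> - \<Omega>" using no[of s] no0 by (cases "s = 0") auto
    qed
    moreover have "Y \<inter> L \<noteq> {}"
    proof -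
      define s where "s = \<bar>R\<bar> + norm x"
      have "norm (s *\<^sub>R h) - norm x \<le> norm (s *\<^sub>R h + x)" by (rule norm_diff_ineq)
      then have "norm (x + s *\<^sub>R h) \<ge> R" using h(1) by (simp add: s_def add.commute)
      then have "x + s *\<^sub>R h \<in> Y" using Y(2) eproj_id[OF e he] by simp
      moreover have "x + s *\<^sub>R h \<in> L" unfolding L_def by (rule image_eqI[of _ _ s]) (auto simp: s_def)
      ultimately show ?thesis by blast
    qed
    ultimately have "L \<subseteq> Y" using components_maximal[OF Y(1)] by blast
    moreover have "x \<in> L" unfolding L_def by (rule image_eqI[of _ _ 0]) auto
    ultimately show ?thesis by blast
  qed
  have pe: "p \<bullet> e = 0" "p \<in> closure \<Omega>" using p(1) by (auto simp: S_def)
  have pY: "p \<in> Y" using out pe by blast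
  have "\<Omega> \<subseteq> - Y" using in_components_subset[OF Y(1)] by blast
  then have "p \<in> closure (- Y)" using pe(2) closure_mono by blast
  then have "p \<in> frontier Y" unfolding frontier_closures using pY closure_subset by blast
  then show thesis using that pe out Y(3) by blast
qed

abbreviation "island y \<equiv> connected_component_set (- \<Omega>) y"

text \<open>The choice is immaterial on islands with flat frontier, where the tangent plane is constant.\<close>

definition anchor :: "'a \<Rightarrow> 'a" where "anchor y = (SOME z. z \<in> frontier (island y))"

definition patched :: "'a \<Rightarrow> real" where
  "patched y = (if y \<in> \<Omega> then height y else plane (anchor y) y)"

lemma island_component: "x \<notin> \<Omega> \<Longrightarrow> island x \<in> components (- \<Omega>)" "x \<notin> \<Omega> \<Longrightarrow> x \<in> island x"
  by (auto intro: componentsI)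

text \<open>The ball meets \<Omega> because \<open>p\<close> is in its closure, and it meets the
  island at \<open>x\<close>. Being connected, it meets the frontier of the island, and this happens
  inside \<open>U0\<close>. So each island reached from the ball has flat frontier, and its anchor
  is meaningful.\<close>

lemma islandI:
  assumes "x \<notin> \<Omega>" "p \<in> closure \<Omega>" "ball p \<delta> \<subseteq> U0" "x \<in> ball p \<delta>"
  shows "anchor x \<in> frontier (island x)" "frontier (island x) \<subseteq> K"
proof -
  have "\<delta> > 0" using assms(4) le_less_trans[OF zero_le_dist] by (metis mem_ball)
  have "ball p \<delta> \<inter> \<Omega> \<noteq> {}"
  proof
    assume "ball p \<delta> \<inter> \<Omega> = {}"
    then have "ball p \<delta> \<inter> closure \<Omega> = {}" by (simp add: open_Int_closure_eq_empty)
    moreover have "p \<in> ball p \<delta>" using \<open>\<delta> > 0\<close> by simp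
    ultimately show False using assms(2) by blast
  qed
  then obtain w where w: "w \<in> ball p \<delta>" "w \<in> \<Omega>" by blast
  have "w \<notin> island x" using w(2) connected_component_subset[of "- \<Omega>" x] by blast
  then have "ball p \<delta> \<inter> frontier (island x) \<noteq> {}"
    using connected_Int_frontier[of "ball p \<delta>" "island x"] w(1) assms(4) island_component(2)[OF assms(1)] by blast
  then have ne: "frontier (island x) \<inter> U0 \<noteq> {}" "\<exists>z. z \<in> frontier (island x)" using assms(3) by blast+
  show "anchor x \<in> frontier (island x)" unfolding anchor_def by (rule someI_ex[OF ne(2)])
  show "frontier (island x) \<subseteq> K" by (rule island_frontier(3)[OF island_component(1)[OF assms(1)] ne(1)])
qed

lemma frontier_islandI:
  assumes "x \<in> closure \<Omega>" "x \<in> island y"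
  shows "x \<in> frontier (island y)"
proof -
  have "\<Omega> \<subseteq> - island y" using connected_component_subset[of "- \<Omega>" y] by blast
  then have "x \<in> closure (- island y)" using assms(1) closure_mono by blast
  then show ?thesis unfolding frontier_closures using assms(2) closure_subset by blast
qed

end

section \<open>The patched height near the exposed point\<close>

context graph_face
begin

context
  fixes p :: 'a and \<delta> :: real
  assumes p: "p \<bullet> e = 0" "p \<in> closure \<Omega>" and \<delta>: "\<delta> > 0" "ball p \<delta> \<subseteq> U0"
begin

lemma frontier_point:
  assumes x: "x \<in> ball p \<delta>" "x \<in> closure \<Omega>" "x \<notin> \<Omega>"
  shows "x \<in> K" "\<And>y. x \<in> island y \<Longrightarrow> y \<notin> \<Omega> \<Longrightarrow> y \<in> ball p \<delta> \<Longrightarrow> plane (anchor y) = plane x"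
proof -
  have f: "x \<in> frontier (island x)" by (rule frontier_islandI[OF x(2) island_component(2)[OF x(3)]])
  then show "x \<in> K" using islandI(2)[OF x(3) p(2) \<delta>(2) x(1)] by blast
  fix y assume y: "x \<in> island y" "y \<notin> \<Omega>" "y \<in> ball p \<delta>"
  note i = islandI[OF y(2) p(2) \<delta>(2) y(3)]
  show "plane (anchor y) = plane x"
    by (rule plane_const[OF island_component(1)[OF y(2)] i(2) i(1) frontier_islandI[OF x(2) y(1)]])
qed

text \<open>The delicate point is an island near \<open>x\<close> that does not contain
  \<open>x\<close>; such islands may be arbitrarily small and numerous. The segment from
  \<open>x\<close> enters it at a flat point \<open>z\<close>, and on it the function is the tangent
  plane at \<open>z\<close>. That plane differs from the one at \<open>x\<close> by a height error
  and a slope error, each at most \<epsilon> times the squared distance, whence the factor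
  2.\<close>

lemma patched_estimate:
  assumes x: "x \<in> ball p \<delta>" "x \<in> closure \<Omega>" "x \<notin> \<Omega>" "x \<bullet> e = 0" and \<epsilon>: "\<epsilon> > 0"
  shows "\<exists>d>0. \<forall>y\<in>ball x d. y \<bullet> e = 0 \<longrightarrow> \<bar>patched y - plane x y\<bar> \<le> 2 * \<epsilon> * (norm (y - x))\<^sup>2"
proof -
  have xK: "x \<in> K" by (rule frontier_point(1)[OF x(1-3)])
  then have xU: "x \<in> U" "\<sigma> x \<in> flat_points" using KU K(3) by blast+
  obtain d1 where d1: "d1 > 0" "ball x d1 \<subseteq> U"
    and sl: "\<And>y. y \<in> ball x d1 \<Longrightarrow> norm (slope y - slope x) \<le> \<epsilon> * norm (y - x)"
    and ht: "\<And>y. y \<in> ball x d1 \<Longrightarrow> \<bar>height y - height x - slope x \<bullet> (y - x)\<bar> \<le> \<epsilon> * (norm (y - x))\<^sup>2"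
    using flat_estimate[OF xU \<epsilon>] by blast
  obtain d2 where d2: "d2 > 0" "ball x d2 \<subseteq> ball p \<delta>" using openE[OF open_ball x(1)] by blast
  show ?thesis
  proof (intro exI[of _ "min d1 d2"] conjI ballI impI)
    show "min d1 d2 > 0" using d1 d2 by simp
    fix y assume y: "y \<in> ball x (min d1 d2)" "y \<bullet> e = 0"
    then have yb: "y \<in> ball x d1" "y \<in> ball p \<delta>" using d2(2) by auto
    have nn: "0 \<le> \<epsilon> * (norm (y - x))\<^sup>2" using \<epsilon> by simp
    show "\<bar>patched y - plane x y\<bar> \<le> 2 * \<epsilon> * (norm (y - x))\<^sup>2"
    proof (cases "y \<in> \<Omega>")
      case True
      then have "patched y - plane x y = height y - height x - slope x \<bullet> (y - x)"
        by (simp add: patched_def plane_eq[OF xU(1) x(4) y(2)])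
      then have "\<bar>patched y - plane x y\<bar> \<le> \<epsilon> * (norm (y - x))\<^sup>2" using ht[OF yb(1)] by simp
      then show ?thesis using nn by linarith
    next
      case False
      then have pt: "patched y = plane (anchor y) y" by (simp add: patched_def)
      show ?thesis
      proof (cases "x \<in> island y")
        case True
        have "plane (anchor y) = plane x" by (rule frontier_point(2)[OF x(1-3) True False yb(2)])
        then have "patched y - plane x y = 0" using pt by simp
        then show ?thesis using nn by simp
      next
        case out: False
        have "closed_segment x y \<inter> frontier (island y) \<noteq> {}"
        proof (rule connected_Int_frontier)
          show "closed_segment x y \<inter> island y \<noteq> {}" using island_component(2)[OF False] by blast
          show "closed_segment x y - island y \<noteq> {}" using out by blast
        qed simp
        then obtain z where z: "z \<in> closed_segment x y" "z \<in> frontier (island y)" by blast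
        note i = islandI[OF False p(2) \<delta>(2) yb(2)]
        have pz: "plane (anchor y) = plane z"
          by (rule plane_const[OF island_component(1)[OF False] i(2) i(1) z(2)])
        have zU: "z \<in> U" using z(2) i(2) KU by blast
        have zb: "z \<in> ball x d1"
        proof -
          have "closed_segment x y \<subseteq> ball x d1"
            using yb(1) d1(1) by (intro closed_segment_subset convex_ball) auto
          then show ?thesis using z(1) by blast
        qed
        obtain t where t: "0 \<le> t" "t \<le> 1" "z = (1 - t) *\<^sub>R x + t *\<^sub>R y" using z(1) by (auto simp: in_segment)
        have ze: "z \<bullet> e = 0" using t(3) x(4) y(2) by (simp add: inner_add_left)
        have n1: "norm (z - x) \<le> norm (y - x)" "norm (y - z) \<le> norm (y - x)"
          using segment_bound[OF z(1)] by (simp_all add: norm_minus_commute)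
        \<comment> \<open>The plane at \<open>z\<close> is compared with the plane at
          \<open>x\<close>, splitting \<open>y - x\<close> into \<open>z - x\<close> and
          \<open>y - z\<close>.\<close>
        have "plane z y - plane x y = (height z - height x - slope x \<bullet> (z - x)) + (slope z - slope x) \<bullet> (y - z)"
          unfolding plane_eq[OF zU ze y(2)] plane_eq[OF xU(1) x(4) y(2)]
          by (simp add: inner_diff_left inner_diff_right)
        also have "\<bar>\<dots>\<bar> \<le> \<bar>height z - height x - slope x \<bullet> (z - x)\<bar> + \<bar>(slope z - slope x) \<bullet> (y - z)\<bar>"
          by (rule abs_triangle_ineq)
        also have "\<dots> \<le> \<epsilon> * (norm (y - x))\<^sup>2 + \<epsilon> * (norm (y - x))\<^sup>2"
        proof (rule add_mono)
          have "\<epsilon> * (norm (z - x))\<^sup>2 \<le> \<epsilon> * (norm (y - x))\<^sup>2"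
            using n1 \<epsilon> by (intro mult_left_mono power_mono) auto
          then show "\<bar>height z - height x - slope x \<bullet> (z - x)\<bar> \<le> \<epsilon> * (norm (y - x))\<^sup>2"
            using ht[OF zb] by linarith
          have "\<bar>(slope z - slope x) \<bullet> (y - z)\<bar> \<le> norm (slope z - slope x) * norm (y - z)"
            by (rule Cauchy_Schwarz_ineq2)
          also have "\<dots> \<le> (\<epsilon> * norm (y - x)) * norm (y - x)"
          proof (rule mult_mono)
            have "\<epsilon> * norm (z - x) \<le> \<epsilon> * norm (y - x)" using n1 \<epsilon> by (intro mult_left_mono) auto
            then show "norm (slope z - slope x) \<le> \<epsilon> * norm (y - x)" using sl[OF zb] by linarith
          qed (use n1 \<epsilon> in auto)
          finally show "\<bar>(slope z - slope x) \<bullet> (y - z)\<bar> \<le> \<epsilon> * (norm (y - x))\<^sup>2" by (simp add: power2_eq_square mult.assoc)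
        qed
        finally show ?thesis unfolding pt pz by simp
      qed
    qed
  qed
qed

lemma exterior_affine:
  assumes x: "x \<notin> closure \<Omega>"
  obtains d where "d > 0" "\<And>y. y \<in> ball x d \<Longrightarrow> patched y = plane (anchor x) y"
proof -
  obtain d where d: "d > 0" "ball x d \<subseteq> - closure \<Omega>"
    using openE[of "- closure \<Omega>" x] x by auto
  have sub: "ball x d \<subseteq> - \<Omega>" using d(2) closure_subset by blast
  have "patched y = plane (anchor x) y" if y: "y \<in> ball x d" for y
  proof -
    have "connected_component (- \<Omega>) x y"
      unfolding connected_component_def using sub y d(1) by (intro exI[of _ "ball x d"]) auto
    then have "island x = island y" by (rule connected_component_eq[symmetric, OF CollectI]) 
    moreover have "y \<notin> \<Omega>" using sub y by blast
    ultimately show ?thesis by (simp add: patched_def anchor_def)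
  qed
  then show thesis using that d(1) by blast
qed

text \<open>Subtracting the plane at \<open>p\<close> leaves second differences unchanged, and it
  makes the function zero on the outer component near \<open>p\<close>.\<close>

definition excess :: "'a \<Rightarrow> real" where "excess y = patched y - plane p y"

lemma excess_continuous: "continuous_on ({x. x \<bullet> e = 0} \<inter> ball p \<delta>) excess"
  unfolding continuous_on_eq_continuous_within
proof
  fix x assume x: "x \<in> {x. x \<bullet> e = 0} \<inter> ball p \<delta>"
  have pl: "isCont (plane z) x" for z unfolding plane_def[abs_def] divide_inverse by (intro continuous_intros)
  have "continuous (at x within {x. x \<bullet> e = 0} \<inter> ball p \<delta>) patched"
  proof -
    consider "x \<in> \<Omega>" | "x \<notin> closure \<Omega>" | "x \<in> closure \<Omega>" "x \<notin> \<Omega>" by blast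
    then show ?thesis
    proof cases
      case 1
      then obtain d where d: "d > 0" "ball x d \<subseteq> \<Omega>" using openE[OF \<Omega>(1)] by blast
      have "x \<in> U" using 1 \<Omega>U by blast
      then have "isCont height x" using height_derivative has_derivative_continuous by blast
      then have "continuous (at x within {x. x \<bullet> e = 0} \<inter> ball p \<delta>) height" by (rule continuous_at_imp_continuous_at_within)
      then show ?thesis
        by (rule continuous_transform_within[OF _ d(1) x]) (simp add: patched_def subsetD[OF d(2)] dist_commute)
    next
      case 2
      obtain d where d: "d > 0" "\<And>y. y \<in> ball x d \<Longrightarrow> patched y = plane (anchor x) y"
        using exterior_affine[OF 2] by blast
      have "continuous (at x within {x. x \<bullet> e = 0} \<inter> ball p \<delta>) (plane (anchor x))"
        by (rule continuous_at_imp_continuous_at_within[OF pl])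
      then show ?thesis
        by (rule continuous_transform_within[OF _ d(1) x]) (use d(2) in \<open>auto simp: dist_commute\<close>)
    next
      case 3
      have xe: "x \<bullet> e = 0" "x \<in> ball p \<delta>" using x by auto
      obtain d where d: "d > 0" "\<And>y. y \<in> ball x d \<Longrightarrow> y \<bullet> e = 0 \<Longrightarrow> \<bar>patched y - plane x y\<bar> \<le> 2 * 1 * (norm (y - x))\<^sup>2"
        using patched_estimate[OF xe(2) 3 xe(1) zero_less_one] by blast
      have px: "patched x = plane x x" using d(2)[of x] d(1) xe(1) by simp
      have l0: "((\<lambda>y. patched y - plane x y) \<longlongrightarrow> 0) (at x within {x. x \<bullet> e = 0} \<inter> ball p \<delta>)"
      proof (rule Lim_null_comparison)
        show "\<forall>\<^sub>F y in at x within {x. x \<bullet> e = 0} \<inter> ball p \<delta>. norm (patched y - plane x y) \<le> 2 * 1 * (norm (y - x))\<^sup>2"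
          unfolding eventually_at using d by (intro exI[of _ d]) (auto simp: dist_commute)
        have "((\<lambda>y. 2 * 1 * (norm (y - x))\<^sup>2) \<longlongrightarrow> 2 * 1 * (norm (x - x))\<^sup>2) (at x within {x. x \<bullet> e = 0} \<inter> ball p \<delta>)"
          by (intro tendsto_intros)
        then show "((\<lambda>y. 2 * 1 * (norm (y - x))\<^sup>2) \<longlongrightarrow> 0) (at x within {x. x \<bullet> e = 0} \<inter> ball p \<delta>)" by simp
      qed
      have "(plane x \<longlongrightarrow> plane x x) (at x within {x. x \<bullet> e = 0} \<inter> ball p \<delta>)"
        using continuous_at_imp_continuous_at_within[OF pl] unfolding continuous_within .
      from tendsto_add[OF l0 this] show ?thesis unfolding continuous_within px by simp
    qed
  qed
  then show "continuous (at x within {x. x \<bullet> e = 0} \<inter> ball p \<delta>) excess"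
    unfolding excess_def[abs_def] by (intro continuous_diff continuous_at_imp_continuous_at_within[OF pl])
qed

lemma excess_interior:
  assumes x: "x \<in> \<Omega>" and Q: "(slope has_derivative Q) (at x)"
  shows "second_difference excess x h (Q h \<bullet> h)"
proof (rule second_difference_cong)
  define b where "b = inverse (\<nu> (\<sigma> p) \<bullet> e) *\<^sub>R \<nu> (\<sigma> p)"
  have pd: "(plane p has_derivative (\<lambda>v. - (b \<bullet> v))) (at y)" for y
  proof -
    have "((\<lambda>y. (\<nu> (\<sigma> p) \<bullet> \<sigma> p) / (\<nu> (\<sigma> p) \<bullet> e) - b \<bullet> y) has_derivative (\<lambda>v. 0 - b \<bullet> v)) (at y)"
      by (intro has_derivative_diff has_derivative_const bounded_linear_imp_has_derivative bounded_linear_inner_right)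
    moreover have "plane p = (\<lambda>y. (\<nu> (\<sigma> p) \<bullet> \<sigma> p) / (\<nu> (\<sigma> p) \<bullet> e) - b \<bullet> y)"
      by (simp add: fun_eq_iff plane_def b_def diff_divide_distrib) (simp add: divide_inverse mult.commute)
    ultimately show ?thesis by simp
  qed
  show "second_difference (\<lambda>y. height y - plane p y) x h (Q h \<bullet> h)"
  proof (rule second_difference_gradient[OF \<Omega>(1) x])
    show "((\<lambda>y. height y - plane p y) has_derivative (\<lambda>v. (slope y + b) \<bullet> v)) (at y)" if "y \<in> \<Omega>" for y
      using has_derivative_diff[OF height_derivative pd, of y] that \<Omega>U by (auto simp: inner_add_left)
    show "((\<lambda>y. slope y + b) has_derivative Q) (at x)"
      using has_derivative_add[OF Q has_derivative_const[of b]] by simp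
  qed
  show "\<forall>\<^sub>F t in nhds 0. height (x + t *\<^sub>R h) - plane p (x + t *\<^sub>R h) = excess (x + t *\<^sub>R h)"
    using eventually_line[OF \<Omega>(1) x, of h] by eventually_elim (simp add: excess_def patched_def)
qed

lemma excess_exterior:
  assumes x: "x \<notin> closure \<Omega>"
  shows "second_difference excess x h 0"
proof -
  obtain d where d: "d > 0" "\<And>y. y \<in> ball x d \<Longrightarrow> patched y = plane (anchor x) y"
    using exterior_affine[OF x] by blast
  have "\<forall>\<^sub>F t in nhds 0. x + t *\<^sub>R h \<in> ball x d" by (rule eventually_line) (use d(1) in auto)
  then have "\<forall>\<^sub>F t in nhds 0. excess (x + t *\<^sub>R h) = (plane (anchor x) x - plane p x) +
      t * (- (\<nu> (\<sigma> (anchor x)) \<bullet> h) / (\<nu> (\<sigma> (anchor x)) \<bullet> e) - - (\<nu> (\<sigma> p) \<bullet> h) / (\<nu> (\<sigma> p) \<bullet> e))"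
  proof eventually_elim
    case (elim t)
    show ?case unfolding excess_def d(2)[OF elim] plane_line by (simp add: right_diff_distrib)
  qed
  then show ?thesis by (rule second_difference_affine)
qed

text \<open>Relative to its own tangent plane at \<open>x\<close> the patched height is of smaller
  than second order, and affine functions have no second differences. No shape of the frontier is
  involved.\<close>

lemma excess_frontier:
  assumes x: "x \<in> ball p \<delta>" "x \<in> closure \<Omega>" "x \<notin> \<Omega>" "x \<bullet> e = 0" and h: "h \<bullet> e = 0"
  shows "second_difference excess x h 0"
  unfolding second_difference_def
proof (rule tendstoI)
  fix r :: real assume r: "r > 0"
  \<comment> \<open>The two values of \<open>g\<close> contribute
    \<open>4 * \<epsilon> * (norm h)\<^sup>2\<close>, which becomes at most \<open>r / 2\<close>;
    adding 1 covers \<open>h = 0\<close>.\<close>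
  define \<epsilon> where "\<epsilon> = r / (8 * ((norm h)\<^sup>2 + 1))"
  have hp: "(norm h)\<^sup>2 + 1 > 0" by (simp add: add_nonneg_pos)
  have \<epsilon>: "\<epsilon> > 0" using r hp by (simp add: \<epsilon>_def)
  obtain d where d: "d > 0" "\<And>y. y \<in> ball x d \<Longrightarrow> y \<bullet> e = 0 \<Longrightarrow> \<bar>patched y - plane x y\<bar> \<le> 2 * \<epsilon> * (norm (y - x))\<^sup>2"
    using patched_estimate[OF x \<epsilon>] by blast
  obtain d' where d': "d' > 0" "\<And>t. \<bar>t\<bar> < d' \<Longrightarrow> x + t *\<^sub>R h \<in> ball x d"
    using eventually_line[OF open_ball, of x x d h] d(1) unfolding eventually_nhds_metric by (auto simp: dist_real_def)
  define g where "g y = patched y - plane x y" for y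
  have g: "\<bar>g (x + t *\<^sub>R h)\<bar> \<le> 2 * \<epsilon> * (t\<^sup>2 * (norm h)\<^sup>2)" if "\<bar>t\<bar> < d'" for t
    using d(2)[OF d'(2)[OF that]] x(4) h by (simp add: g_def inner_add_left power_mult_distrib)
  have g0: "g x = 0" using d(2)[of x] d(1) x(4) by (simp add: g_def)
  have num: "excess (x + t *\<^sub>R h) + excess (x - t *\<^sub>R h) - 2 * excess x = g (x + t *\<^sub>R h) + g (x - t *\<^sub>R h)" for t
  proof -
    have l: "plane z (x + t *\<^sub>R h) + plane z (x - t *\<^sub>R h) = 2 * plane z x" for z
      using plane_line[of z x t h] plane_line[of z x "- t" h] by simp
    have px: "patched x = plane x x" using g0 by (simp add: g_def)
    have aux: "(u - a) + (v - b) - 2 * (w - c) = (u - a') + (v - b')"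
      if "w = c'" "a' + b' = 2 * c'" "a + b = 2 * c" for u v w a b c a' b' c' :: real
      using that by argo
    show ?thesis unfolding excess_def g_def by (rule aux[OF px l l])
  qed
  show "\<forall>\<^sub>F t in at 0. dist ((excess (x + t *\<^sub>R h) + excess (x - t *\<^sub>R h) - 2 * excess x) / t\<^sup>2) 0 < r"
    unfolding eventually_at
  proof (intro exI[of _ d'] conjI ballI impI d'(1))
    fix t :: real assume "t \<noteq> 0 \<and> dist t 0 < d'"
    then have t: "t \<noteq> 0" "\<bar>t\<bar> < d'" by (auto simp: dist_real_def)
    have "\<bar>g (x + t *\<^sub>R h) + g (x - t *\<^sub>R h)\<bar> \<le> \<bar>g (x + t *\<^sub>R h)\<bar> + \<bar>g (x - t *\<^sub>R h)\<bar>" by (rule abs_triangle_ineq)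
    also have "\<dots> \<le> 2 * \<epsilon> * (t\<^sup>2 * (norm h)\<^sup>2) + 2 * \<epsilon> * (t\<^sup>2 * (norm h)\<^sup>2)"
      using g[OF t(2)] g[of "- t"] t(2) by (intro add_mono) simp_all
    also have "\<dots> = 4 * \<epsilon> * (norm h)\<^sup>2 * t\<^sup>2" by simp
    finally have "\<bar>g (x + t *\<^sub>R h) + g (x - t *\<^sub>R h)\<bar> / t\<^sup>2 \<le> 4 * \<epsilon> * (norm h)\<^sup>2" using t(1) by (simp add: divide_le_eq)
    also have "\<dots> \<le> 4 * \<epsilon> * ((norm h)\<^sup>2 + 1)" using \<epsilon> by simp
    also have "\<dots> = r / 2"
    proof -
      have "4 * (r / (8 * w)) * w = r / 2" if "w > 0" for w :: real using that by simp
      from this[OF hp] show ?thesis unfolding \<epsilon>_def .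
    qed
    also have "\<dots> < r" using r by simp
    finally show "dist ((excess (x + t *\<^sub>R h) + excess (x - t *\<^sub>R h) - 2 * excess x) / t\<^sup>2) 0 < r"
      unfolding num by (simp add: dist_real_def abs_divide)
  qed
qed

end

lemma no_face: False
proof -
  obtain p where p: "p \<bullet> e = 0" "p \<in> K" "p \<in> frontier Y" "p \<in> closure \<Omega>"
    and out: "\<And>x. x \<bullet> e = 0 \<Longrightarrow> norm p \<le> norm x \<Longrightarrow> x \<in> Y"
    by (rule exposed_point) blast
  obtain \<delta> where \<delta>: "\<delta> > 0" "ball p \<delta> \<subseteq> U0" using openE[OF U0(1)] p(2) K(2) by blast
  define hess where "hess x = (SOME Q. (slope has_derivative Q) (at x))" for x
  \<comment> \<open>The second differences of the excess: the Hessian of the height on the face,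
    zero on its frontier and outside, as the three local computations show.\<close>
  define q where "q x h = (if x \<in> \<Omega> then hess x h \<bullet> h else 0)" for x h
  have hs: "(slope has_derivative hess x) (at x)" if "x \<in> \<Omega>" for x
  proof -
    have "x \<in> U" using that \<Omega>U by blast
    then have "\<exists>Q. (slope has_derivative Q) (at x)" using slope_quadratic[OF _ curv[OF that]] by metis
    then show ?thesis unfolding hess_def by (rule someI_ex)
  qed
  have hq: "(\<forall>a. \<exists>h. h \<noteq> 0 \<and> h \<bullet> a = 0 \<and> h \<bullet> e = 0 \<and> 0 \<le> hess x h \<bullet> h) \<and>
    (\<forall>\<alpha> \<beta> z. 0 \<le> \<alpha> \<longrightarrow> 0 \<le> \<beta> \<longrightarrow> z \<bullet> e = 0 \<longrightarrow> (\<forall>h. h \<bullet> e = 0 \<longrightarrow> hess x h \<bullet> h \<le> \<alpha> * (norm h)\<^sup>2 - \<beta> * (z \<bullet> h)\<^sup>2) \<longrightarrow> \<beta> * (norm z)\<^sup>2 \<le> 2 * real n * \<alpha>) \<and>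
    (\<exists>h. h \<bullet> e = 0 \<and> hess x h \<bullet> h \<noteq> 0)" if x: "x \<in> \<Omega>" for x
  proof -
    have xU: "x \<in> U" using x \<Omega>U by blast
    show ?thesis
    proof (rule slope_quadratic[OF xU curv[OF x]])
      fix Q assume Q: "(slope has_derivative Q) (at x)"
      have "Q = hess x" by (rule has_derivative_unique[OF Q hs[OF x]])
      moreover assume "\<forall>a. \<exists>h. h \<noteq> 0 \<and> h \<bullet> a = 0 \<and> h \<bullet> e = 0 \<and> 0 \<le> Q h \<bullet> h"
        "\<forall>\<alpha> \<beta> z. 0 \<le> \<alpha> \<longrightarrow> 0 \<le> \<beta> \<longrightarrow> z \<bullet> e = 0 \<longrightarrow> (\<forall>h. h \<bullet> e = 0 \<longrightarrow> Q h \<bullet> h \<le> \<alpha> * (norm h)\<^sup>2 - \<beta> * (z \<bullet> h)\<^sup>2) \<longrightarrow> \<beta> * (norm z)\<^sup>2 \<le> 2 * real n * \<alpha>"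
        "\<exists>h. h \<bullet> e = 0 \<and> Q h \<bullet> h \<noteq> 0"
      ultimately show ?thesis by (intro conjI) simp_all
    qed
  qed
  let ?f = "excess p"
  note cont = excess_continuous[OF p(1,4) \<delta>]
  have sd: "second_difference ?f x h (q x h)" if x: "x \<bullet> e = 0" "x \<in> ball p \<delta>" "h \<bullet> e = 0" for x h
  proof -
    consider "x \<in> \<Omega>" | "x \<notin> closure \<Omega>" | "x \<in> closure \<Omega>" "x \<notin> \<Omega>" by blast
    then show ?thesis
    proof cases
      case 1
      then show ?thesis using excess_interior[OF p(1,4) \<delta> 1 hs[OF 1], of h] by (simp add: q_def)
    next
      case 2
      then have "x \<notin> \<Omega>" using closure_subset by blast
      then show ?thesis using excess_exterior[OF p(1,4) \<delta> 2, of h] by (simp add: q_def)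
    next
      case 3
      then show ?thesis using excess_frontier[OF p(1,4) \<delta> x(2) 3 x(1,3)] by (simp add: q_def)
    qed
  qed
  have two: "\<exists>h. h \<noteq> 0 \<and> h \<bullet> a = 0 \<and> h \<bullet> e = 0 \<and> 0 \<le> q x h" for x a
  proof (cases "x \<in> \<Omega>")
    case True
    then show ?thesis using hq[OF True] by (simp add: q_def)
  next
    case False
    \<comment> \<open>Off the face \<open>q\<close> is zero, so any nonzero vector orthogonal to
      \<open>a\<close> and \<open>e\<close> will do; it exists since the ambient dimension is at
      least 3.\<close>
    have "dim {a, e} \<le> card {a, e}" by (rule dim_le_card') simp
    also have "\<dots> < DIM('a)" using dim n2 card_insert_le_m1[of 2 "{e}" a] by (simp add: card_insert_if)
    finally have "dim {a, e} < DIM('a)" .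
    from lowdim_subset_hyperplane[OF this] obtain h where h: "h \<noteq> 0" "span {a, e} \<subseteq> {x. h \<bullet> x = 0}" by blast
    then have "h \<bullet> a = 0" "h \<bullet> e = 0" using span_base[of a "{a, e}"] span_base[of e "{a, e}"] by auto
    then show ?thesis using h(1) False by (intro exI[of _ h]) (simp add: q_def)
  qed
  have tr: "\<beta> * (norm z)\<^sup>2 \<le> 2 * real n * \<alpha>"
    if "0 \<le> \<alpha>" "0 \<le> \<beta>" "z \<bullet> e = 0" "\<And>h. h \<bullet> e = 0 \<Longrightarrow> q x h \<le> \<alpha> * (norm h)\<^sup>2 - \<beta> * (z \<bullet> h)\<^sup>2" for x \<alpha> \<beta> z
  proof (cases "x \<in> \<Omega>")
    case True
    then show ?thesis using hq[OF True] that by (simp add: q_def)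
  next
    case False
    show ?thesis
    proof (cases "z = 0")
      case True then show ?thesis using that(1) by simp
    next
      case nz: False
      \<comment> \<open>Off the face the trace bound follows by testing the vanishing
        \<open>q\<close> with \<open>h = z\<close>.\<close>
      have "0 \<le> \<alpha> * (norm z)\<^sup>2 - \<beta> * (z \<bullet> z)\<^sup>2" using that(4)[OF that(3)] False by (simp add: q_def)
      then have "(norm z)\<^sup>2 * (\<beta> * (norm z)\<^sup>2) \<le> (norm z)\<^sup>2 * \<alpha>"
        by (simp add: power2_norm_eq_inner[symmetric] power2_eq_square mult.commute mult.left_commute)
      then have "\<beta> * (norm z)\<^sup>2 \<le> \<alpha>" using nz by simp
      also have "\<alpha> \<le> 2 * real n * \<alpha>" using that(1) n2 mult_right_mono[of 1 "2 * real n" \<alpha>] by simp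
      finally show ?thesis .
    qed
  qed
  have pO: "p \<notin> \<Omega>" using out[OF p(1)] in_components_subset[OF Y(1)] by blast
  have island_far: "island x = Y" if "x \<in> Y" for x
    using that Y(1) by (metis connected_component_eq components_iff)
  have out0: "?f x = 0" if x: "x \<bullet> e = 0" "x \<in> ball p \<delta>" "norm p \<le> norm x" for x
  proof -
    have xY: "x \<in> Y" by (rule out[OF x(1,3)])
    then have xO: "x \<notin> \<Omega>" using in_components_subset[OF Y(1)] by blast
    have "p \<in> Y" by (rule out[OF p(1)]) simp
    \<comment> \<open>The island of \<open>x\<close> is the whole outer component, whose tangent
      plane along the frontier is the one at \<open>p\<close>; so the excess vanishes there.\<close>
    then have pi: "p \<in> island x" unfolding island_far[OF xY] .
    have "p \<in> ball p \<delta>" using \<delta>(1) by simp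
    from frontier_point(2)[OF p(1,4) \<delta> this p(4) pO pi xO x(2)]
    have "plane (anchor x) = plane p" .
    then show ?thesis using xO by (simp add: excess_def[OF p(1,4) \<delta>] patched_def)
  qed
  obtain \<rho> where \<rho>: "\<rho> > 0" "\<rho> \<le> \<delta>" "\<forall>x\<in>ball p \<rho>. x \<bullet> e = 0 \<longrightarrow> ?f x \<le> 0"
    using nonpositive_near_exposed_point[OF p(1) \<delta>(1) cont sd two out0] by blast
  have sub: "x \<in> ball p \<delta>" if "x \<in> ball p \<rho>" for x using that \<rho>(2) by simp
  have f0: "?f x = 0" if x: "x \<bullet> e = 0" "x \<in> ball p (\<rho> / 2)" for x
  proof (rule strong_maximum_principle[OF p(1) _ \<rho>(1), of _ "real n" q])
    show "?f p = 0" by (rule out0[OF p(1)]) (use \<delta>(1) in auto)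
    show "1 \<le> real n" using n2 by simp
    show "continuous_on ({x. x \<bullet> e = 0} \<inter> ball p \<rho>) ?f" by (rule continuous_on_subset[OF cont]) (use sub in blast)
    show "second_difference ?f x h (q x h)" if "x \<bullet> e = 0" "x \<in> ball p \<rho>" "h \<bullet> e = 0" for x h
      using sd that sub by blast
    show "\<beta> * (norm z)\<^sup>2 \<le> 2 * real n * \<alpha>"
      if "0 \<le> \<alpha>" "0 \<le> \<beta>" "z \<bullet> e = 0" "\<And>h. h \<bullet> e = 0 \<Longrightarrow> q x h \<le> \<alpha> * (norm h)\<^sup>2 - \<beta> * (z \<bullet> h)\<^sup>2" for x \<alpha> \<beta> z
      by (rule tr[OF that])
    show "?f x \<le> 0" if "x \<bullet> e = 0" "x \<in> ball p \<rho>" for x using \<rho>(3) that by blast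
  qed (rule x)+
  have "ball p (\<rho> / 2) \<inter> \<Omega> \<noteq> {}"
  proof
    assume "ball p (\<rho> / 2) \<inter> \<Omega> = {}"
    then have "ball p (\<rho> / 2) \<inter> closure \<Omega> = {}" by (simp add: open_Int_closure_eq_empty)
    then show False using p(4) \<rho>(1) by (metis IntI centre_in_ball empty_iff half_gt_zero)
  qed
  then obtain w where w: "w \<in> ball p (\<rho> / 2)" "w \<in> \<Omega>" by blast
  \<comment> \<open>The maximum principles speak about the hyperplane only. As \<Omega> is a
    cylinder, its point \<open>w\<close> may be projected there without leaving \<Omega> or the
    ball.\<close>
  define x where "x = eproj e w"
  have xe: "x \<bullet> e = 0" unfolding x_def by (rule eproj_inner[OF e])
  have xO: "x \<in> \<Omega>" by (rule cyl[OF w(2)]) (simp add: x_def eproj_id[OF e eproj_inner[OF e]])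
  have "dist p x = norm (eproj e (p - w))" by (simp add: x_def eproj_diff eproj_id[OF e p(1)] dist_norm)
  also have "\<dots> \<le> dist p w" unfolding dist_norm by (rule norm_eproj_le[OF e])
  finally have xb: "x \<in> ball p (\<rho> / 2)" using w(1) by simp
  then have xd: "x \<in> ball p \<delta>" using \<rho> by simp
  obtain h where h: "h \<bullet> e = 0" "hess x h \<bullet> h \<noteq> 0" using hq[OF xO] by blast
  have "\<forall>\<^sub>F t in nhds 0. x + t *\<^sub>R h \<in> ball p (\<rho> / 2)" by (rule eventually_line[OF open_ball xb])
  then have "\<forall>\<^sub>F t in nhds 0. ?f (x + t *\<^sub>R h) = 0 + t * 0"
    by eventually_elim (use f0 xe h(1) in \<open>simp add: inner_add_left\<close>)
  then have "second_difference ?f x h 0" by (rule second_difference_affine)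
  moreover have "second_difference ?f x h (hess x h \<bullet> h)" using sd[OF xe xd h(1)] xO by (simp add: q_def)
  ultimately have "hess x h \<bullet> h = 0"
    unfolding second_difference_def using tendsto_unique[OF trivial_limit_at] by blast
  then show False using h(2) by simp
qed

end

section \<open>The sign near a component of the flat set\<close>

lemma connected_sign:
  fixes g :: "'a::topological_space \<Rightarrow> real"
  assumes "connected S" "continuous_on S g" "\<And>x. x \<in> S \<Longrightarrow> g x \<noteq> 0"
  shows "(\<forall>x\<in>S. g x > 0) \<or> (\<forall>x\<in>S. g x < 0)"
proof (rule ccontr)
  assume "\<not> ?thesis"
  then obtain a b where ab: "a \<in> S" "b \<in> S" "g a \<le> 0" "g b \<ge> 0" by (metis linorder_le_less_linear)
  have "connected (g ` S)" by (rule connected_continuous_image[OF assms(2,1)])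
  from connectedD_interval[OF this imageI[OF ab(1)] imageI[OF ab(2)] ab(3,4)]
  obtain x where "x \<in> S" "0 = g x" by blast
  then show False using assms(3)[of x] by simp
qed

lemma cylinder_component:
  fixes e :: "'a::euclidean_space"
  assumes S: "\<And>y y'. y \<in> S \<Longrightarrow> eproj e y = eproj e y' \<Longrightarrow> y' \<in> S" and C: "C \<in> components S"
    and y: "y \<in> C" "eproj e y = eproj e y'"
  shows "y' \<in> C"
proof -
  have yS: "y \<in> S" using in_components_subset[OF C] y(1) by blast
  have "closed_segment y y' \<subseteq> S"
  proof
    fix z assume "z \<in> closed_segment y y'"
    then obtain t where "z = (1 - t) *\<^sub>R y + t *\<^sub>R y'" by (auto simp: in_segment)
    then have "eproj e z = (1 - t) *\<^sub>R eproj e y + t *\<^sub>R eproj e y'"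
      by (simp only: linear_add[OF eproj_linear] linear_scale[OF eproj_linear])
    also have "\<dots> = eproj e y" unfolding y(2)[symmetric] by (simp flip: scaleR_add_left)
    finally show "z \<in> S" using S[OF yS] by simp
  qed
  then have "closed_segment y y' \<subseteq> C"
    using components_maximal[OF C connected_segment(1)] y(1) by (metis disjoint_iff ends_in_segment(1))
  then show ?thesis by blast
qed

lemma component_subset_clopen:
  fixes S :: "'a::topological_space set"
  assumes "connected C" "C \<subseteq> S" "openin (top_of_set S) Z" "closed Z" "C \<inter> Z \<noteq> {}"
  shows "C \<subseteq> Z"
proof -
  obtain O1 where O1: "open O1" "Z = S \<inter> O1" using assms(3) by (auto simp: openin_open)
  have "openin (top_of_set C) (C \<inter> Z)"
    unfolding openin_open using O1 assms(2) by (intro exI[of _ O1]) blast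
  moreover have "closedin (top_of_set C) (C \<inter> Z)"
    unfolding closedin_closed using assms(4) by (intro exI[of _ Z]) simp
  ultimately have "C \<inter> Z = C" using assms(1,5) unfolding connected_clopen by blast
  then show ?thesis by blast
qed

context oriented_hypersurface
begin

text \<open>The factor \<open>c\<close> has to be constant near \<open>p\<close> only and is forced
  to be a sign. This covers both the global change of orientation and a change on single
  components.\<close>

lemma curvature_rescale:
  assumes \<nu>': "unit_normal_field M \<nu>'" and p: "p \<in> M" and T: "open T" "p \<in> T" "\<And>x. x \<in> M \<inter> T \<Longrightarrow> \<nu>' x = c *\<^sub>R \<nu> x"
  shows "mean_curvature M \<nu>' p = c * mean_curvature M \<nu> p" "scalar_curvature M \<nu>' p = scalar_curvature M \<nu> p"
proof -
  interpret h: oriented_hypersurface M \<nu>' n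
    by unfold_locales (rule n2 dim emb \<nu>')+
  obtain D where D: "(\<nu> has_derivative D) (at p within M)" "\<And>h. D h \<bullet> \<nu> p = 0"
    using normal_differentiable[OF p] by blast
  have "((\<lambda>x. c *\<^sub>R \<nu> x) has_derivative (\<lambda>h. c *\<^sub>R D h)) (at p within M)"
    by (rule has_derivative_scaleR_right[OF D(1)])
  then have D': "(\<nu>' has_derivative (\<lambda>h. c *\<^sub>R D h)) (at p within M)"
  proof (rule has_derivative_transform_eventually)
    show "\<forall>\<^sub>F x in at p within M. c *\<^sub>R \<nu> x = \<nu>' x"
      unfolding eventually_at_topological using T by (intro exI[of _ T]) auto
  qed (use p T in auto)
  have "\<bar>c\<bar> = 1" using h.norm_normal[OF p] norm_normal[OF p] T(2) T(3)[of p] p by simp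
  then have c2: "c\<^sup>2 = 1" using power2_abs[of c] by simp
  show 1: "mean_curvature M \<nu>' p = c * mean_curvature M \<nu> p"
    unfolding h.curvature_shape(1)[OF p D'] curvature_shape(1)[OF p D(1)] by (simp add: sum_distrib_left)
  show "scalar_curvature M \<nu>' p = scalar_curvature M \<nu> p"
    unfolding h.curvature_shape(2)[OF p D'] curvature_shape(2)[OF p D(1)] 1
    by (simp add: power_mult_distrib c2)
qed

lemma flip_normal: "unit_normal_field M (\<lambda>x. - \<nu> x)"
  using normal unfolding unit_normal_field_def by (auto intro: continuous_intros)

lemma hyperplane_unit_orthogonal:
  assumes e: "norm e = 1"
  obtains h :: 'a where "norm h = 1" "h \<bullet> e = 0" "h \<bullet> a = 0"
proof -
  have "dim {a, e} \<le> card {a, e}" by (rule dim_le_card') simp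
  also have "\<dots> < DIM('a)" using dim n2 by (simp add: card_insert_if)
  finally have "dim {a, e} < DIM('a)" .
  from lowdim_subset_hyperplane[OF this] obtain h where h: "h \<noteq> 0" "span {a, e} \<subseteq> {x. h \<bullet> x = 0}" by blast
  then have "h \<bullet> a = 0" "h \<bullet> e = 0" using span_base[of a "{a, e}"] span_base[of e "{a, e}"] by auto
  then show thesis using that[of "h /\<^sub>R norm h"] h(1) by simp
qed

text \<open>The set is a union of half-spaces \<open>R \<le> h \<bullet> y\<close> over unit vectors
  \<open>h\<close> orthogonal to \<open>e\<close>. Two of them meet unless their normals are
  opposite, and opposite ones are linked through a third one with orthogonal normal, for which
  \<open>n \<ge> 2\<close> leaves room.\<close>

lemma connected_exterior_cylinder:
  assumes e: "norm e = 1" and R: "R > 0"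
  shows "connected {y::'a. R \<le> norm (eproj e y)}"
proof -
  define F where "F = {y::'a. R \<le> norm (eproj e y)}"
  define W where "W h = {y::'a. h \<bullet> y \<ge> R}" for h
  have hy: "h \<bullet> y = h \<bullet> eproj e y" if "h \<bullet> e = 0" for h y :: 'a
    using that by (simp add: eproj_def inner_diff_right)
  have WF: "W h \<subseteq> F" if "norm h = 1" "h \<bullet> e = 0" for h
  proof
    fix y assume "y \<in> W h"
    then have "R \<le> h \<bullet> eproj e y" using hy[OF that(2), of y] by (simp add: W_def)
    also have "\<dots> \<le> norm (eproj e y)" using norm_cauchy_schwarz[of h "eproj e y"] that(1) by simp
    finally show "y \<in> F" by (simp add: F_def)
  qed
  have conv: "connected (W h)" for h unfolding W_def by (intro convex_connected convex_halfspace_ge)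
  have link: "connected_component F a b"
    if h: "norm h = 1" "h \<bullet> e = 0" and h': "norm h' = 1" "h' \<bullet> e = 0" and ne: "h \<bullet> h' \<noteq> - 1" and ab: "a \<in> W h" "b \<in> W h'" for h h' a b
  proof -
    have "\<bar>h \<bullet> h'\<bar> \<le> 1" using Cauchy_Schwarz_ineq2[of h h'] h(1) h'(1) by simp
    then have s: "1 + h \<bullet> h' > 0" using ne by linarith
    \<comment> \<open>The multiple of the bisector \<open>h + h'\<close> that lies on both boundary
      hyperplanes.\<close>
    define c where "c = (R / (1 + h \<bullet> h')) *\<^sub>R (h + h')"
    have hh: "h \<bullet> h = 1" "h' \<bullet> h' = 1" "h' \<bullet> h = h \<bullet> h'"
      using h(1) h'(1) by (simp_all only: norm_eq_1 inner_commute)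
    have "h \<bullet> c = (R / (1 + h \<bullet> h')) * (1 + h \<bullet> h')" "h' \<bullet> c = (R / (1 + h \<bullet> h')) * (1 + h \<bullet> h')"
      unfolding c_def inner_scaleR_right inner_add_right hh by (rule refl, simp only: add.commute)
    then have "h \<bullet> c = R" "h' \<bullet> c = R" using s by simp_all
    then have c: "c \<in> W h" "c \<in> W h'" by (auto simp: W_def)
    have "connected_component F a c"
      unfolding connected_component_def by (intro exI[of _ "W h"] conjI conv WF h ab c)
    moreover have "connected_component F c b"
      unfolding connected_component_def by (intro exI[of _ "W h'"] conjI conv WF h' ab c)
    ultimately show ?thesis by (rule connected_component_trans)
  qed
  have dir: "\<exists>h. norm h = 1 \<and> h \<bullet> e = 0 \<and> y \<in> W h" if "y \<in> F" for y
  proof -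
    have n: "norm (eproj e y) \<ge> R" using that by (simp add: F_def)
    define h where "h = eproj e y /\<^sub>R norm (eproj e y)"
    have he: "h \<bullet> e = 0" by (simp add: h_def eproj_inner[OF e])
    have "norm (eproj e y) > 0" using n R by linarith
    then have nz: "norm (eproj e y) \<noteq> 0" by simp
    have "h \<bullet> y = norm (eproj e y)"
    proof -
      have "h \<bullet> y = inverse (norm (eproj e y)) * (eproj e y \<bullet> eproj e y)" unfolding hy[OF he, of y] by (simp add: h_def)
      also have "\<dots> = inverse (norm (eproj e y)) * (norm (eproj e y) * norm (eproj e y))"
        by (simp only: dot_square_norm power2_eq_square)
      finally show ?thesis using nz by simp
    qed
    then show ?thesis using n nz he by (intro exI[of _ h]) (simp add: W_def h_def)
  qed
  have "connected_component F a b" if aF: "a \<in> F" and bF: "b \<in> F" for a b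
  proof -
    obtain h where h: "norm h = 1" "h \<bullet> e = 0" "a \<in> W h" using dir[OF aF] by (elim exE conjE)
    obtain h' where h': "norm h' = 1" "h' \<bullet> e = 0" "b \<in> W h'" using dir[OF bF] by (elim exE conjE)
    show ?thesis
    proof (cases "h \<bullet> h' = - 1")
      case False
      show ?thesis by (rule link[OF h(1,2) h'(1,2) False h(3) h'(3)])
    next
      case True
      obtain k where k: "norm k = 1" "k \<bullet> e = 0" "k \<bullet> h = 0" by (rule hyperplane_unit_orthogonal[OF e])
      have "h \<bullet> h = 1" "h' \<bullet> h' = 1" "h' \<bullet> h = - 1" using h(1) h'(1) True by (simp_all only: norm_eq_1 inner_commute)
      then have "(norm (h + h'))\<^sup>2 = 0"
        unfolding power2_norm_eq_inner inner_add_left inner_add_right True by simp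
      then have "h + h' = 0" by simp
      then have h'h: "h' = - h" by (simp add: eq_neg_iff_add_eq_0 add.commute)
      have Rk: "R *\<^sub>R k \<in> W k" using k(1) R by (simp add: W_def norm_eq_1)
      have "connected_component F a (R *\<^sub>R k)"
        by (rule link[OF h(1,2) k(1,2) _ h(3) Rk]) (use k(3) in \<open>simp add: inner_commute\<close>)
      moreover have "connected_component F (R *\<^sub>R k) b"
        by (rule link[OF k(1,2) h'(1,2) _ Rk h'(3)]) (use k(3) h'h in simp)
      ultimately show ?thesis by (rule connected_component_trans)
    qed
  qed
  then have "connected F" by (simp only: connected_iff_connected_component) simp
  then show ?thesis by (simp only: F_def)
qed

end

lemma (in nonneg_scalar_hypersurface) flip_nonneg:
  "nonneg_scalar_hypersurface M (\<lambda>x. - \<nu> x) n"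
  "p \<in> M \<Longrightarrow> mean_curvature M (\<lambda>x. - \<nu> x) p = - mean_curvature M \<nu> p"
  "nonneg_scalar_hypersurface.flat_points M (\<lambda>x. - \<nu> x) = flat_points"
proof -
  have r: "mean_curvature M (\<lambda>x. - \<nu> x) p = - mean_curvature M \<nu> p" "scalar_curvature M (\<lambda>x. - \<nu> x) p = scalar_curvature M \<nu> p"
    if "p \<in> M" for p
    using curvature_rescale[OF flip_normal that open_UNIV UNIV_I, of "- 1"] by auto
  show *: "nonneg_scalar_hypersurface M (\<lambda>x. - \<nu> x) n"
    by unfold_locales (use n2 dim emb flip_normal r(2) scal in auto)
  show "p \<in> M \<Longrightarrow> mean_curvature M (\<lambda>x. - \<nu> x) p = - mean_curvature M \<nu> p" by (rule r(1))
  show "nonneg_scalar_hypersurface.flat_points M (\<lambda>x. - \<nu> x) = flat_points"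
    unfolding nonneg_scalar_hypersurface.flat_points_def[OF *] flat_points_def using r(1) by auto
qed

section \<open>The flat set does not separate a cylinder\<close>

context graph_patch
begin

lemma flip_graph: "graph_patch M (\<lambda>x. - \<nu> x) n (- e) T"
proof -
  interpret f: nonneg_scalar_hypersurface M "\<lambda>x. - \<nu> x" n by (rule flip_nonneg(1))
  show ?thesis
    by unfold_locales (use e T inj pos steep in \<open>auto simp: eproj_uminus\<close>)
qed

lemma no_face_component:
  assumes U0: "open U0" "U0 \<subseteq> U" and U0c: "\<And>y y'. y \<in> U0 \<Longrightarrow> eproj e y = eproj e y' \<Longrightarrow> y' \<in> U0"
    and R: "\<And>y. y \<in> U0 \<Longrightarrow> norm (eproj e y) < R"
    and K: "closed K" "K = {y\<in>U0. \<sigma> y \<in> flat_points}"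
    and \<Omega>: "\<Omega> \<in> components (U0 - K)"
    and Y: "Y \<in> components (- \<Omega>)" "\<And>y. norm (eproj e y) \<ge> R \<Longrightarrow> y \<in> Y" "frontier Y \<subseteq> K"
  shows False
proof -
  have sub: "\<Omega> \<subseteq> U0 - K" by (rule in_components_subset[OF \<Omega>])
  have op: "open \<Omega>" by (rule open_components[OF open_Diff[OF U0(1) K(1)] \<Omega>])
  have con: "connected \<Omega>" "\<Omega> \<noteq> {}" by (rule in_components_connected[OF \<Omega>], rule in_components_nonempty[OF \<Omega>])
  have cyl: "y' \<in> \<Omega>" if "y \<in> \<Omega>" "eproj e y = eproj e y'" for y y'
  proof (rule cylinder_component[OF _ \<Omega> that])
    fix a b assume ab: "a \<in> U0 - K" "eproj e a = eproj e b"
    have "b \<in> U0" using U0c[OF _ ab(2)] ab(1) by blast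
    moreover have "\<sigma> b = \<sigma> a" using lift_cong[OF ab(2)] by simp
    ultimately show "b \<in> U0 - K" using ab(1) by (simp add: K(2))
  qed
  have fr: "frontier \<Omega> \<subseteq> K \<union> frontier U0"
  proof -
    have "frontier \<Omega> \<subseteq> frontier (U0 \<inter> - K)" using frontier_of_components_subset[OF \<Omega>] by (simp add: Diff_eq)
    also have "\<dots> \<subseteq> frontier U0 \<union> frontier (- K)" by (rule frontier_Int_subset)
    also have "\<dots> \<subseteq> K \<union> frontier U0" using frontier_subset_closed[OF K(1)] by auto
    finally show ?thesis .
  qed
  have KU0: "K \<subseteq> U0" "\<And>y. y \<in> K \<Longrightarrow> \<sigma> y \<in> flat_points" using K(2) by auto
  have \<Omega>U: "\<Omega> \<subseteq> U" using sub U0(2) by blast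
  have \<sigma>M: "\<sigma> ` \<Omega> \<subseteq> M" using lift(1) \<Omega>U by blast
  have "continuous_on \<Omega> (\<lambda>y. mean_curvature M \<nu> (\<sigma> y))"
    by (rule continuous_on_compose2[OF mean_curvature_continuous continuous_on_subset[OF continuous_lift \<Omega>U] \<sigma>M])
  moreover have "mean_curvature M \<nu> (\<sigma> y) \<noteq> 0" if "y \<in> \<Omega>" for y
  proof -
    have "y \<in> U0" "y \<notin> K" using sub that by blast+
    then have "\<sigma> y \<notin> flat_points" by (simp add: K(2))
    then show ?thesis using \<sigma>M that unfolding flat_points_def by blast
  qed
  ultimately consider "\<forall>y\<in>\<Omega>. mean_curvature M \<nu> (\<sigma> y) > 0" | "\<forall>y\<in>\<Omega>. mean_curvature M \<nu> (\<sigma> y) < 0"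
    using connected_sign[OF con(1)] by blast
  then show False
  proof cases
    case 1
    interpret graph_face M \<nu> n e T \<Omega> U0 K Y R
    proof (intro graph_face.intro graph_patch_axioms graph_face_axioms.intro)
      show "\<Omega> \<subseteq> U0" using sub by blast
      show "norm (eproj e y) < R" if "y \<in> \<Omega>" for y using R sub that by blast
      show "mean_curvature M \<nu> (\<sigma> y) > 0" if "y \<in> \<Omega>" for y using 1 that by blast
      show "y' \<in> \<Omega>" if "y \<in> \<Omega>" "eproj e y = eproj e y'" for y y' by (rule cyl[OF that])
      show "y \<in> Y" if "R \<le> norm (eproj e y)" for y by (rule Y(2)[OF that])
      show "\<sigma> y \<in> flat_points" if "y \<in> K" for y by (rule KU0(2)[OF that])
    qed (rule op con U0 K(1) KU0(1) fr Y(1,3))+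
    show False by (rule no_face)
  next
    case 2
    \<comment> \<open>Reversing \<nu> and \<open>e\<close> together keeps
      \<open>\<nu> \<bullet> e\<close> positive and changes neither the projection nor the lift,
      while the mean curvature becomes positive.\<close>
    interpret f: graph_patch M "\<lambda>x. - \<nu> x" n "- e" T by (rule flip_graph)
    have l: "graph_lift (M \<inter> T) (- e) = \<sigma>" "graph_domain (M \<inter> T) (- e) = U"
      by (simp_all add: graph_lift_def graph_domain_def fun_eq_iff)
    have H: "mean_curvature M (\<lambda>x. - \<nu> x) (\<sigma> y) > 0" if "y \<in> \<Omega>" for y
    proof -
      have "\<sigma> y \<in> M" using \<sigma>M that by blast
      then show ?thesis using flip_nonneg(2)[of "\<sigma> y"] 2 that by simp
    qed
    interpret f: graph_face M "\<lambda>x. - \<nu> x" n "- e" T \<Omega> U0 K Y R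
    proof (intro graph_face.intro flip_graph graph_face_axioms.intro)
      show "\<Omega> \<subseteq> U0" using sub by blast
      show "norm (eproj (- e) y) < R" if "y \<in> \<Omega>" for y unfolding eproj_uminus using R sub that by blast
      show "mean_curvature M (\<lambda>x. - \<nu> x) (graph_lift (M \<inter> T) (- e) y) > 0" if "y \<in> \<Omega>" for y
        unfolding l by (rule H[OF that])
      show "y' \<in> \<Omega>" if "y \<in> \<Omega>" "eproj (- e) y = eproj (- e) y'" for y y'
        using that unfolding eproj_uminus by (rule cyl)
      show "y \<in> Y" if "R \<le> norm (eproj (- e) y)" for y using that unfolding eproj_uminus by (rule Y(2))
      show "graph_lift (M \<inter> T) (- e) y \<in> f.flat_points" if "y \<in> K" for y
        unfolding l flip_nonneg(3) by (rule KU0(2)[OF that])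
      show "U0 \<subseteq> graph_domain (M \<inter> T) (- e)" unfolding l by (rule U0(2))
    qed (rule op con U0(1) K(1) KU0(1) fr Y(1,3))+
    show False by (rule f.no_face)
  qed
qed

text \<open>Of two distinct components \<open>A\<close> and \<open>B\<close>, neither lies in the
  outer complementary component of the other, because that component would have flat frontier and
  \<open>no_face_component\<close> would apply. So each lies in a hole of the other, which is
  incompatible with the connectedness of the exterior of a hole.\<close>

lemma connected_complement_flat:
  assumes U0: "open U0" "connected U0" "U0 \<subseteq> U" and U0c: "\<And>y y'. y \<in> U0 \<Longrightarrow> eproj e y = eproj e y' \<Longrightarrow> y' \<in> U0"
    and R: "\<And>y. y \<in> U0 \<Longrightarrow> norm (eproj e y) < R" and Rp: "R > 0"
    and K: "closed K" "K = {y\<in>U0. \<sigma> y \<in> flat_points}"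
  shows "connected (U0 - K)"
proof (rule ccontr)
  assume "\<not> connected (U0 - K)"
  then obtain x y where xy: "x \<in> U0 - K" "y \<in> U0 - K" "\<not> connected_component (U0 - K) x y"
    unfolding connected_iff_connected_component by blast
  define A B where "A = connected_component_set (U0 - K) x" and "B = connected_component_set (U0 - K) y"
  have AB: "A \<in> components (U0 - K)" "B \<in> components (U0 - K)" using xy by (auto simp: A_def B_def intro: componentsI)
  have mem: "x \<in> A" "y \<in> B" using xy by (auto simp: A_def B_def)
  have "A \<noteq> B"
  proof
    assume "A = B"
    then have "y \<in> A" using mem(2) by simp
    then show False using xy(3) by (simp add: A_def)
  qed
  then have dis: "A \<inter> B = {}" using components_nonoverlap[OF AB] by simp
  define Far where "Far = {z. R \<le> norm (eproj e z)}"
  have cF: "connected Far" unfolding Far_def by (rule connected_exterior_cylinder[OF e Rp])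
  obtain k where k: "norm k = 1" "k \<bullet> e = 0" "k \<bullet> e = 0" by (rule hyperplane_unit_orthogonal[OF e])
  have "R *\<^sub>R k \<in> Far" using k Rp eproj_id[OF e, of "R *\<^sub>R k"] by (simp add: Far_def)
  then have Fne: "Far \<noteq> {}" by blast
  have key: "\<exists>Y. Y \<in> components (- P) \<and> Q \<subseteq> Y \<and> Far \<inter> Y = {}"
    if P: "P \<in> components (U0 - K)" and Q: "Q \<in> components (U0 - K)" and d: "P \<inter> Q = {}" for P Q
  proof -
    have cQ: "connected Q" "Q \<noteq> {}" using in_components_connected[OF Q] in_components_nonempty[OF Q] by auto
    have cP: "connected P" "P \<noteq> {}" using in_components_connected[OF P] in_components_nonempty[OF P] by auto
    have sP: "P \<subseteq> U0 - K" "Q \<subseteq> U0 - K" using in_components_subset P Q by auto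
    have "Q \<subseteq> - P" using d by blast
    moreover from this have "- P \<noteq> {}" using cQ(2) by blast
    ultimately obtain Y where Y: "Y \<in> components (- P)" "Q \<subseteq> Y"
      using exists_component_superset[OF _ _ cQ(1)] by blast
    have YP: "Y \<subseteq> - P" by (rule in_components_subset[OF Y(1)])
    have fP: "frontier P \<subseteq> K \<union> frontier U0"
    proof -
      have "frontier P \<subseteq> frontier (U0 \<inter> - K)" using frontier_of_components_subset[OF P] by (simp add: Diff_eq)
      also have "\<dots> \<subseteq> frontier U0 \<union> frontier (- K)" by (rule frontier_Int_subset)
      also have "\<dots> \<subseteq> K \<union> frontier U0" using frontier_subset_closed[OF K(1)] by auto
      finally show ?thesis .
    qed
    have fY: "frontier Y \<subseteq> K \<union> frontier U0" using frontier_of_components_subset[OF Y(1)] fP by simp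
    have cY: "connected (frontier Y)" by (rule connected_frontier_component_complement[OF cP(1) Y(1)])
    have dU: "U0 \<inter> frontier U0 = {}" using frontier_disjoint_eq[of U0] U0(1) by blast
    have "U0 \<inter> frontier Y \<noteq> {}"
    proof (rule connected_Int_frontier[OF U0(2)])
      show "U0 \<inter> Y \<noteq> {}" using cQ(2) Y(2) sP(2) by blast
      show "U0 - Y \<noteq> {}" using cP(2) YP sP(1) by blast
    qed
    then have "frontier Y \<inter> K \<noteq> {}" using fY dU by blast
    moreover have "K \<inter> frontier U0 = {}" using dU K(2) by blast
    \<comment> \<open>\<open>U0\<close> is connected and meets both \<open>Q\<close>, inside
      \<open>Y\<close>, and \<open>P\<close>, outside \<open>Y\<close>; hence the connected frontier
      of \<open>Y\<close> enters \<open>U0\<close>, and it must stay in \<open>K\<close>.\<close>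
    then have "K \<inter> frontier Y = {} \<or> frontier U0 \<inter> frontier Y = {}"
      by (intro connected_closedD[OF cY _ fY K(1) frontier_closed]) blast
    ultimately have fK: "frontier Y \<subseteq> K" using fY by blast
    have "Far \<inter> Y = {}"
    proof (rule ccontr)
      assume ne: "Far \<inter> Y \<noteq> {}"
      have "Far \<subseteq> - P"
      proof
        fix z assume "z \<in> Far"
        then have "\<not> norm (eproj e z) < R" by (simp add: Far_def)
        then have "z \<notin> U0" using R by blast
        then show "z \<in> - P" using sP(1) by blast
      qed
      then have "Far \<subseteq> Y" using components_maximal[OF Y(1) cF] ne by blast
      then have far: "\<And>z. R \<le> norm (eproj e z) \<Longrightarrow> z \<in> Y" unfolding Far_def by blast
      show False by (rule no_face_component[OF U0(1,3) U0c R K P Y(1) far fK])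
    qed
    then show ?thesis using Y by blast
  qed
  obtain Y1 where Y1: "Y1 \<in> components (- A)" "B \<subseteq> Y1" "Far \<inter> Y1 = {}" using key[OF AB dis] by blast
  obtain Y2 where Y2: "Y2 \<in> components (- B)" "A \<subseteq> Y2" "Far \<inter> Y2 = {}" using key[OF AB(2,1)] dis by blast
  \<comment> \<open>The exterior of the hole \<open>Y2\<close> is connected, avoids \<open>A\<close>
    and contains \<open>B\<close>, so it lies in the hole \<open>Y1\<close>. Then \<open>Y1\<close>
    and \<open>Y2\<close> cover the space, though neither reaches \<open>Far\<close>.\<close>
  have "connected (- Y2)"
    by (rule component_complement_connected[OF in_components_connected[OF AB(2)] Y2(1)])
  moreover have "- Y2 \<subseteq> - A" using Y2(2) by blast
  moreover have "y \<in> - Y2" using in_components_subset[OF Y2(1)] mem(2) by blast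
  then have "Y1 \<inter> - Y2 \<noteq> {}" using Y1(2) mem(2) by blast
  ultimately have "- Y2 \<subseteq> Y1" using components_maximal[OF Y1(1)] by blast
  then show False using Y2(3) Y1(3) Fne by blast
qed

end

section \<open>Compact hypersurfaces: neighbourhoods of flat components\<close>

locale closed_nonneg_hypersurface = nonneg_scalar_hypersurface +
  assumes compact: "compact M"
begin

lemma flat_points_compact: "compact flat_points"
proof -
  have "flat_points = M \<inter> mean_curvature M \<nu> -` {0}" by (auto simp: flat_points_def)
  moreover have "closed (M \<inter> mean_curvature M \<nu> -` {0})"
    by (rule continuous_closed_preimage[OF mean_curvature_continuous compact_imp_closed[OF compact] closed_singleton])
  ultimately show ?thesis using compact compact_Int_closed[of M "M \<inter> mean_curvature M \<nu> -` {0}"] by (metis inf.left_idem)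
qed

text \<open>The component lies in one affine hyperplane orthogonal to its common normal, so the
  projection is injective on it. Compactness extends this to a neighbourhood: the pairs in
  \<open>bad\<close> stay at positive distance from \<open>C \<times> C\<close>, by separate
  projections off the diagonal and by \<open>vertical_difference\<close> on it.\<close>

lemma graph_over_flat_component:
  assumes C: "C \<in> components flat_points" and z: "z \<in> C"
  shows "\<exists>T. C \<subseteq> T \<and> graph_patch M \<nu> n (\<nu> z) T"
proof -
  define e where "e = \<nu> z"
  have Cf: "C \<subseteq> flat_points" "connected C" by (rule in_components_subset[OF C], rule in_components_connected[OF C])
  have CM: "C \<subseteq> M" using Cf(1) by (auto simp: flat_points_def)
  have e1: "norm e = 1" unfolding e_def using norm_normal z CM by blast
  have ne: "\<nu> x = e" "x \<bullet> e = z \<bullet> e" if "x \<in> C" for x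
    using tangent_plane_constant[OF Cf(2,1) that z] by (auto simp: e_def inner_commute)
  have Cc: "compact C" using compact_components[OF flat_points_compact C] .
  define bad where "bad = {p. fst p \<in> M \<and> snd p \<in> M \<and> fst p \<noteq> snd p \<and> eproj e (fst p) = eproj e (snd p)}"
  have sep: "(C \<times> C) \<inter> closure bad = {}"
  proof -
    have "(a, b) \<notin> closure bad" if a: "a \<in> C" and b: "b \<in> C" for a b
    proof -
      have "\<exists>N. open N \<and> (a, b) \<in> N \<and> N \<inter> bad = {}"
      proof (cases "a = b")
        case False
        have "eproj e a \<noteq> eproj e b"
        proof
          assume "eproj e a = eproj e b"
          then have "a = b + (a \<bullet> e - b \<bullet> e) *\<^sub>R e" by (rule eproj_eqD[OF e1])
          then show False using ne(2)[OF a] ne(2)[OF b] False by simp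
        qed
        moreover have "open {p. eproj e (fst p) \<noteq> eproj e (snd p)}"
          unfolding eproj_def by (intro open_Collect_neq continuous_intros)
        ultimately show ?thesis
          by (intro exI[of _ "{p. eproj e (fst p) \<noteq> eproj e (snd p)}"]) (auto simp: bad_def)
      next
        case True
        have aM: "a \<in> M" using a CM by blast
        have "\<nu> a \<bullet> e > 0" using ne(1)[OF a] e1 by (simp add: norm_eq_1)
        from vertical_difference[OF aM this] obtain V where V: "open V" "a \<in> V" "\<And>x t. x \<in> M \<inter> V \<Longrightarrow> x + t *\<^sub>R e \<in> M \<inter> V \<Longrightarrow> t = 0"
          by blast
        have "(V \<times> V) \<inter> bad = {}"
        proof (rule ccontr)
          assume "(V \<times> V) \<inter> bad \<noteq> {}"
          then obtain x y where xy: "x \<in> V" "y \<in> V" "x \<in> M" "y \<in> M" "x \<noteq> y" "eproj e x = eproj e y"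
            by (auto simp: bad_def)
          have eq: "x = y + (x \<bullet> e - y \<bullet> e) *\<^sub>R e" by (rule eproj_eqD[OF e1 xy(6)])
          then have "y + (x \<bullet> e - y \<bullet> e) *\<^sub>R e \<in> M \<inter> V" using xy by simp
          then have "x \<bullet> e - y \<bullet> e = 0" by (rule V(3)[rotated]) (use xy in blast)
          then show False using eq xy(5) by simp
        qed
        then show ?thesis using V True by (intro exI[of _ "V \<times> V"]) (auto intro: open_Times)
      qed
      then obtain N where N: "open N" "(a, b) \<in> N" "N \<inter> bad = {}" by blast
      have "N \<inter> closure bad = {}" using N(1,3) by (simp add: open_Int_closure_eq_empty)
      then show ?thesis using N(2) by blast
    qed
    then show ?thesis by auto
  qed
  obtain d where d: "d > 0" "\<And>p q. p \<in> C \<times> C \<Longrightarrow> q \<in> closure bad \<Longrightarrow> d \<le> dist p q"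
    using separate_compact_closed[OF compact_Times[OF Cc Cc] closed_closure sep] by blast
  have "continuous_on M (\<lambda>x. \<nu> x \<bullet> e)" by (intro continuous_intros normal_continuous)
  \<comment> \<open>The threshold \<open>3 / 4\<close> leaves its square above the required
    \<open>1 / 2\<close>.\<close>
  then have "openin (top_of_set M) (M \<inter> (\<lambda>x. \<nu> x \<bullet> e) -` {3/4<..})"
    by (rule continuous_openin_preimage_gen) simp
  then obtain T1 where T1: "open T1" "M \<inter> (\<lambda>x. \<nu> x \<bullet> e) -` {3/4<..} = M \<inter> T1" unfolding openin_open by blast
  define T where "T = T1 \<inter> (\<Union>c\<in>C. ball c (d / 2))"
  have "graph_patch M \<nu> n e T"
  proof unfold_locales
    show "norm e = 1" by (rule e1)
    show "open T" unfolding T_def using T1(1) by (intro open_Int open_UN) auto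
    show "inj_on (eproj e) (M \<inter> T)"
    proof (rule inj_onI, rule ccontr)
      fix x y assume xy: "x \<in> M \<inter> T" "y \<in> M \<inter> T" "eproj e x = eproj e y" "x \<noteq> y"
      then have "(x, y) \<in> bad" by (auto simp: bad_def)
      then have cl: "(x, y) \<in> closure bad" using closure_subset by blast
      obtain c c' where c: "c \<in> C" "c' \<in> C" "dist c x < d / 2" "dist c' y < d / 2" using xy by (auto simp: T_def)
      have "dist (c, c') (x, y) \<le> dist c x + dist c' y"
        unfolding dist_Pair_Pair by (rule sqrt_sum_squares_le_sum) auto
      also have "\<dots> < d" using c by simp
      finally show False using d(2)[OF _ cl, of "(c, c')"] c by simp
    qed
    have big: "\<nu> x \<bullet> e > 3 / 4" if "x \<in> M \<inter> T" for x using that T1(2) unfolding T_def by blast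
    show "\<nu> x \<bullet> e > 0" if "x \<in> M \<inter> T" for x using big[OF that] by simp
    show "1 / 2 \<le> (\<nu> x \<bullet> e)\<^sup>2" if "x \<in> M \<inter> T" for x
    proof -
      have "(3 / 4)\<^sup>2 \<le> (\<nu> x \<bullet> e)\<^sup>2" using big[OF that] by (intro power_mono) auto
      then show ?thesis by (simp add: power2_eq_square)
    qed
  qed
  moreover have "C \<subseteq> T"
  proof
    fix x assume x: "x \<in> C"
    have "\<nu> x \<bullet> e = 1" using ne(1)[OF x] e1 by (simp add: norm_eq_1)
    then have "x \<in> T1" using T1(2) x CM by auto
    then show "x \<in> T" using x d(1) by (auto simp: T_def intro!: bexI[of _ x])
  qed
  ultimately show ?thesis unfolding e_def by blast
qed

text \<open>Besides the sign, the neighbourhood contains the whole flat component of each of its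
  flat points. This saturation makes overlaps of neighbourhoods with different signs manageable
  later on.\<close>

lemma flat_component_sign:
  assumes C: "C \<in> components flat_points"
  shows "\<exists>T'. open T' \<and> C \<subseteq> T' \<and> (\<forall>y\<in>flat_points \<inter> T'. connected_component_set flat_points y \<subseteq> T') \<and>
    ((\<forall>m\<in>M \<inter> T'. 0 \<le> mean_curvature M \<nu> m) \<or> (\<forall>m\<in>M \<inter> T'. mean_curvature M \<nu> m \<le> 0))"
proof -
  obtain z where z: "z \<in> C" using in_components_nonempty[OF C] by blast
  obtain T where CT: "C \<subseteq> T" and gp: "graph_patch M \<nu> n (\<nu> z) T" using graph_over_flat_component[OF C z] by blast
  interpret g: graph_patch M \<nu> n "\<nu> z" T by (rule gp)
  define e where "e = \<nu> z"
  let ?\<sigma> = "graph_lift (M \<inter> T) e" and ?U = "graph_domain (M \<inter> T) e"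
  have Cc: "compact C" by (rule compact_components[OF flat_points_compact C])
  have lc: "locally compact flat_points"
    using flat_points_compact by (simp add: closed_imp_locally_compact compact_imp_closed)
  \<comment> \<open>\<open>C\<close> may be a limit of other flat components. The Sura-Bura theorem
    replaces it by a compact relatively open set of flat points that still lies over the
    patch.\<close>
  obtain Z1 where Z1: "openin (top_of_set flat_points) Z1" "compact Z1" "C \<subseteq> Z1" "Z1 \<subseteq> T"
    by (rule Sura_Bura_clopen_subset[OF lc C Cc g.T CT])
  obtain O1 where O1: "open O1" "Z1 = flat_points \<inter> O1" using Z1(1) by (auto simp: openin_open)
  define U1 where "U1 = ?U \<inter> ?\<sigma> -` O1"
  have U1: "open U1" unfolding U1_def e_def by (rule continuous_open_preimage[OF g.continuous_lift g.open_domain O1(1)])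
  have ZM: "Z1 \<subseteq> M \<inter> T" using O1(2) Z1(4) by (auto simp: flat_points_def)
  have ZU: "Z1 \<subseteq> U1"
  proof
    fix y assume y: "y \<in> Z1"
    then have "y \<in> M \<inter> T" using ZM by blast
    then show "y \<in> U1" using y O1(2) g.patch_subset g.lift_self[of y] by (auto simp: U1_def e_def)
  qed
  have U1c: "y' \<in> U1" if "y \<in> U1" "eproj e y = eproj e y'" for y y'
    using that g.domain_cong[of y y'] g.lift_cong[of y y'] by (auto simp: U1_def e_def)
  define U0 where "U0 = connected_component_set U1 z"
  have zU1: "z \<in> U1" using z Z1(3) ZU by blast
  have U0: "U0 \<in> components U1" unfolding U0_def by (rule componentsI[OF zU1])
  have U0o: "open U0" by (rule open_components[OF U1 U0])
  have U0s: "U0 \<subseteq> U1" by (rule in_components_subset[OF U0])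
  have U0c: "y' \<in> U0" if "y \<in> U0" "eproj e y = eproj e y'" for y y'
    by (rule cylinder_component[OF U1c U0 that])
  \<comment> \<open>The cylinder over the projection of the compact set \<open>Z1\<close>. It is
    closed in the whole space, which the topological arguments about complementary components
    require.\<close>
  define K1 where "K1 = eproj e -` (eproj e ` Z1)"
  have K1: "closed K1" unfolding K1_def
    by (intro closed_vimage compact_imp_closed compact_continuous_image eproj_continuous Z1(2))
  have K1e: "K1 = {y\<in>U1. ?\<sigma> y \<in> flat_points}"
  proof (intro set_eqI iffI)
    fix y assume "y \<in> K1"
    then obtain m where m: "m \<in> Z1" "eproj e y = eproj e m" by (auto simp: K1_def)
    have "?\<sigma> y = m" unfolding e_def by (rule g.lift_eq) (use m ZM in \<open>auto simp: e_def\<close>)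
    moreover have "y \<in> U1" using U1c[of m y] m ZU by auto
    ultimately show "y \<in> {y\<in>U1. ?\<sigma> y \<in> flat_points}" using m(1) O1(2) by simp
  next
    fix y assume y: "y \<in> {y\<in>U1. ?\<sigma> y \<in> flat_points}"
    then have "?\<sigma> y \<in> Z1" by (simp add: O1(2) U1_def)
    moreover have "eproj e (?\<sigma> y) = eproj e y" using y g.lift(2)[of y] by (simp add: U1_def e_def)
    ultimately show "y \<in> K1" unfolding K1_def by (metis imageI vimageI2)
  qed
  define K where "K = {y\<in>U0. ?\<sigma> y \<in> flat_points}"
  have Kc: "closed K"
  proof -
    \<comment> \<open>Restriction to the one component \<open>U0\<close> of \<open>U1\<close> keeps
      the set closed because the other components are open.\<close>
    have "K = K1 \<inter> - \<Union>(components U1 - {U0})"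
    proof (intro set_eqI iffI)
      fix y assume y: "y \<in> K"
      then have "y \<in> U0" by (simp add: K_def)
      moreover have "y \<notin> D" if "D \<in> components U1" "D \<noteq> U0" for D
        using components_nonoverlap[OF that(1) U0] that(2) \<open>y \<in> U0\<close> by blast
      ultimately show "y \<in> K1 \<inter> - \<Union>(components U1 - {U0})" using y U0s unfolding K1e K_def by blast
    next
      fix y assume y: "y \<in> K1 \<inter> - \<Union>(components U1 - {U0})"
      then have "y \<in> U1" by (simp add: K1e)
      then have "connected_component_set U1 y \<in> components U1" "y \<in> connected_component_set U1 y"
        by (auto intro: componentsI)
      then have "y \<in> U0" using y by blast
      then show "y \<in> K" using y by (simp add: K_def K1e)
    qed
    moreover have "open (\<Union>(components U1 - {U0}))" using open_components[OF U1] by (intro open_Union) blast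
    ultimately show ?thesis using K1 by (simp add: closed_Int closed_Compl)
  qed
  obtain B where B: "B > 0" "\<And>x. x \<in> M \<Longrightarrow> norm x \<le> B" using compact_imp_bounded[OF compact] bounded_pos by metis
  have UU: "U0 \<subseteq> ?U" using U0s by (auto simp: U1_def)
  have bd: "norm (eproj e y) < B + 1" if "y \<in> U0" for y
  proof -
    have y: "y \<in> ?U" using that UU by blast
    have "norm (eproj e y) = norm (eproj e (?\<sigma> y))" using g.lift(2)[of y] y by (simp add: e_def)
    also have "\<dots> \<le> norm (?\<sigma> y)" by (rule norm_eproj_le) (simp add: e_def g.e)
    also have "\<dots> \<le> B" using B(2) g.lift(1)[of y] y by (auto simp: e_def)
    finally show ?thesis by simp
  qed
  have con: "connected (U0 - K)"
  proof (rule g.connected_complement_flat[of U0 "B + 1" K])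
    show "U0 \<subseteq> graph_domain (M \<inter> T) (\<nu> z)" using UU by (simp add: e_def)
    show "y' \<in> U0" if "y \<in> U0" "eproj (\<nu> z) y = eproj (\<nu> z) y'" for y y'
      using that unfolding e_def[symmetric] by (rule U0c)
    show "norm (eproj (\<nu> z) y) < B + 1" if "y \<in> U0" for y unfolding e_def[symmetric] by (rule bd[OF that])
    show "0 < B + 1" using B(1) by linarith
    show "K = {y \<in> U0. graph_lift (M \<inter> T) (\<nu> z) y \<in> flat_points}" unfolding e_def[symmetric] by (rule K_def)
  qed (rule U0o in_components_connected[OF U0] Kc)+
  have "continuous_on (U0 - K) (\<lambda>y. mean_curvature M \<nu> (?\<sigma> y))"
    by (rule continuous_on_compose2[OF mean_curvature_continuous continuous_on_subset[OF g.continuous_lift[folded e_def]]])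
      (use UU g.lift(1)[folded e_def] in blast)+
  moreover have "mean_curvature M \<nu> (?\<sigma> y) \<noteq> 0" if "y \<in> U0 - K" for y
    using that UU g.lift(1)[folded e_def, of y] by (auto simp: K_def flat_points_def)
  ultimately have sg: "(\<forall>y\<in>U0 - K. mean_curvature M \<nu> (?\<sigma> y) > 0) \<or> (\<forall>y\<in>U0 - K. mean_curvature M \<nu> (?\<sigma> y) < 0)"
    by (rule connected_sign[OF con])
  have K0: "mean_curvature M \<nu> (?\<sigma> y) = 0" if "y \<in> K" for y using that by (simp add: K_def flat_points_def)
  have Cz: "C \<subseteq> U0"
  proof (rule components_maximal[OF U0 in_components_connected[OF C]])
    show "C \<subseteq> U1" using Z1(3) ZU by blast
    have "z \<in> U0" using zU1 by (simp add: U0_def)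
    then show "U0 \<inter> C \<noteq> {}" using z by blast
  qed
  show ?thesis
  proof (intro exI[of _ "T \<inter> U0"] conjI)
    show "open (T \<inter> U0)" using g.T U0o by blast
    show "C \<subseteq> T \<inter> U0" using CT Cz by blast
    show "\<forall>y\<in>flat_points \<inter> (T \<inter> U0). connected_component_set flat_points y \<subseteq> T \<inter> U0"
    proof
      fix y assume y: "y \<in> flat_points \<inter> (T \<inter> U0)"
      then have "y \<in> M \<inter> T" by (simp add: flat_points_def)
      then have "?\<sigma> y = y" unfolding e_def by (rule g.lift_self)
      then have "y \<in> Z1" using y U0s O1(2) by (auto simp: U1_def)
      let ?D = "connected_component_set flat_points y"
      have yD: "y \<in> ?D" using y by simp
      have "?D \<subseteq> Z1"
        by (rule component_subset_clopen[OF connected_connected_component connected_component_subset Z1(1) compact_imp_closed[OF Z1(2)]])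
          (use yD \<open>y \<in> Z1\<close> in blast)
      then have "?D \<subseteq> U1" "?D \<subseteq> T" using ZU Z1(4) by auto
      moreover have "?D \<subseteq> U0"
        by (rule components_maximal[OF U0 connected_connected_component \<open>?D \<subseteq> U1\<close>]) (use yD y in blast)
      ultimately show "?D \<subseteq> T \<inter> U0" by blast
    qed
    have H: "mean_curvature M \<nu> m = mean_curvature M \<nu> (?\<sigma> m)" "m \<in> U0" if "m \<in> M \<inter> (T \<inter> U0)" for m
      using that g.lift_self[folded e_def, of m] by auto
    show "(\<forall>m\<in>M \<inter> (T \<inter> U0). 0 \<le> mean_curvature M \<nu> m) \<or> (\<forall>m\<in>M \<inter> (T \<inter> U0). mean_curvature M \<nu> m \<le> 0)"
      using sg
    proof
      assume s: "\<forall>y\<in>U0 - K. mean_curvature M \<nu> (?\<sigma> y) > 0"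
      have "0 \<le> mean_curvature M \<nu> m" if m: "m \<in> M \<inter> (T \<inter> U0)" for m
      proof (cases "m \<in> K")
        case True
        then show ?thesis using H(1)[OF m] K0 by simp
      next
        case False
        then have "m \<in> U0 - K" using H(2)[OF m] by simp
        with s have "mean_curvature M \<nu> (?\<sigma> m) > 0" by (rule bspec)
        then show ?thesis using H(1)[OF m] by linarith
      qed
      then show ?thesis by blast
    next
      assume s: "\<forall>y\<in>U0 - K. mean_curvature M \<nu> (?\<sigma> y) < 0"
      have "mean_curvature M \<nu> m \<le> 0" if m: "m \<in> M \<inter> (T \<inter> U0)" for m
      proof (cases "m \<in> K")
        case True
        then show ?thesis using H(1)[OF m] K0 by simp
      next
        case False
        then have "m \<in> U0 - K" using H(2)[OF m] by simp
        with s have "mean_curvature M \<nu> (?\<sigma> m) < 0" by (rule bspec)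
        then show ?thesis using H(1)[OF m] by linarith
      qed
      then show ?thesis by blast
    qed
  qed
qed

end

section \<open>From local signs to a sign on each component\<close>

context oriented_hypersurface
begin

text \<open>\<open>M\<close> is locally connected: a ball cut with a subspace is convex, and the
  inverse chart carries it to a connected part of \<open>M\<close>.\<close>

lemma component_neighbourhood:
  assumes p: "p \<in> M"
  shows "\<exists>T. open T \<and> p \<in> T \<and> M \<inter> T \<subseteq> connected_component_set M p"
proof -
  obtain U V \<phi> \<psi> S where pU: "p \<in> U" and d: "Ck_diffeomorphism (n + 1) U V \<phi> \<psi>"
    and S: "subspace S" "dim S = n" and img: "\<phi> ` (M \<inter> U) = V \<inter> S"
    using emb p unfolding embedded_submanifold_def by blast
  have opn: "open U" "open V" and hom: "homeomorphism U V \<phi> \<psi>"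
    using d by (auto simp: Ck_diffeomorphism_def)
  have inv: "\<psi> (\<phi> x) = x" "\<phi> x \<in> V" if "x \<in> U" for x
    using homeomorphism_apply1[OF hom that] homeomorphism_image1[OF hom] that by auto
  obtain r where r: "r > 0" "ball (\<phi> p) r \<subseteq> V" using openE[OF opn(2) inv(2)[OF pU]] by blast
  define T where "T = U \<inter> \<phi> -` ball (\<phi> p) r"
  have T: "open T" unfolding T_def
    by (rule continuous_open_preimage[OF homeomorphism_cont1[OF hom] opn(1) open_ball])
  have pT: "p \<in> T" using pU r(1) by (simp add: T_def)
  define L where "L = \<psi> ` (ball (\<phi> p) r \<inter> S)"
  have "connected L"
    unfolding L_def
  proof (rule connected_continuous_image)
    show "continuous_on (ball (\<phi> p) r \<inter> S) \<psi>"
      by (rule continuous_on_subset[OF homeomorphism_cont2[OF hom]]) (use r(2) in blast)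
    show "connected (ball (\<phi> p) r \<inter> S)"
      by (intro convex_connected convex_Int convex_ball subspace_imp_convex S(1))
  qed
  moreover have "L \<subseteq> M"
  proof
    fix y assume "y \<in> L"
    then obtain q where q: "q \<in> ball (\<phi> p) r" "q \<in> S" "y = \<psi> q" by (auto simp: L_def)
    then have "q \<in> \<phi> ` (M \<inter> U)" unfolding img using r(2) by blast
    then show "y \<in> M" using q(3) inv(1) by auto
  qed
  moreover have TL: "M \<inter> T \<subseteq> L"
  proof
    fix x assume x: "x \<in> M \<inter> T"
    then have "\<phi> x \<in> \<phi> ` (M \<inter> U)" by (auto simp: T_def)
    then have "\<phi> x \<in> ball (\<phi> p) r \<inter> S" using x img by (auto simp: T_def)
    then have "\<psi> (\<phi> x) \<in> L" unfolding L_def by (rule imageI)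
    then show "x \<in> L" using inv(1)[of x] x by (simp add: T_def)
  qed
  moreover have "p \<in> L" using TL p pT by blast
  ultimately have "L \<subseteq> connected_component_set M p" using connected_component_maximal by blast
  then show ?thesis using T pT TL by blast
qed

end

context closed_nonneg_hypersurface
begin

text \<open>The neighbourhoods of the two signs form two open sets covering \<open>C\<close>. If
  they are disjoint on \<open>C\<close>, connectedness leaves one sign. If they overlap, the overlap
  consists of flat points and the whole of \<open>C\<close> turns out flat.\<close>

lemma component_sign:
  assumes C: "C \<in> components M"
  shows "(\<forall>p\<in>C. 0 \<le> mean_curvature M \<nu> p) \<or> (\<forall>p\<in>C. mean_curvature M \<nu> p \<le> 0)"
proof -
  let ?H = "mean_curvature M \<nu>"
  \<comment> \<open>The factor \<open>s\<close> is 1 or -1 and selects the sign; the middle clause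
    is saturation with respect to flat components.\<close>
  define good where "good s T \<longleftrightarrow> open T \<and> (\<forall>y\<in>flat_points \<inter> T. connected_component_set flat_points y \<subseteq> T) \<and>
    (\<forall>m\<in>M \<inter> T. 0 \<le> s * ?H m)" for s :: real and T
  have CM: "C \<subseteq> M" "connected C" by (rule in_components_subset[OF C], rule in_components_connected[OF C])
  have cover: "\<exists>T. x \<in> T \<and> (good 1 T \<or> good (- 1) T)" if x: "x \<in> M" for x
  proof (cases "x \<in> flat_points")
    case True
    then have "connected_component_set flat_points x \<in> components flat_points" "x \<in> connected_component_set flat_points x"
      by (auto intro: componentsI)
    then show ?thesis using flat_component_sign[of "connected_component_set flat_points x"]
      unfolding good_def by (metis mult_1 mult_minus_left neg_0_le_iff_le subsetD)
  next
    case False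
    have pre: "\<exists>T. x \<in> T \<and> good s T" if s: "s * ?H x > 0" for s
    proof -
      have "continuous_on M (\<lambda>x. s * ?H x)" by (intro continuous_intros mean_curvature_continuous)
      then have "openin (top_of_set M) (M \<inter> (\<lambda>x. s * ?H x) -` {0<..})"
        by (rule continuous_openin_preimage_gen) simp
      then obtain T where T: "open T" "M \<inter> (\<lambda>x. s * ?H x) -` {0<..} = M \<inter> T" unfolding openin_open by blast
      have pos: "0 < s * ?H m" if "m \<in> M \<inter> T" for m using T(2) that by blast
      have "y \<notin> T" if "y \<in> flat_points" for y using pos[of y] that by (auto simp: flat_points_def)
      then have "good s T" unfolding good_def using T(1) pos less_imp_le by blast
      moreover have "x \<in> T" using T(2) x s by blast
      ultimately show ?thesis by blast
    qed
    have "?H x \<noteq> 0" using False x by (simp add: flat_points_def)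
    then consider "1 * ?H x > 0" | "(- 1) * ?H x > 0" by fastforce
    then show ?thesis using pre by cases blast+
  qed
  define A where "A s = \<Union>{T. good s T}" for s
  have op: "open (A s)" for s unfolding A_def by (intro open_Union) (auto simp: good_def)
  have cov: "C \<subseteq> A 1 \<union> A (- 1)" using cover CM(1) unfolding A_def by blast
  have sg: "0 \<le> s * ?H m" if "m \<in> C" "m \<in> A s" for s m using that CM(1) unfolding A_def good_def by blast
  show ?thesis
  proof (cases "A 1 \<inter> A (- 1) \<inter> C = {}")
    case True
    from connectedD[OF CM(2) op op True cov] have "A 1 \<inter> C = {} \<or> A (- 1) \<inter> C = {}" .
    then show ?thesis
    proof
      assume "A 1 \<inter> C = {}"
      then have "m \<in> A (- 1)" if "m \<in> C" for m using cov that by blast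
      then have "?H m \<le> 0" if "m \<in> C" for m using sg[OF that, of "- 1"] that by simp
      then show ?thesis by blast
    next
      assume "A (- 1) \<inter> C = {}"
      then have "m \<in> A 1" if "m \<in> C" for m using cov that by blast
      then have "0 \<le> ?H m" if "m \<in> C" for m using sg[OF that, of 1] that by simp
      then show ?thesis by blast
    qed
  next
    case False
    then obtain x T1 T2 where x: "x \<in> C" "x \<in> T1" "x \<in> T2" and T: "good 1 T1" "good (- 1) T2"
      unfolding A_def by blast
    have fl: "M \<inter> (T1 \<inter> T2) \<subseteq> flat_points"
    proof
      fix m assume m: "m \<in> M \<inter> (T1 \<inter> T2)"
      have "0 \<le> 1 * ?H m" using T(1) m unfolding good_def by blast
      moreover have "0 \<le> (- 1) * ?H m" using T(2) m unfolding good_def by blast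
      ultimately show "m \<in> flat_points" using m by (simp add: flat_points_def)
    qed
    have xf: "x \<in> flat_points" using fl x CM(1) by blast
    define Z where "Z = connected_component_set flat_points x"
    have Zc: "Z \<in> components flat_points" unfolding Z_def by (rule componentsI[OF xf])
    have xZ: "x \<in> Z" using xf by (simp add: Z_def)
    have "Z \<subseteq> T1" using T(1) xf x(2) unfolding good_def Z_def by blast
    moreover have "Z \<subseteq> T2" using T(2) xf x(3) unfolding good_def Z_def by blast
    ultimately have ZT: "Z \<subseteq> T1 \<inter> T2" by blast
    have lc: "locally compact flat_points"
      using flat_points_compact by (simp add: closed_imp_locally_compact compact_imp_closed)
    have oT: "open (T1 \<inter> T2)" using T unfolding good_def by blast
    obtain Z1 where Z1: "openin (top_of_set flat_points) Z1" "compact Z1" "Z \<subseteq> Z1" "Z1 \<subseteq> T1 \<inter> T2"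
      by (rule Sura_Bura_clopen_subset[OF lc Zc compact_components[OF flat_points_compact Zc] oT ZT])
    obtain O1 where O1: "open O1" "Z1 = flat_points \<inter> O1" using Z1(1) by (auto simp: openin_open)
    have fM: "flat_points \<subseteq> M" by (auto simp: flat_points_def)
    \<comment> \<open>Near \<open>Z1\<close> all points of \<open>M\<close> are flat, so
      \<open>Z1\<close> is open in \<open>M\<close> and not merely among the flat points. Being
      compact too, it contains the connected set \<open>C\<close>.\<close>
    have "Z1 = M \<inter> (T1 \<inter> T2 \<inter> O1)" using O1(2) Z1(4) fl fM by blast
    then have "openin (top_of_set M) Z1" unfolding openin_open using oT O1(1) by blast
    then have "C \<subseteq> Z1"
      by (rule component_subset_clopen[OF CM(2,1) _ compact_imp_closed[OF Z1(2)]]) (use x(1) xZ Z1(3) in blast)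
    then have "?H m = 0" if "m \<in> C" for m using that O1(2) by (auto simp: flat_points_def)
    then show ?thesis by simp
  qed
qed

text \<open>The sign depends on the component of \<open>x\<close> only and is therefore locally
  constant on \<open>M\<close>; a sign read off from the mean curvature at \<open>x\<close> would be
  ambiguous at flat points.\<close>

definition coherent_normal :: "'a \<Rightarrow> 'a" where
  "coherent_normal x = (if \<forall>p\<in>connected_component_set M x. 0 \<le> mean_curvature M \<nu> p then 1 else - 1 :: real) *\<^sub>R \<nu> x"

lemma coherent_normal_local:
  assumes p: "p \<in> M"
  shows "\<exists>T c. open T \<and> p \<in> T \<and> (\<forall>x\<in>M \<inter> T. coherent_normal x = c *\<^sub>R \<nu> x) \<and> 0 \<le> c * mean_curvature M \<nu> p"
proof -
  let ?C = "connected_component_set M"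
  obtain T where T: "open T" "p \<in> T" "M \<inter> T \<subseteq> ?C p" using component_neighbourhood[OF p] by blast
  define c :: real where "c = (if \<forall>q\<in>?C p. 0 \<le> mean_curvature M \<nu> q then 1 else - 1)"
  have "coherent_normal x = c *\<^sub>R \<nu> x" if "x \<in> M \<inter> T" for x
  proof -
    have "x \<in> ?C p" using that T(3) by blast
    then have "?C x = ?C p" by (rule connected_component_eq)
    then show ?thesis by (simp add: coherent_normal_def c_def)
  qed
  moreover have "0 \<le> c * mean_curvature M \<nu> p"
  proof -
    have pc: "p \<in> ?C p" "?C p \<in> components M" using p by (auto intro: componentsI)
    show ?thesis using component_sign[OF pc(2)] pc(1) by (auto simp: c_def)
  qed
  ultimately show ?thesis using T by blast
qed

lemma coherent_normal_field: "unit_normal_field M coherent_normal"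
  unfolding unit_normal_field_def
proof (intro conjI ballI)
  show "continuous_on M coherent_normal"
    unfolding continuous_on_eq_continuous_within
  proof
    fix p assume p: "p \<in> M"
    obtain T c where T: "open T" "p \<in> T" "\<forall>x\<in>M \<inter> T. coherent_normal x = c *\<^sub>R \<nu> x"
      using coherent_normal_local[OF p] by blast
    obtain d where d: "d > 0" "ball p d \<subseteq> T" using openE[OF T(1,2)] by blast
    have "continuous_on M (\<lambda>x. c *\<^sub>R \<nu> x)" by (intro continuous_intros normal_continuous)
    then have "continuous (at p within M) (\<lambda>x. c *\<^sub>R \<nu> x)" using p by (simp add: continuous_on_eq_continuous_within)
    then show "continuous (at p within M) coherent_normal"
    proof (rule continuous_transform_within[OF _ d(1) p])
      fix x assume "x \<in> M" "dist x p < d"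
      then have "x \<in> M \<inter> T" using d(2) by (auto simp: dist_commute)
      then show "c *\<^sub>R \<nu> x = coherent_normal x" using T(3) by simp
    qed
  qed
  fix p assume p: "p \<in> M"
  show "norm (coherent_normal p) = 1" using norm_normal[OF p] by (simp add: coherent_normal_def)
  show "coherent_normal p \<bullet> v = 0" if "v \<in> tangent_space M p" for v
    using that p normal by (simp add: coherent_normal_def unit_normal_field_def)
qed

lemma coherent_mean_curvature:
  assumes p: "p \<in> M"
  shows "0 \<le> mean_curvature M coherent_normal p"
proof -
  obtain T c where T: "open T" "p \<in> T" "\<forall>x\<in>M \<inter> T. coherent_normal x = c *\<^sub>R \<nu> x" "0 \<le> c * mean_curvature M \<nu> p"
    using coherent_normal_local[OF p] by blast
  show ?thesis
    using curvature_rescale(1)[OF coherent_normal_field p T(1,2) bspec[OF T(3)]] T(4) by simp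
qed

end

theorem theorem1:
  fixes M :: "'a::euclidean_space set" and \<nu> :: "'a \<Rightarrow> 'a" and n :: nat
  assumes "n \<ge> 2" and "DIM('a) = n + 1"
    and "embedded_submanifold (n + 1) n M"
    and "compact M"
    and "unit_normal_field M \<nu>"
    and "\<And>p. p \<in> M \<Longrightarrow> scalar_curvature M \<nu> p \<ge> 0"
  shows "(\<exists>\<nu>'. unit_normal_field M \<nu>' \<and>
            ((\<forall>p\<in>M. mean_curvature M \<nu>' p \<ge> 0) \<or> (\<forall>p\<in>M. mean_curvature M \<nu>' p \<le> 0))) \<and>
         (\<forall>C\<in>components M.
            (\<forall>p\<in>C. mean_curvature M \<nu> p \<ge> 0) \<or> (\<forall>p\<in>C. mean_curvature M \<nu> p \<le> 0))"
proof -
  interpret closed_nonneg_hypersurface M \<nu> n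
    by unfold_locales (rule assms; assumption?)+
  show ?thesis
    using coherent_normal_field coherent_mean_curvature component_sign by blast
qed

end
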